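(* Let $N\ge 1$, $1<m<p$ and $\sigma>0$. Set $L=\sigma(m-1)+2(p-1)$, $\alpha=(\sigma+2)/L$, $\beta=(p-m)/L$. For $A>0$ let $f(\cdot;A)\ge 0$ denote the solution of the initial value problem $$(f^m)''(\xi)+\frac{N-1}{\xi}(f^m)'(\xi)+\alpha f(\xi)+\beta\xi f'(\xi)-\xi^{\sigma}f^p(\xi)=0,\quad \xi>0,\qquad f(0)=A,\ f'(0)=0.$$ Then: (a) There exists a unique $A^*\in(0,\infty)$ such that $$\lim_{\xi\to\infty}\xi^{\sigma/(p-1)}f(\xi;A^* )=\left(\frac{1}{p-1}\right)^{1/(p-1)}.$$ (b) For every $K\in(0,\infty)$ there exists a unique $A(K)\in(0,A^* )$ such that $$\lim_{\xi\to\infty}\xi^{(\sigma+2)/(p-m)}f(\xi;A(K))=K.$$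
   Context: The profiles $f(\cdot;A)$ are the profiles of radially symmetric self-similar solutions $U(x,t;A)=t^{-\alpha}f(|x|t^{-\beta};A)$ of the equation $u_t=\Delta u^m-|x|^{\sigma}u^p$ in $\mathbb{R}^N\times(0,\infty)$; non-negative profiles are understood as continued (possibly by zero) on $[0,\infty)$. *)

theory Defs
  imports "HOL-Analysis.Analysis"
begin

definition ssL :: "real \<Rightarrow> real \<Rightarrow> real \<Rightarrow> real" where
  "ssL m p \<sigma> = \<sigma> * (m - 1) + 2 * (p - 1)"

definition ss_alpha :: "real \<Rightarrow> real \<Rightarrow> real \<Rightarrow> real" where
  "ss_alpha m p \<sigma> = (\<sigma> + 2) / ssL m p \<sigma>"

definition ss_beta :: "real \<Rightarrow> real \<Rightarrow> real \<Rightarrow> real" where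
  "ss_beta m p \<sigma> = (p - m) / ssL m p \<sigma>"

definition ss_profile ::
  "nat \<Rightarrow> real \<Rightarrow> real \<Rightarrow> real \<Rightarrow> real \<Rightarrow> (real \<Rightarrow> real) \<Rightarrow> bool" where
  "ss_profile N m p \<sigma> A f \<longleftrightarrow>
     f 0 = A \<and>
     (\<forall>\<xi>\<ge>0. f \<xi> \<ge> 0) \<and>
     continuous_on {0..} f \<and>
     (f has_real_derivative 0) (at 0 within {0..}) \<and>
     (\<forall>\<xi>>0. f \<xi> > 0 \<longrightarrow>
        (\<exists>f1 G G2.
           (f has_real_derivative f1) (at \<xi>) \<and>
           (\<forall>\<eta>>0. f \<eta> > 0 \<longrightarrow> ((\<lambda>x. f x powr m) has_real_derivative G \<eta>) (at \<eta>)) \<and>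
           (G has_real_derivative G2) (at \<xi>) \<and>
           G2 + (real N - 1) / \<xi> * G \<xi> + ss_alpha m p \<sigma> * f \<xi>
             + ss_beta m p \<sigma> * \<xi> * f1 - \<xi> powr \<sigma> * f \<xi> powr p = 0)) \<and>
     (\<forall>\<xi>0>0. f \<xi>0 = 0 \<longrightarrow> (\<forall>\<xi>\<ge>\<xi>0. f \<xi> = 0))"

end

theory Submission
  imports Defs
begin

text \<open>
  In the variable \<open>t = ln \<xi>\<close> put \<open>\<rho> = - \<xi> f'/f\<close>, \<open>X = \<xi>\<^sup>\<sigma> f\<^sup>p\<^sup>-\<^sup>1\<close> and
  \<open>\<Lambda> = \<xi>\<^sup>2 f\<^sup>1\<^sup>-\<^sup>m\<close>; the equation becomes
  \<open>\<rho>' = m \<rho>\<^sup>2 - (N - 2) \<rho> + (\<Lambda> / m) (\<alpha> - \<beta> \<rho> - X)\<close>, \<open>X' = (p - 1) X (\<nu> - \<rho>)\<close> with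
  \<open>\<nu> = \<sigma> / (p - 1)\<close>, and \<open>\<Lambda> \<rightarrow> \<infinity>\<close>. The equilibrium \<open>X = 1 / (p - 1)\<close> of the slow dynamics is unstable, so
  there is a trichotomy for the initial value \<open>A\<close>: the solution starts to increase, or it enters
  an invariant region of fast decay, or it has the critical decay of part (a). The first two
  possibilities are open conditions on \<open>A\<close>, mutually exclusive and both realised, and \<open>(0, \<infinity>)\<close> is connected:
  a critical \<open>A\<close> exists. Part (b) repeats the argument on \<open>(0, A\<^sup>*)\<close> with two explicit invariant
  regions which force \<open>\<xi>\<^sup>\<gamma> f\<close>, \<open>\<gamma> = (\<sigma> + 2) / (p - m)\<close>, to end up strictly below, respectively
  above \<open>K\<close>.

  Uniqueness in both parts is a sliding argument: for \<open>l > 1\<close> the rescaled solution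
  \<open>l\<^sup>-\<^sup>k f(l \<xi>)\<close>, \<open>k = 2 / (m - 1)\<close>, solves the equation with a larger absorption, hence cannot touch
  another solution from below; two solutions with the same behaviour at infinity could be
  brought into contact by decreasing \<open>l\<close> to a first contact value above \<open>1\<close>.
\<close>

subsection \<open>Scalar differential inequalities\<close>

text \<open>For large \<Lambda> the first equation relaxes onto the slow manifold \<alpha> - \<beta>
  \<rho> - X = 0. On it the second one reads X' = (p - 1) X (X - 1/(p-1)) / \<beta>, so the critical
  value repels on both sides; this is why part (a) is a shooting problem. The manifold meets X = 0
  at \<rho> = \<gamma>, the origin of the tails in part (b). There \<Lambda> grows at the rate
  1/\<beta>, which fixes the time scale of the barriers around K.

  Two degeneracies shape the form of the proof. The diffusion degenerates where f vanishes: only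
  positive solutions are constructed, possibly on a bounded interval, and extinction is shown to lie
  in the fast regime instead of being continued through. The coefficient (N - 1)/\<xi> is singular
  at the origin: solutions are built from the equation integrated from 0. The same integral form is
  used when two solutions touch at \<xi> = 0, where the absorption vanishes and the usual comparison
  of second derivatives decides nothing.\<close>

lemma powr_lipschitz_on_interval:
  fixes a b r :: real
  assumes "0 < a"
  obtains C where "C > 0" "\<And>x y. x \<in> {a..b} \<Longrightarrow> y \<in> {a..b} \<Longrightarrow> \<bar>x powr r - y powr r\<bar> \<le> C * \<bar>x - y\<bar>"
proof -
  have "continuous_on {a..b} (\<lambda>x. r * x powr (r - 1))"
    using assms by (intro continuous_intros) auto
  then have "bounded ((\<lambda>x. r * x powr (r - 1)) ` {a..b})"
    by (intro compact_imp_bounded compact_continuous_image) auto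
  then obtain C where C: "C > 0" "\<And>x. x \<in> {a..b} \<Longrightarrow> \<bar>r * x powr (r - 1)\<bar> \<le> C"
    unfolding bounded_pos by auto
  show thesis
  proof (rule that[OF C(1)])
    fix x y assume xy: "x \<in> {a..b}" "y \<in> {a..b}"
    have "norm (x powr r - y powr r) \<le> C * norm (x - y)"
    proof (rule field_differentiable_bound[where S="{a..b}" and f'="\<lambda>x. r * x powr (r - 1)"])
      fix z assume "z \<in> {a..b}"
      then show "((\<lambda>x. x powr r) has_field_derivative r * z powr (r - 1)) (at z within {a..b})"
        using assms by (auto intro!: derivative_eq_intros)
      show "norm (r * z powr (r - 1)) \<le> C" using C(2)[OF \<open>z \<in> _\<close>] by simp
    qed (use xy in auto)
    then show "\<bar>x powr r - y powr r\<bar> \<le> C * \<bar>x - y\<bar>" by simp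
  qed
qed

lemma first_zero:
  fixes u :: "real \<Rightarrow> real"
  assumes ab: "a \<le> b" and c: "continuous_on {a..b} u" and a: "u a > 0" and b: "u b \<le> 0"
  obtains s where "s \<in> {a<..b}" "u s = 0" "\<forall>y\<in>{a..<s}. u y > 0"
proof -
  define Z where "Z = {a..b} \<inter> u -` {..0}"
  have "closed Z" unfolding Z_def using c by (intro continuous_closed_preimage) auto
  then have "compact Z" using bounded_subset[OF bounded_closed_interval[of a b]]
    by (auto simp: compact_eq_bounded_closed Z_def)
  moreover have "b \<in> Z" using b ab by (auto simp: Z_def)
  ultimately obtain s where s: "s \<in> Z" "\<And>y. y \<in> Z \<Longrightarrow> s \<le> y"
    using compact_attains_inf[of Z] by blast
  have sab: "s \<in> {a<..b}" "u s \<le> 0" using s(1) a by (auto simp: Z_def order.order_iff_strict)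
  have pos: "u y > 0" if "y \<in> {a..<s}" for y
    using s(2)[of y] that sab by (force simp: Z_def)
  have "u s = 0"
  proof (rule ccontr)
    assume "u s \<noteq> 0"
    then obtain y where "a \<le> y" "y \<le> s" "u y = 0"
      using IVT2'[of u s 0 a] sab a continuous_on_subset[OF c, of "{a..s}"] by auto
    then show False using pos[of y] \<open>u s \<noteq> 0\<close> by (cases "y = s") auto
  qed
  then show thesis using that sab pos by blast
qed

lemma DERIV_imp_continuous_on:
  "(\<And>x. x \<in> S \<Longrightarrow> (u has_real_derivative u' x) (at x)) \<Longrightarrow> continuous_on S u"
  by (meson DERIV_continuous_on DERIV_subset subset_UNIV)

text \<open>A first zero is approached through positive values, so a positive derivative there is
  impossible. The premise that \<open>u\<close> is nonnegative up to \<open>t\<close> lets a caller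
  first transport other quantities along \<open>{a..t}\<close> by monotonicity and then check the
  sign of \<open>u' t\<close>.\<close>

lemma barrier:
  fixes u u' :: "real \<Rightarrow> real"
  assumes ab: "a \<le> b" and d: "\<And>t. t \<in> {a..b} \<Longrightarrow> (u has_real_derivative u' t) (at t)"
    and a: "u a > 0"
    and z: "\<And>t. t \<in> {a..b} \<Longrightarrow> u t = 0 \<Longrightarrow> (\<And>s. s \<in> {a..t} \<Longrightarrow> u s \<ge> 0) \<Longrightarrow> u' t > 0"
  shows "u b > 0"
proof (rule ccontr)
  assume "\<not> u b > 0"
  then obtain s where s: "s \<in> {a<..b}" "u s = 0" "\<forall>y\<in>{a..<s}. u y > 0"
    using first_zero[OF ab DERIV_imp_continuous_on[OF d] a] by auto
  have sab: "s \<in> {a..b}" using s by auto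
  have "u' s > 0" using z[OF sab s(2)] s(2,3) by (metis atLeastAtMost_iff atLeastLessThan_iff less_eq_real_def)
  then obtain e where e: "e > 0" "\<And>h. h > 0 \<Longrightarrow> h < e \<Longrightarrow> u (s - h) < u s"
    using DERIV_pos_inc_left[OF d[OF sab]] by blast
  define h where "h = min (e / 2) (s - a)"
  have "h > 0" "h < e" "s - h \<in> {a..<s}" using e(1) s by (auto simp: h_def min_def)
  then show False using e(2)[of h] s by fastforce
qed

text \<open>\<open>first_zero\<close> for the time-reversed, negated function. Since
  \<open>u\<close> is negative right after this zero, \<open>u' s\<close> cannot be
  positive.\<close>

lemma last_nonneg:
  fixes u u' :: "real \<Rightarrow> real"
  assumes ab: "a \<le> b" and d: "\<And>t. t \<in> {a..b} \<Longrightarrow> (u has_real_derivative u' t) (at t)"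
    and a: "u a \<ge> 0" and b: "u b < 0"
  obtains s where "s \<in> {a..<b}" "u s = 0" "u' s \<le> 0" "\<forall>t\<in>{s<..b}. u t < 0"
proof -
  have "continuous_on {a..b} u" using d by (rule DERIV_imp_continuous_on)
  then have "continuous_on {a..b} (\<lambda>t. u (a + b - t))"
    by (rule continuous_on_compose2) (auto intro!: continuous_intros)
  then have "continuous_on {a..b} (\<lambda>t. - u (a + b - t))" by (rule continuous_on_minus)
  then obtain r where r: "r \<in> {a<..b}" "u (a + b - r) = 0" "\<forall>y\<in>{a..<r}. u (a + b - y) < 0"
    using first_zero[OF ab, of "\<lambda>t. - u (a + b - t)"] a b by auto
  define s where "s = a + b - r"
  have s: "s \<in> {a..<b}" "u s = 0" using r by (auto simp: s_def)
  have neg: "u y < 0" if "y \<in> {s<..b}" for y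
    using r(3)[rule_format, of "a + b - y"] that by (auto simp: s_def)
  have "u' s \<le> 0"
  proof (rule ccontr)
    assume "\<not> u' s \<le> 0"
    then obtain e where e: "e > 0" "\<And>h. h > 0 \<Longrightarrow> h < e \<Longrightarrow> u s < u (s + h)"
      using DERIV_pos_inc_right[OF d, of s] s by auto
    define h where "h = min (e / 2) (b - s)"
    have "h > 0" "h < e" "s + h \<in> {s<..b}" using e(1) s by (auto simp: h_def min_def)
    then show False using e(2)[of h] neg[of "s + h"] s by auto
  qed
  then show thesis using that[of s] s neg by auto
qed

text \<open>After its last visit to the level \<open>c\<close> the function would stay below
  \<open>c\<close>, hence not decrease, a contradiction. In the limit proofs this turns "reached
  once" into "from then on".\<close>

lemma eventually_ge_of_nondecreasing_below:
  fixes u u' :: "real \<Rightarrow> real"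
  assumes d: "\<And>t. t \<ge> t0 \<Longrightarrow> (u has_real_derivative u' t) (at t)"
    and inc: "\<And>t. t \<ge> t0 \<Longrightarrow> u t < c \<Longrightarrow> u' t \<ge> 0"
    and t1: "t1 \<ge> t0" "u t1 \<ge> c" and t: "t \<ge> t1"
  shows "u t \<ge> c"
proof (rule ccontr)
  assume n: "\<not> u t \<ge> c"
  have d': "((\<lambda>t. u t - c) has_real_derivative u' x) (at x)" if "x \<in> {t1..t}" for x
    using d[of x] that t1 by (auto intro!: derivative_eq_intros)
  have "u t1 - c \<ge> 0" "u t - c < 0" using t1 n by auto
  then obtain s where s: "s \<in> {t1..<t}" "u s - c = 0" "\<forall>x\<in>{s<..t}. u x - c < 0"
    using last_nonneg[OF t d'] by metis
  have "u s \<le> u t"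
  proof (rule DERIV_nonneg_imp_increasing_open[of s t u])
    show "s \<le> t" using s by auto
    fix x assume x: "s < x" "x < t"
    then have "u' x \<ge> 0" using s inc[of x] t1 by auto
    then show "\<exists>y. DERIV u x :> y \<and> 0 \<le> y" using d[of x] x s t1 by auto
  next
    show "continuous_on {s..t} u" by (rule DERIV_imp_continuous_on[OF d]) (use s t1 in auto)
  qed
  then show False using s n by simp
qed

lemma eventually_le_of_nonincreasing_above:
  fixes u u' :: "real \<Rightarrow> real"
  assumes d: "\<And>t. t \<ge> t0 \<Longrightarrow> (u has_real_derivative u' t) (at t)"
    and inc: "\<And>t. t \<ge> t0 \<Longrightarrow> u t > c \<Longrightarrow> u' t \<le> 0"
    and t1: "t1 \<ge> t0" "u t1 \<le> c" and t: "t \<ge> t1"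
  shows "u t \<le> c"
  using eventually_ge_of_nondecreasing_below[of t0 "\<lambda>t. - u t" "\<lambda>t. - u' t" "- c" t1 t] assms
  by (auto intro: DERIV_minus)

lemma unbounded_below_of_deriv_le_neg1:
  fixes u u' :: "real \<Rightarrow> real"
  assumes d: "\<And>t. t \<ge> t0 \<Longrightarrow> (u has_real_derivative u' t) (at t)"
    and le: "\<And>t. t \<ge> t0 \<Longrightarrow> u' t \<le> -1"
  shows "\<exists>t\<ge>t0. u t < c"
proof -
  define t where "t = t0 + \<bar>u t0 - c\<bar> + 1"
  have t: "t0 \<le> t" by (simp add: t_def)
  have "u t + t \<le> u t0 + t0"
  proof (rule DERIV_nonpos_imp_nonincreasing[OF t])
    fix x assume "t0 \<le> x" "x \<le> t"
    then show "\<exists>y. DERIV (\<lambda>t. u t + t) x :> y \<and> y \<le> 0"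
      using d[of x] le[of x] by (intro exI[of _ "u' x + 1"]) (auto intro!: derivative_eq_intros)
  qed
  then have "u t < c" by (simp add: t_def)
  then show ?thesis using t by blast
qed

lemma unbounded_above_of_deriv_ge_1:
  fixes u u' :: "real \<Rightarrow> real"
  assumes d: "\<And>t. t \<ge> t0 \<Longrightarrow> (u has_real_derivative u' t) (at t)"
    and le: "\<And>t. t \<ge> t0 \<Longrightarrow> u' t \<ge> 1"
  shows "\<exists>t\<ge>t0. u t > c"
  using unbounded_below_of_deriv_le_neg1[of t0 "\<lambda>t. - u t" "\<lambda>t. - u' t" "- c"] assms
  by (auto intro: DERIV_minus)

lemma mult_exp_powr:
  fixes c y a :: real
  assumes "c \<ge> 0"
  shows "(c * exp y) powr a = c powr a * exp (a * y)"
proof -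
  have "exp y powr a = exp (a * y)" by (simp add: powr_def)
  then show ?thesis using assms by (simp add: powr_mult)
qed

lemma open_Collect_nhds:
  assumes "\<And>x. P x \<Longrightarrow> \<forall>\<^sub>F y in nhds x. P y"
  shows "open {x. P x}"
proof (subst open_subopen, safe)
  fix x assume "P x"
  from assms[OF this] obtain S where "open S" "x \<in> S" "\<forall>y\<in>S. P y"
    unfolding eventually_nhds by blast
  then show "\<exists>T. open T \<and> x \<in> T \<and> T \<subseteq> {x. P x}" by blast
qed

subsection \<open>The integrated equation\<close>

locale ss_ode =
  fixes N :: nat and m p \<sigma> :: real
  assumes N1: "N \<ge> 1" and m1: "1 < m" and mp: "m < p" and sig: "0 < \<sigma>"
begin

abbreviation al where "al \<equiv> ss_alpha m p \<sigma>"
abbreviation be where "be \<equiv> ss_beta m p \<sigma>"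

lemma ssL_pos: "ssL m p \<sigma> > 0"
  unfolding ssL_def using m1 mp sig by (intro add_pos_pos mult_pos_pos) auto

lemma al_pos: "al > 0" and be_pos: "be > 0"
  unfolding ss_alpha_def ss_beta_def using ssL_pos mp sig by auto

text \<open>Multiply the equation by \<open>s ^ (N - 1)\<close> and write
  \<open>be * s ^ N * f'\<close> as the derivative of \<open>be * s ^ N * f\<close> minus
  \<open>N * be * s ^ (N - 1) * f\<close>. This produces the coefficient
  \<open>real N * be - al\<close> here and the boundary term \<open>be * r * f r\<close> in
  \<open>flux\<close>.\<close>

definition source :: "(real \<Rightarrow> real) \<Rightarrow> real \<Rightarrow> real" where
  "source f s = s ^ (N - 1) * ((real N * be - al) * f s + s powr \<sigma> * f s powr p)"

definition srcint :: "(real \<Rightarrow> real) \<Rightarrow> real \<Rightarrow> real" where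
  "srcint f r = integral {0..r} (source f)"

text \<open>The derivative of the \<open>m\<close>-th power of \<open>f\<close> dictated by the equation, once integrated in
  divergence form; at \<open>r = 0\<close> the quotient has the junk value \<open>0\<close>, which is also its limit.\<close>

definition flux :: "(real \<Rightarrow> real) \<Rightarrow> real \<Rightarrow> real" where
  "flux f r = srcint f r / r ^ (N - 1) - be * r * f r"

definition volterra :: "real \<Rightarrow> (real \<Rightarrow> real) \<Rightarrow> real \<Rightarrow> real" where
  "volterra A f x = A powr m + integral {0..x} (flux f)"

definition pos_cont :: "real \<Rightarrow> (real \<Rightarrow> real) \<Rightarrow> bool" where
  "pos_cont R f \<longleftrightarrow> continuous_on {0..R} f \<and> (\<forall>x\<in>{0..R}. f x > 0)"

lemma pos_cont_mono: "pos_cont R f \<Longrightarrow> r \<le> R \<Longrightarrow> pos_cont r f"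
  unfolding pos_cont_def by (auto intro: continuous_on_subset)

lemma source_cont:
  assumes "pos_cont R f"
  shows "continuous_on {0..R} (source f)"
  using assms sig unfolding source_def pos_cont_def
  by (intro continuous_intros continuous_on_powr') (auto simp: less_imp_le)

lemma source_integrable: "pos_cont R f \<Longrightarrow> r \<le> R \<Longrightarrow> source f integrable_on {0..r}"
  using source_cont[OF pos_cont_mono] by (intro integrable_continuous_real) auto

lemma pow_N: "r * r ^ (N - 1) = (r::real) ^ N"
  using N1 by (metis Suc_diff_1 Suc_le_eq One_nat_def power_Suc)

text \<open>The weight \<open>s ^ (N - 1)\<close> of the integrand pays for the division by
  \<open>r ^ (N - 1)\<close>; the length of the interval is left as a factor, so the singular
  quotient tends to \<open>0\<close> at the origin.\<close>

lemma srcint_bound: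
  fixes g :: "real \<Rightarrow> real"
  assumes g: "g integrable_on {0..r}" and "0 \<le> r"
    and b: "\<And>s. s \<in> {0..r} \<Longrightarrow> \<bar>g s\<bar> \<le> C * s ^ (N - 1)"
  shows "\<bar>integral {0..r} g\<bar> / r ^ (N - 1) \<le> C * r"
proof (cases "r = 0")
  case False
  then have r: "r > 0" using assms by simp
  have C: "0 \<le> C"
    using b[of r] r by (smt (verit) atLeastAtMost_iff mult_nonneg_nonneg mult_less_0_iff zero_less_power)
  have "norm (integral {0..r} g) \<le> integral {0..r} (\<lambda>s. C * r ^ (N - 1))"
  proof (rule integral_norm_bound_integral[OF g])
    fix s assume s: "s \<in> {0..r}"
    have "C * s ^ (N - 1) \<le> C * r ^ (N - 1)"
      using s C by (intro mult_left_mono power_mono) auto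
    then show "norm (g s) \<le> C * r ^ (N - 1)" using b[OF s] by simp
  qed (rule integrable_const_ivl)
  also have "\<dots> = C * r * r ^ (N - 1)" using r by simp
  finally show ?thesis using r by (simp add: divide_le_eq)
qed simp

lemma flux_cont:
  assumes f: "pos_cont R f" and R: "R > 0"
  shows "continuous_on {0..R} (flux f)"
proof -
  have "bounded ((\<lambda>s. (real N * be - al) * f s + s powr \<sigma> * f s powr p) ` {0..R})"
    using f sig unfolding pos_cont_def
    by (intro compact_imp_bounded compact_continuous_image continuous_intros continuous_on_powr')
       (auto simp: less_imp_le)
  then obtain C where C: "C > 0"
    "\<And>s. s \<in> {0..R} \<Longrightarrow> \<bar>(real N * be - al) * f s + s powr \<sigma> * f s powr p\<bar> \<le> C"
    unfolding bounded_pos by auto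
  have src: "\<bar>source f s\<bar> \<le> C * s ^ (N - 1)" if "s \<in> {0..R}" for s
    using mult_left_mono[OF C(2)[OF that], of "s ^ (N - 1)"] that
    by (simp add: source_def abs_mult mult.commute)
  have bd: "\<bar>srcint f r / r ^ (N - 1)\<bar> \<le> C * r" if "r \<in> {0..R}" for r
    using srcint_bound[OF source_integrable[OF f], of r C] that src
    by (auto simp: srcint_def abs_divide)
  have cJ: "continuous_on {0..R} (srcint f)"
    unfolding srcint_def
    using indefinite_integral_continuous_1[OF source_integrable[OF f order_refl]] by simp
  have "continuous_on {0..R} (\<lambda>r. srcint f r / r ^ (N - 1))"
    unfolding continuous_on_eq_continuous_within
  proof
    fix x assume x: "x \<in> {0..R}"
    show "continuous (at x within {0..R}) (\<lambda>r. srcint f r / r ^ (N - 1))"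
    proof (cases "x = 0")
      case True
      have "((\<lambda>r. srcint f r / r ^ (N - 1)) \<longlongrightarrow> 0) (at 0 within {0..R})"
      proof (rule Lim_null_comparison)
        show "\<forall>\<^sub>F r in at 0 within {0..R}. norm (srcint f r / r ^ (N - 1)) \<le> C * r"
          using bd by (auto simp: eventually_at_filter)
        show "((\<lambda>r. C * r) \<longlongrightarrow> 0) (at 0 within {0..R})"
          by (auto intro!: tendsto_eq_intros)
      qed
      then show ?thesis using True by (simp add: continuous_within srcint_def)
    next
      case False
      then show ?thesis
        using cJ x unfolding continuous_on_eq_continuous_within
        by (intro continuous_intros) auto
    qed
  qed
  then show ?thesis
    using f unfolding flux_def pos_cont_def
    by (intro continuous_on_diff continuous_on_mult continuous_on_const continuous_on_id) auto
qed

lemma flux_integrable: "pos_cont R f \<Longrightarrow> R > 0 \<Longrightarrow> r \<le> R \<Longrightarrow> flux f integrable_on {0..r}"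
  by (intro integrable_continuous_real continuous_on_subset[OF flux_cont]) auto

lemma volterra_deriv:
  assumes f: "pos_cont R f" and x: "x \<in> {0..R}" and R: "R > 0"
  shows "(volterra A f has_real_derivative flux f x) (at x within {0..R})"
proof -
  have "((\<lambda>u. integral {0..u} (flux f)) has_real_derivative flux f x) (at x within {0..R})"
    using integral_has_real_derivative[OF flux_cont[OF f R]] x by simp
  then show ?thesis unfolding volterra_def[abs_def] by (auto intro!: derivative_eq_intros)
qed

lemma volterra_cont: "pos_cont R f \<Longrightarrow> R > 0 \<Longrightarrow> continuous_on {0..R} (volterra A f)"
  using volterra_deriv by (meson DERIV_continuous_on)

lemma volterra_0 [simp]: "volterra A f 0 = A powr m"
  by (simp add: volterra_def)

lemma srcint_cong: "(\<And>x. x \<in> {0..r} \<Longrightarrow> f x = g x) \<Longrightarrow> srcint f r = srcint g r"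
  unfolding srcint_def by (intro integral_cong) (simp add: source_def)

lemma flux_cong: "0 \<le> r \<Longrightarrow> (\<And>x. x \<in> {0..r} \<Longrightarrow> f x = g x) \<Longrightarrow> flux f r = flux g r"
  unfolding flux_def using srcint_cong[of r f g] by simp

lemma volterra_cong:
  assumes "\<And>x. x \<in> {0..r} \<Longrightarrow> f x = g x"
  shows "volterra A f r = volterra A g r"
proof -
  have "integral {0..r} (flux f) = integral {0..r} (flux g)"
    using assms by (intro integral_cong flux_cong) auto
  then show ?thesis by (simp add: volterra_def)
qed

text \<open>Differences are measured with the weight \<open>exp (l * s)\<close>: a further
  integration then gains a factor \<open>1 / l\<close>, so that an interval of any length can be
  treated at once. The bound on the \<open>p\<close>-th powers is a separate premise because both
  bounds will be derived from one for the \<open>m\<close>-th powers.\<close>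

lemma flux_diff:
  assumes f: "pos_cont R f" and g: "pos_cont R g" and l: "l \<ge> 0"
    and e1: "\<And>s. s \<in> {0..R} \<Longrightarrow> \<bar>f s - g s\<bar> \<le> e1 * exp (l * s)"
    and e2: "\<And>s. s \<in> {0..R} \<Longrightarrow> \<bar>f s powr p - g s powr p\<bar> \<le> e2 * exp (l * s)"
    and r: "r \<in> {0..R}"
  shows "\<bar>flux f r - flux g r\<bar> \<le>
    (be * R * e1 + R * (\<bar>real N * be - al\<bar> * e1 + R powr \<sigma> * e2)) * exp (l * r)"
proof -
  define C where "C = (\<bar>real N * be - al\<bar> * e1 + R powr \<sigma> * e2) * exp (l * r)"
  have e10: "e1 \<ge> 0" and e20: "e2 \<ge> 0"
    using e1[OF r] e2[OF r] by (smt (verit) exp_gt_zero mult_neg_pos abs_ge_zero)+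
  have C0: "0 \<le> C" unfolding C_def using e10 e20 by simp
  have int: "(\<lambda>s. source f s - source g s) integrable_on {0..r}"
    using source_integrable f g r by (intro integrable_diff) auto
  have "\<bar>integral {0..r} (\<lambda>s. source f s - source g s)\<bar> / r ^ (N - 1) \<le> C * r"
  proof (rule srcint_bound[OF int])
    fix s assume s: "s \<in> {0..r}"
    then have sR: "s \<in> {0..R}" using r by auto
    have E: "exp (l * s) \<le> exp (l * r)" using s l by (simp add: mult_left_mono)
    have "\<bar>(real N * be - al) * (f s - g s) + s powr \<sigma> * (f s powr p - g s powr p)\<bar>
        \<le> \<bar>real N * be - al\<bar> * \<bar>f s - g s\<bar> + s powr \<sigma> * \<bar>f s powr p - g s powr p\<bar>"
      by (rule order_trans[OF abs_triangle_ineq]) (simp add: abs_mult)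
    also have "\<dots> \<le> \<bar>real N * be - al\<bar> * (e1 * exp (l * r)) + R powr \<sigma> * (e2 * exp (l * r))"
    proof (intro add_mono mult_mono)
      show "\<bar>f s - g s\<bar> \<le> e1 * exp (l * r)"
        using e1[OF sR] mult_left_mono[OF E e10] by linarith
      show "\<bar>f s powr p - g s powr p\<bar> \<le> e2 * exp (l * r)"
        using e2[OF sR] mult_left_mono[OF E e20] by linarith
      show "s powr \<sigma> \<le> R powr \<sigma>" using sR sig by (intro powr_mono2) auto
    qed auto
    also have "\<dots> = C" by (simp add: C_def algebra_simps)
    finally have "\<bar>(real N * be - al) * (f s - g s) + s powr \<sigma> * (f s powr p - g s powr p)\<bar> \<le> C" .
    then have "s ^ (N - 1) * \<bar>(real N * be - al) * (f s - g s) + s powr \<sigma> * (f s powr p - g s powr p)\<bar>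
        \<le> s ^ (N - 1) * C" using s by (intro mult_left_mono) auto
    moreover have "source f s - source g s =
        s ^ (N - 1) * ((real N * be - al) * (f s - g s) + s powr \<sigma> * (f s powr p - g s powr p))"
      by (simp add: source_def algebra_simps)
    ultimately show "\<bar>source f s - source g s\<bar> \<le> C * s ^ (N - 1)"
      using s by (simp add: abs_mult mult.commute)
  qed (use r in auto)
  moreover have "integral {0..r} (\<lambda>s. source f s - source g s) = srcint f r - srcint g r"
    unfolding srcint_def using source_integrable f g r by (intro integral_diff) auto
  ultimately have "\<bar>srcint f r - srcint g r\<bar> / r ^ (N - 1) \<le> C * r" by simp
  moreover have "C * r \<le> C * R" using C0 r by (intro mult_left_mono) auto
  moreover have "be * r * \<bar>f r - g r\<bar> \<le> be * R * (e1 * exp (l * r))"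
    using be_pos r e1[OF r] by (intro mult_mono) auto
  moreover have "flux f r - flux g r = (srcint f r - srcint g r) / r ^ (N - 1) - be * r * (f r - g r)"
    by (simp add: flux_def diff_divide_distrib algebra_simps)
  moreover have "\<bar>(srcint f r - srcint g r) / r ^ (N - 1) - be * r * (f r - g r)\<bar> \<le>
      \<bar>srcint f r - srcint g r\<bar> / r ^ (N - 1) + be * r * \<bar>f r - g r\<bar>"
    using be_pos r by (intro order_trans[OF abs_triangle_ineq4]) (auto simp: abs_mult abs_divide)
  ultimately have "\<bar>flux f r - flux g r\<bar> \<le> C * R + be * R * (e1 * exp (l * r))" by linarith
  then show ?thesis by (simp add: C_def algebra_simps)
qed

text \<open>Clamping the \<open>m\<close>-th power to \<open>[a, b]\<close> removes the degeneracy at \<open>0\<close> and the blow-up, so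
  that the Volterra equation becomes globally Lipschitz; its solutions are genuine as long as they stay in \<open>[a, b]\<close>.\<close>

definition trunc :: "real \<Rightarrow> real \<Rightarrow> real \<Rightarrow> real" where
  "trunc a b v = (max a (min b v)) powr (1 / m)"

lemma trunc_pos_cont:
  assumes "0 < a" "a \<le> b" "continuous_on {0..R} u"
  shows "pos_cont R (\<lambda>x. trunc a b (u x))"
  using assms unfolding pos_cont_def trunc_def
  by (auto intro!: continuous_intros)

text \<open>The same \<open>l\<close> is the exponent of the weight and twice the Lipschitz
  constant; integrating \<open>exp (l * s)\<close> leaves the contraction factor
  \<open>1 / 2\<close>.\<close>

definition flux_lip :: "real \<Rightarrow> real \<Rightarrow> real \<Rightarrow> real \<Rightarrow> bool" where
  "flux_lip a b R l \<longleftrightarrow> (\<forall>u v M x. continuous_on {0..R} u \<longrightarrow> continuous_on {0..R} v \<longrightarrow>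
    (\<forall>s\<in>{0..R}. \<bar>u s - v s\<bar> \<le> M * exp (l * s)) \<longrightarrow> x \<in> {0..R} \<longrightarrow>
    \<bar>flux (\<lambda>s. trunc a b (u s)) x - flux (\<lambda>s. trunc a b (v s)) x\<bar> \<le> l / 2 * M * exp (l * x))"

lemma flux_lipD:
  assumes "flux_lip a b R l" "continuous_on {0..R} u" "continuous_on {0..R} v"
    "\<And>s. s \<in> {0..R} \<Longrightarrow> \<bar>u s - v s\<bar> \<le> M * exp (l * s)" "x \<in> {0..R}"
  shows "\<bar>flux (\<lambda>s. trunc a b (u s)) x - flux (\<lambda>s. trunc a b (v s)) x\<bar> \<le> l / 2 * M * exp (l * x)"
  using assms unfolding flux_lip_def by blast

lemma trunc_flux_diff:
  assumes ab: "0 < a" "a \<le> b" and R: "0 < R"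
  obtains l where "l > 0" "flux_lip a b R l"
proof -
  obtain c1 where c1: "c1 > 0" "\<And>x y. x \<in> {a..b} \<Longrightarrow> y \<in> {a..b} \<Longrightarrow> \<bar>x powr (1/m) - y powr (1/m)\<bar> \<le> c1 * \<bar>x - y\<bar>"
    using powr_lipschitz_on_interval[OF ab(1)] by metis
  obtain c2 where c2: "c2 > 0" "\<And>x y. x \<in> {a..b} \<Longrightarrow> y \<in> {a..b} \<Longrightarrow> \<bar>x powr (p/m) - y powr (p/m)\<bar> \<le> c2 * \<bar>x - y\<bar>"
    using powr_lipschitz_on_interval[OF ab(1)] by metis
  \<comment> \<open>The constant in \<open>flux_diff\<close> does not depend on the exponent of the
    weight, so the exponent may be defined as twice that constant.\<close>
  define l where "l = 2 * (be * R * c1 + R * (\<bar>real N * be - al\<bar> * c1 + R powr \<sigma> * c2))"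
  have l: "l > 0" unfolding l_def using be_pos R c1 c2
    by (intro mult_pos_pos add_pos_nonneg) auto
  have cl: "max a (min b z) \<in> {a..b}" for z using ab by auto
  have lip: "\<bar>max a (min b z) - max a (min b w)\<bar> \<le> \<bar>z - w\<bar>" for z w by auto
  show thesis
  proof (rule that[OF l], unfold flux_lip_def, intro allI impI)
    fix u v :: "real \<Rightarrow> real" and M x
    assume uv: "continuous_on {0..R} u" "continuous_on {0..R} v"
      and M': "\<forall>s\<in>{0..R}. \<bar>u s - v s\<bar> \<le> M * exp (l * s)" and x: "x \<in> {0..R}"
    note M = M'[rule_format]
    have "\<bar>flux (\<lambda>s. trunc a b (u s)) x - flux (\<lambda>s. trunc a b (v s)) x\<bar> \<le>
      (be * R * (c1 * M) + R * (\<bar>real N * be - al\<bar> * (c1 * M) + R powr \<sigma> * (c2 * M))) * exp (l * x)"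
    proof (rule flux_diff[OF trunc_pos_cont trunc_pos_cont])
      fix s assume s: "s \<in> {0..R}"
      have "\<bar>trunc a b (u s) - trunc a b (v s)\<bar> \<le> c1 * \<bar>u s - v s\<bar>"
        unfolding trunc_def using c1(2)[OF cl cl] mult_left_mono[OF lip less_imp_le[OF c1(1)]]
        by (meson order_trans)
      also have "\<dots> \<le> c1 * (M * exp (l * s))" using M[OF s] c1 by simp
      finally show "\<bar>trunc a b (u s) - trunc a b (v s)\<bar> \<le> c1 * M * exp (l * s)" by (simp add: mult.assoc)
      have "\<bar>trunc a b (u s) powr p - trunc a b (v s) powr p\<bar> \<le> c2 * \<bar>u s - v s\<bar>"
        unfolding trunc_def powr_powr using c2(2)[OF cl cl] mult_left_mono[OF lip less_imp_le[OF c2(1)]]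
        by (simp) (meson order_trans)
      also have "\<dots> \<le> c2 * (M * exp (l * s))" using M[OF s] c2 by simp
      finally show "\<bar>trunc a b (u s) powr p - trunc a b (v s) powr p\<bar> \<le> c2 * M * exp (l * s)" by (simp add: mult.assoc)
    qed (use ab uv l x in auto)
    also have "\<dots> = l / 2 * M * exp (l * x)" by (simp add: l_def algebra_simps)
    finally show "\<bar>flux (\<lambda>s. trunc a b (u s)) x - flux (\<lambda>s. trunc a b (v s)) x\<bar> \<le> l / 2 * M * exp (l * x)" .
  qed
qed

lemma volterra_diff:
  assumes f: "pos_cont R f" and g: "pos_cont R g" and l: "l > 0"
    and b: "\<And>s. s \<in> {0..R} \<Longrightarrow> \<bar>flux f s - flux g s\<bar> \<le> l / 2 * M * exp (l * s)" and x: "x \<in> {0..R}" and R: "R > 0"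
  shows "\<bar>volterra A f x - volterra A' g x\<bar> \<le> \<bar>A powr m - A' powr m\<bar> + M / 2 * exp (l * x)"
proof -
  have M: "M \<ge> 0" using b[OF x] l by (smt (verit) abs_ge_zero divide_pos_pos exp_gt_zero mult_neg_pos mult_pos_neg)
  have I: "((\<lambda>s. l / 2 * M * exp (l * s)) has_integral (M / 2 * exp (l * x) - M / 2 * exp (l * 0))) {0..x}"
    using x l by (intro fundamental_theorem_of_calculus)
      (auto intro!: derivative_eq_intros simp: has_real_derivative_iff_has_vector_derivative[symmetric])
  moreover have "norm (integral {0..x} (\<lambda>s. flux f s - flux g s)) \<le> integral {0..x} (\<lambda>s. l / 2 * M * exp (l * s))"
    using x R f g b by (intro integral_norm_bound_integral integrable_diff flux_integrable integrable_continuous_real continuous_intros) auto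
  moreover have "integral {0..x} (\<lambda>s. flux f s - flux g s) = integral {0..x} (flux f) - integral {0..x} (flux g)"
    using flux_integrable f g x R by (intro integral_diff) auto
  ultimately have "\<bar>integral {0..x} (flux f) - integral {0..x} (flux g)\<bar> \<le> M / 2 * exp (l * x)"
    using M unfolding integral_unique[OF I] by simp
  then show ?thesis unfolding volterra_def by linarith
qed

definition trunc_sol :: "real \<Rightarrow> real \<Rightarrow> real \<Rightarrow> real \<Rightarrow> (real \<Rightarrow> real) \<Rightarrow> bool" where
  "trunc_sol a b R A u \<longleftrightarrow> continuous_on {0..R} u \<and>
     (\<forall>x\<in>{0..R}. u x = volterra A (\<lambda>s. trunc a b (u s)) x)"

lemma trunc_exists:
  assumes ab: "0 < a" "a \<le> b" and R: "0 < R"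
  shows "\<exists>u. trunc_sol a b R A u"
proof -
  obtain l where l: "l > 0" "flux_lip a b R l"
    using trunc_flux_diff[OF ab R] .
  \<comment> \<open>Projecting the line onto \<open>{0..R}\<close> makes every iterate a bounded
    continuous function on all reals, an element of a complete space.\<close>
  define c where "c x = max 0 (min R x)" for x :: real
  have c: "c x \<in> {0..R}" for x using R by (auto simp: c_def)
  have cc: "continuous_on UNIV c" unfolding c_def by (intro continuous_intros)
  \<comment> \<open>The unknown is \<open>y s = exp (- l * s) * u s\<close>, so that the plain
    supremum distance of \<open>y\<close> is the weighted distance of \<open>u\<close>.\<close>
  define T where "T y x = volterra A (\<lambda>s. trunc a b (exp (l * s) * y s)) x" for y :: "real \<Rightarrow> real" and x
  define S where "S y = Bcontfun (\<lambda>x. exp (- l * c x) * T (apply_bcontfun y) (c x))" for y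
  have uc: "continuous_on {0..R} (\<lambda>s. exp (l * s) * apply_bcontfun y s)" for y
    by (intro continuous_intros continuous_on_subset[OF continuous_on_apply_bcontfun]) auto
  have Tc: "continuous_on {0..R} (T (apply_bcontfun y))" for y
    unfolding T_def using volterra_cont[OF trunc_pos_cont[OF ab uc] R] by simp
  have in_b: "(\<lambda>x. exp (- l * c x) * T (apply_bcontfun y) (c x)) \<in> bcontfun" for y
  proof -
    have g: "continuous_on {0..R} (\<lambda>x. exp (- l * x) * T (apply_bcontfun y) x)"
      by (intro continuous_intros Tc)
    have "continuous_on UNIV (\<lambda>x. exp (- l * c x) * T (apply_bcontfun y) (c x))"
      by (rule continuous_on_compose2[OF g cc]) (use c in auto)
    moreover have "bounded (range (\<lambda>x. exp (- l * c x) * T (apply_bcontfun y) (c x)))"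
      by (rule bounded_subset[OF compact_imp_bounded[OF compact_continuous_image[OF g]]]) (use c in auto)
    ultimately show ?thesis by (simp add: bcontfun_def)
  qed
  have Sapp: "apply_bcontfun (S y) x = exp (- l * c x) * T (apply_bcontfun y) (c x)" for y x
    unfolding S_def using Bcontfun_inverse[OF in_b] by simp
  have "\<exists>!y. y \<in> UNIV \<and> S y = y"
  proof (rule Banach_fix[of UNIV "1/2" S])
    show "dist (S y) (S z) \<le> 1 / 2 * dist y z" for y z
    proof (rule dist_bound)
      fix x
      have d: "\<bar>exp (l * s) * apply_bcontfun y s - exp (l * s) * apply_bcontfun z s\<bar> \<le> dist y z * exp (l * s)" for s
        using mult_left_mono[OF dist_bounded[of y s z], of "exp (l * s)"]
      unfolding right_diff_distrib[symmetric] abs_mult by (simp add: dist_real_def mult.commute)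
      have "\<bar>T (apply_bcontfun y) (c x) - T (apply_bcontfun z) (c x)\<bar> \<le> \<bar>A powr m - A powr m\<bar> + dist y z / 2 * exp (l * c x)"
        unfolding T_def
        by (intro volterra_diff[OF trunc_pos_cont[OF ab uc] trunc_pos_cont[OF ab uc] l(1)] flux_lipD[OF l(2)] uc d c R)
      then have "exp (- l * c x) * \<bar>T (apply_bcontfun y) (c x) - T (apply_bcontfun z) (c x)\<bar> \<le>
         exp (- l * c x) * (dist y z / 2 * exp (l * c x))"
        by (intro mult_left_mono) auto
      then show "dist (apply_bcontfun (S y) x) (apply_bcontfun (S z) x) \<le> 1 / 2 * dist y z"
        unfolding Sapp by (simp add: dist_real_def right_diff_distrib[symmetric] abs_mult exp_minus field_simps)
    qed
  qed (auto simp: complete_UNIV)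
  then obtain y where y: "S y = y" by auto
  show ?thesis unfolding trunc_sol_def
  proof (intro exI conjI ballI, rule uc[of y])
    fix x assume x: "x \<in> {0..R}"
    then have "c x = x" by (auto simp: c_def)
    then have "apply_bcontfun y x = exp (- l * x) * T (apply_bcontfun y) x"
      using Sapp[of y x] y by simp
    then show "exp (l * x) * apply_bcontfun y x = volterra A (\<lambda>s. trunc a b (exp (l * s) * apply_bcontfun y s)) x"
      by (simp add: T_def exp_minus)
  qed
qed

definition data_lip :: "real \<Rightarrow> real \<Rightarrow> real \<Rightarrow> real \<Rightarrow> bool" where
  "data_lip a b R C \<longleftrightarrow> (\<forall>u v A A' x. trunc_sol a b R A u \<longrightarrow> trunc_sol a b R A' v \<longrightarrow> x \<in> {0..R} \<longrightarrow>
    \<bar>u x - v x\<bar> \<le> C * \<bar>A powr m - A' powr m\<bar> \<and>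
    \<bar>flux (\<lambda>s. trunc a b (u s)) x - flux (\<lambda>s. trunc a b (v s)) x\<bar> \<le> C * \<bar>A powr m - A' powr m\<bar>)"

lemma data_lipD:
  assumes "data_lip a b R C" "trunc_sol a b R A u" "trunc_sol a b R A' v" "x \<in> {0..R}"
  shows "\<bar>u x - v x\<bar> \<le> C * \<bar>A powr m - A' powr m\<bar>"
    "\<bar>flux (\<lambda>s. trunc a b (u s)) x - flux (\<lambda>s. trunc a b (v s)) x\<bar> \<le> C * \<bar>A powr m - A' powr m\<bar>"
  using assms unfolding data_lip_def by blast+

text \<open>A Gronwall argument by maximum: where the weighted difference \<open>w\<close> is
  largest, \<open>volterra_diff\<close> bounds it by the difference of the data plus
  \<open>w / 2\<close>, and the second term is absorbed.\<close>

lemma trunc_dependence: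
  assumes ab: "0 < a" "a \<le> b" and R: "0 < R"
  shows "\<exists>C>0. data_lip a b R C"
proof -
  obtain l where l: "l > 0" "flux_lip a b R l"
    using trunc_flux_diff[OF ab R] .
  define C where "C = 2 * exp (l * R) + l * exp (l * R)"
  show ?thesis unfolding data_lip_def
  proof (intro exI[of _ C] conjI[of "C > 0"] allI impI)
    show "C > 0" using l(1) by (simp add: C_def add_pos_pos)
    fix u v A A' x
    assume "trunc_sol a b R A u" "trunc_sol a b R A' v" and x: "x \<in> {0..R}"
    then have u: "continuous_on {0..R} u" and v: "continuous_on {0..R} v"
      and ue: "\<And>x. x \<in> {0..R} \<Longrightarrow> u x = volterra A (\<lambda>s. trunc a b (u s)) x"
      and ve: "\<And>x. x \<in> {0..R} \<Longrightarrow> v x = volterra A' (\<lambda>s. trunc a b (v s)) x"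
      by (auto simp: trunc_sol_def)
    define w where "w s = exp (- l * s) * \<bar>u s - v s\<bar>" for s
    have "continuous_on {0..R} w" unfolding w_def using u v by (intro continuous_intros)
    then obtain s0 where s0: "s0 \<in> {0..R}" "\<And>s. s \<in> {0..R} \<Longrightarrow> w s \<le> w s0"
      using continuous_attains_sup[of "{0..R}" w] R by auto
    have d: "\<bar>u s - v s\<bar> \<le> w s0 * exp (l * s)" if "s \<in> {0..R}" for s
      using s0(2)[OF that] by (simp add: w_def exp_minus field_simps)
    have "\<bar>u s0 - v s0\<bar> \<le> \<bar>A powr m - A' powr m\<bar> + w s0 / 2 * exp (l * s0)"
      unfolding ue[OF s0(1)] ve[OF s0(1)]
      by (intro volterra_diff[OF trunc_pos_cont[OF ab u] trunc_pos_cont[OF ab v] l(1)] flux_lipD[OF l(2)] u v d s0(1) R)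
    then have "exp (- l * s0) * \<bar>u s0 - v s0\<bar> \<le> exp (- l * s0) * (\<bar>A powr m - A' powr m\<bar> + w s0 / 2 * exp (l * s0))"
      by (intro mult_left_mono) auto
    then have "w s0 \<le> exp (- l * s0) * \<bar>A powr m - A' powr m\<bar> + w s0 / 2"
      by (simp add: w_def[of s0] exp_minus field_simps)
    moreover have "exp (- l * s0) * \<bar>A powr m - A' powr m\<bar> \<le> 1 * \<bar>A powr m - A' powr m\<bar>"
      using l(1) s0(1) by (intro mult_right_mono) auto
    ultimately have w2: "w s0 \<le> 2 * \<bar>A powr m - A' powr m\<bar>" by simp
    have E: "exp (l * x) \<le> exp (l * R)" using x l(1) by simp
    have w0: "w s0 \<ge> 0" by (simp add: w_def)
    have we: "w s0 * exp (l * x) \<le> 2 * \<bar>A powr m - A' powr m\<bar> * exp (l * R)"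
      using w2 E by (intro mult_mono) auto
    have "\<bar>u x - v x\<bar> \<le> 2 * \<bar>A powr m - A' powr m\<bar> * exp (l * R)"
      using d[OF x] we by linarith
    moreover have "\<bar>flux (\<lambda>s. trunc a b (u s)) x - flux (\<lambda>s. trunc a b (v s)) x\<bar> \<le> l / 2 * w s0 * exp (l * x)"
      using flux_lipD[OF l(2) u v d x] .
    moreover have "l / 2 * w s0 * exp (l * x) \<le> l / 2 * (2 * \<bar>A powr m - A' powr m\<bar> * exp (l * R))"
      using mult_left_mono[OF we, of "l / 2"] l(1) by (simp add: mult.assoc)
    ultimately have fin: "\<bar>u x - v x\<bar> \<le> 2 * \<bar>A powr m - A' powr m\<bar> * exp (l * R)"
      "\<bar>flux (\<lambda>s. trunc a b (u s)) x - flux (\<lambda>s. trunc a b (v s)) x\<bar> \<le> l / 2 * (2 * \<bar>A powr m - A' powr m\<bar> * exp (l * R))"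
      by linarith+
    show "\<bar>u x - v x\<bar> \<le> C * \<bar>A powr m - A' powr m\<bar> \<and>
      \<bar>flux (\<lambda>s. trunc a b (u s)) x - flux (\<lambda>s. trunc a b (v s)) x\<bar> \<le> C * \<bar>A powr m - A' powr m\<bar>"
    proof -
      define D E where "D = \<bar>A powr m - A' powr m\<bar>" and "E = exp (l * R)"
      have "0 \<le> D * E" "0 \<le> l * (D * E)" using l(1) by (auto simp: D_def E_def)
      moreover have "C * D = 2 * (D * E) + l * (D * E)" by (simp add: C_def E_def algebra_simps)
      moreover have "2 * D * E = 2 * (D * E)" "l / 2 * (2 * D * E) = l * (D * E)" by simp_all
      ultimately show ?thesis
        using fin[folded D_def E_def] unfolding D_def[symmetric] by linarith
    qed
  qed
qed

subsection \<open>The positive solution and its dependence on the initial value\<close>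

definition sol :: "real \<Rightarrow> real \<Rightarrow> (real \<Rightarrow> real) \<Rightarrow> bool" where
  "sol A R f \<longleftrightarrow> 0 < A \<and> 0 < R \<and> pos_cont R f \<and> (\<forall>x\<in>{0..R}. f x powr m = volterra A f x)"

lemma sol_mono: "sol A R f \<Longrightarrow> 0 < r \<Longrightarrow> r \<le> R \<Longrightarrow> sol A r f"
  unfolding sol_def using pos_cont_mono by auto

lemma powr_m_inj: "0 < (x::real) \<Longrightarrow> 0 < y \<Longrightarrow> x powr m = y powr m \<Longrightarrow> x = y"
proof -
  assume xy: "0 < x" "0 < y" and eq: "x powr m = y powr m"
  have "x = (x powr m) powr (1 / m)" "y = (y powr m) powr (1 / m)"
    using m1 xy by (simp_all add: powr_powr)
  then show "x = y" using eq by simp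
qed

lemma sol_0: "sol A R f \<Longrightarrow> f 0 = A"
  unfolding sol_def pos_cont_def by (rule powr_m_inj) auto

lemma trunc_id: "0 < y \<Longrightarrow> a \<le> y powr m \<Longrightarrow> y powr m \<le> b \<Longrightarrow> trunc a b (y powr m) = y"
  unfolding trunc_def using m1 by (simp add: powr_powr max_def min_def)

lemma trunc_powr: "0 < a \<Longrightarrow> a \<le> v \<Longrightarrow> v \<le> b \<Longrightarrow> trunc a b v powr m = v"
  unfolding trunc_def using m1 by (simp add: powr_powr max_def min_def)

lemma sol_imp_trunc_sol:
  assumes f: "sol A R f" and ab: "0 < a" "\<And>x. x \<in> {0..R} \<Longrightarrow> a \<le> f x powr m \<and> f x powr m \<le> b"
  shows "trunc_sol a b R A (\<lambda>x. f x powr m)"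
  unfolding trunc_sol_def
proof (intro conjI ballI)
  show "continuous_on {0..R} (\<lambda>x. f x powr m)"
    using f by (auto simp: sol_def pos_cont_def intro!: continuous_intros)
  fix x assume x: "x \<in> {0..R}"
  have "volterra A (\<lambda>s. trunc a b (f s powr m)) x = volterra A f x"
    using x ab f by (intro volterra_cong trunc_id) (auto simp: sol_def pos_cont_def)
  then show "f x powr m = volterra A (\<lambda>s. trunc a b (f s powr m)) x" using f x by (simp add: sol_def)
qed

lemma trunc_sol_imp_sol:
  assumes "0 < A" "0 < R" "0 < a" "a \<le> b" "trunc_sol a b R A u"
    and "\<And>x. x \<in> {0..R} \<Longrightarrow> a \<le> u x \<and> u x \<le> b"
  shows "sol A R (\<lambda>s. trunc a b (u s))"
  using assms trunc_pos_cont[of a b R u] by (auto simp: sol_def trunc_powr trunc_sol_def)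

lemma trunc_sol_mono: "trunc_sol a b R A u \<Longrightarrow> r \<le> R \<Longrightarrow> trunc_sol a b r A u"
  unfolding trunc_sol_def by (auto intro: continuous_on_subset)

lemma pos_cont_powr_bounds:
  assumes "pos_cont R f" "R > 0"
  obtains a b where "0 < a" "a \<le> b" "\<And>x. x \<in> {0..R} \<Longrightarrow> a \<le> f x powr m \<and> f x powr m \<le> b"
proof -
  have c: "continuous_on {0..R} (\<lambda>x. f x powr m)"
    using assms by (auto simp: pos_cont_def intro!: continuous_intros)
  obtain x1 where x1: "x1 \<in> {0..R}" "\<And>x. x \<in> {0..R} \<Longrightarrow> f x1 powr m \<le> f x powr m"
    using continuous_attains_inf[OF _ _ c] assms(2) by auto
  obtain x2 where x2: "x2 \<in> {0..R}" "\<And>x. x \<in> {0..R} \<Longrightarrow> f x powr m \<le> f x2 powr m"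
    using continuous_attains_sup[OF _ _ c] assms(2) by auto
  have "f x1 > 0" using x1 assms(1) unfolding pos_cont_def by blast
  then have "0 < f x1 powr m" by simp
  then show thesis using that x1 x2 by blast
qed

lemma sol_unique:
  assumes f: "sol A R f" and g: "sol A R g" and x: "x \<in> {0..R}"
  shows "f x = g x"
proof -
  have R: "R > 0" using f by (simp add: sol_def)
  have pf: "pos_cont R f" and pg: "pos_cont R g" using f g by (auto simp: sol_def)
  obtain a b where ab: "0 < a" "a \<le> b" "\<And>x. x \<in> {0..R} \<Longrightarrow> a \<le> f x powr m \<and> f x powr m \<le> b"
    using pos_cont_powr_bounds[OF pf R] by metis
  obtain a' b' where ab': "0 < a'" "a' \<le> b'" "\<And>x. x \<in> {0..R} \<Longrightarrow> a' \<le> g x powr m \<and> g x powr m \<le> b'"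
    using pos_cont_powr_bounds[OF pg R] by metis
  define c d where "c = min a a'" and "d = max b b'"
  have cd: "0 < c" "c \<le> d" using ab ab' by (auto simp: c_def d_def)
  have fb: "\<And>x. x \<in> {0..R} \<Longrightarrow> c \<le> f x powr m \<and> f x powr m \<le> d"
    and gb: "\<And>x. x \<in> {0..R} \<Longrightarrow> c \<le> g x powr m \<and> g x powr m \<le> d"
    using ab(3) ab'(3) by (auto simp: c_def d_def min_le_iff_disj le_max_iff_disj)
  obtain C where C: "data_lip c d R C"
    using trunc_dependence[OF cd R] by blast
  have "\<bar>f x powr m - g x powr m\<bar> \<le> C * \<bar>A powr m - A powr m\<bar>"
    using data_lipD(1)[OF C sol_imp_trunc_sol[OF f cd(1) fb] sol_imp_trunc_sol[OF g cd(1) gb] x] .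
  then have "f x powr m = g x powr m" by simp
  moreover have "f x > 0" "g x > 0" using pf pg x by (auto simp: pos_cont_def)
  ultimately show ?thesis using powr_m_inj by blast
qed

definition solvable :: "real \<Rightarrow> real \<Rightarrow> bool" where "solvable A R \<longleftrightarrow> (\<exists>f. sol A R f)"

text \<open>A maximal solution without a maximal interval: the value at \<open>x\<close> is read off
  a solution on \<open>{0..x}\<close>, and uniqueness makes these readings consistent. Where no
  solution reaches \<open>x\<close> the value is arbitrary, hence the guards \<open>solvable\<close>
  throughout.\<close>

definition F :: "real \<Rightarrow> real \<Rightarrow> real" where
  "F A x = (if x = 0 then A else (SOME f. sol A x f) x)"

definition FG :: "real \<Rightarrow> real \<Rightarrow> real" where "FG A = flux (F A)"

lemma F_0 [simp]: "F A 0 = A" by (simp add: F_def)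

lemma F_eq:
  assumes f: "sol A R f" and x: "x \<in> {0..R}"
  shows "F A x = f x"
proof (cases "x = 0")
  case False
  then have s: "sol A x f" using sol_mono[OF f] x by auto
  then have "sol A x (SOME f. sol A x f)" by (rule someI[where P="sol A x"])
  from sol_unique[OF this s] False x show ?thesis by (simp add: F_def)
qed (use sol_0[OF f] in simp)

lemma sol_cong:
  assumes f: "sol A R f" and eq: "\<And>x. x \<in> {0..R} \<Longrightarrow> g x = f x"
  shows "sol A R g"
proof -
  have "continuous_on {0..R} g" using f eq continuous_on_cong[of "{0..R}" "{0..R}" g f]
    by (auto simp: sol_def pos_cont_def)
  moreover have "volterra A g x = volterra A f x" if "x \<in> {0..R}" for x
    using that eq by (intro volterra_cong) auto
  ultimately show ?thesis using f eq by (auto simp: sol_def pos_cont_def)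
qed

lemma F_sol: "solvable A R \<Longrightarrow> sol A R (F A)"
  unfolding solvable_def using sol_cong F_eq by blast

lemma solvable_mono: "solvable A R \<Longrightarrow> 0 < r \<Longrightarrow> r \<le> R \<Longrightarrow> solvable A r"
  unfolding solvable_def using sol_mono by blast

lemma solvable_pos: "solvable A R \<Longrightarrow> 0 < A" "solvable A R \<Longrightarrow> 0 < R"
  unfolding solvable_def sol_def by auto

lemma F_pos: "solvable A R \<Longrightarrow> x \<in> {0..R} \<Longrightarrow> F A x > 0"
  using F_sol unfolding sol_def pos_cont_def by auto

lemma F_cont: "solvable A R \<Longrightarrow> continuous_on {0..R} (F A)"
  using F_sol unfolding sol_def pos_cont_def by auto

lemma FG_cont: "solvable A R \<Longrightarrow> continuous_on {0..R} (FG A)"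
  unfolding FG_def using F_sol flux_cont unfolding sol_def by auto

lemma FG_0 [simp]: "FG A 0 = 0"
  by (simp add: FG_def flux_def srcint_def)

text \<open>The truncated problem is solved on the longer interval \<open>{0..R+1}\<close> for all
  data at once. For the given \<open>A\<close> its solution stays well inside the clamp slightly
  beyond \<open>R\<close>; the Lipschitz dependence keeps neighbouring solutions inside too, so they
  are genuine. Openness of existence and continuity come out together.\<close>

lemma dependence:
  assumes d: "solvable A R" and e: "e > 0"
  obtains R' where "R' > R" "\<forall>\<^sub>F A' in nhds A. solvable A' R' \<and> \<bar>F A' R powr m - F A R powr m\<bar> < e \<and> \<bar>FG A' R - FG A R\<bar> < e"
proof -
  have s: "sol A R (F A)" using F_sol[OF d] .
  have R: "R > 0" and A: "A > 0" using solvable_pos[OF d] by auto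
  have pf: "pos_cont R (F A)" using s by (simp add: sol_def)
  obtain a0 b0 where ab0: "0 < a0" "a0 \<le> b0" "\<And>x. x \<in> {0..R} \<Longrightarrow> a0 \<le> F A x powr m \<and> F A x powr m \<le> b0"
    using pos_cont_powr_bounds[OF pf R] by metis
  \<comment> \<open>The margin: the solution may drift by \<open>a / 2\<close> beyond
    \<open>R\<close>, and a neighbour may differ by another \<open>a / 2\<close>, before the clamp
    acts.\<close>
  define a b where "a = a0 / 2" and "b = b0 + a0"
  have ab: "0 < a" "a \<le> b" using ab0 by (auto simp: a_def b_def)
  have R1: "R + 1 > 0" using R by simp
  obtain C where C: "data_lip a b (R+1) C"
    using trunc_dependence[OF ab R1] by blast
  obtain C2 where C2: "data_lip a b R C2"
    using trunc_dependence[OF ab R] by blast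
  obtain u where u: "trunc_sol a b (R+1) A u"
    using trunc_exists[OF ab R1] by blast
  have uc: "continuous_on {0..R+1} u" using u by (simp add: trunc_sol_def)
  have Fb: "a \<le> F A x powr m \<and> F A x powr m \<le> b" if "x \<in> {0..R}" for x
    using ab0 that by (force simp: a_def b_def)
  have uF: "u x = F A x powr m" if x: "x \<in> {0..R}" for x
  proof -
    have "\<bar>u x - F A x powr m\<bar> \<le> C2 * \<bar>A powr m - A powr m\<bar>"
      using data_lipD(1)[OF C2 trunc_sol_mono[OF u] sol_imp_trunc_sol[OF s ab(1) Fb] x] by simp
    then show ?thesis by simp
  qed
  have "isCont u R" using uc R
    by (intro continuous_on_interior[of "{0..R+1}"]) auto
  then obtain r where r: "r > 0" "\<And>x. \<bar>x - R\<bar> < r \<Longrightarrow> \<bar>u x - u R\<bar> < a / 2"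
    unfolding continuous_at_eps_delta using ab(1) by (metis dist_real_def half_gt_zero)
  define R' where "R' = R + min (1/2) (r / 2)"
  have R': "R < R'" "R' \<le> R + 1" using r by (auto simp: R'_def)
  have ub: "a0 - a / 2 \<le> u x \<and> u x \<le> b0 + a / 2" if x: "x \<in> {0..R'}" for x
  proof (cases "x \<le> R")
    case True then show ?thesis using uF[of x] ab0(3)[of x] x ab(1) by auto
  next
    case False
    then have "\<bar>x - R\<bar> < r" using x r(1) by (auto simp: R'_def)
    then have "\<bar>u x - u R\<bar> < a / 2" by (rule r(2))
    moreover have "u R = F A R powr m" "a0 \<le> F A R powr m" "F A R powr m \<le> b0"
      using uF[of R] ab0(3)[of R] R by auto
    ultimately show ?thesis by linarith
  qed
  have ev: "\<forall>\<^sub>F A' in nhds A. A' > 0 \<and> C * \<bar>A' powr m - A powr m\<bar> < min e (a / 2)"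
  proof -
    have "((\<lambda>A'. C * \<bar>A' powr m - A powr m\<bar>) \<longlongrightarrow> C * \<bar>A powr m - A powr m\<bar>) (nhds A)"
      using A by (intro tendsto_intros filterlim_ident) auto
    moreover have "C * \<bar>A powr m - A powr m\<bar> < min e (a / 2)" using e ab by simp
    ultimately have "\<forall>\<^sub>F A' in nhds A. C * \<bar>A' powr m - A powr m\<bar> < min e (a / 2)"
      by (rule order_tendstoD(2))
    moreover have "\<forall>\<^sub>F A' in nhds A. A' \<in> {0<..}"
      using A by (intro eventually_nhds_in_open) auto
    ultimately show ?thesis by eventually_elim auto
  qed
  show thesis
  proof (rule that[OF R'(1)], use ev in eventually_elim)
    case (elim A')
    obtain v where v: "trunc_sol a b (R+1) A' v"
      using trunc_exists[OF ab R1] by blast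
    have vu: "\<bar>v x - u x\<bar> < min e (a / 2)"
      "\<bar>flux (\<lambda>s. trunc a b (v s)) x - flux (\<lambda>s. trunc a b (u s)) x\<bar> < min e (a / 2)" if "x \<in> {0..R+1}" for x
      using data_lipD[OF C v u that] elim by auto
    have vb: "a \<le> v x \<and> v x \<le> b" if x: "x \<in> {0..R'}" for x
    proof -
      have "\<bar>v x - u x\<bar> < a / 2" using vu(1)[of x] R' x by auto
      then have "a \<le> v x" "v x \<le> b" using ub[OF x] ab0(1) unfolding a_def b_def by linarith+
      then show ?thesis by simp
    qed
    have vs: "sol A' R' (\<lambda>s. trunc a b (v s))"
      using elim R' R ab vb trunc_sol_mono[OF v] by (intro trunc_sol_imp_sol) auto
    have FA': "F A' x = trunc a b (v x)" if "x \<in> {0..R'}" for x using F_eq[OF vs that] .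
    have FA: "F A x = trunc a b (u x)" if "x \<in> {0..R}" for x
      using uF[OF that] trunc_id[of "F A x" a b] Fb[OF that] F_pos[OF d that] by simp
    have "FG A' R = flux (\<lambda>s. trunc a b (v s)) R"
      unfolding FG_def using R R' FA' by (intro flux_cong) auto
    moreover have "FG A R = flux (\<lambda>s. trunc a b (u s)) R"
      unfolding FG_def using R FA by (intro flux_cong) auto
    moreover have "F A' R powr m = v R"
      using FA'[of R] vb[of R] R R' ab by (simp add: trunc_powr)
    ultimately show ?case using vs vu[of R] uF[of R] R by (auto simp: solvable_def)
  qed
qed

lemma solvable_open:
  assumes "solvable A R" obtains R' where "R' > R" "\<forall>\<^sub>F A' in nhds A. solvable A' R'"
  by (rule dependence[OF assms zero_less_one]) (auto intro: that elim: eventually_mono)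

lemma solvable_ext: assumes "solvable A R" obtains R' where "R' > R" "solvable A R'"
  using solvable_open[OF assms] by (metis eventually_nhds_x_imp_x)

lemma FG_tendsto: "solvable A R \<Longrightarrow> ((\<lambda>A'. FG A' R) \<longlongrightarrow> FG A R) (nhds A)"
  unfolding tendsto_iff dist_real_def
  by (intro allI impI, erule (1) dependence) (auto elim: eventually_mono)

lemma F_tendsto:
  assumes d: "solvable A R" shows "((\<lambda>A'. F A' R) \<longlongrightarrow> F A R) (nhds A)"
proof -
  have "((\<lambda>A'. F A' R powr m) \<longlongrightarrow> F A R powr m) (nhds A)"
    unfolding tendsto_iff dist_real_def
    by (intro allI impI, erule dependence[OF d]) (auto elim: eventually_mono)
  moreover have p: "F A R > 0" using F_pos[OF d] solvable_pos[OF d] by auto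
  then have "F A R powr m \<noteq> 0" by simp
  ultimately have "((\<lambda>A'. (F A' R powr m) powr (1/m)) \<longlongrightarrow> (F A R powr m) powr (1/m)) (nhds A)"
    by (rule tendsto_powr[OF _ tendsto_const])
  then have "((\<lambda>A'. (F A' R powr m) powr (1/m)) \<longlongrightarrow> F A R) (nhds A)"
    using p m1 by (simp add: powr_powr)
  moreover have "\<forall>\<^sub>F A' in nhds A. (F A' R powr m) powr (1/m) = F A' R"
  proof -
    obtain R' where R': "R' > R" "\<forall>\<^sub>F A' in nhds A. solvable A' R'" using solvable_open[OF d] by metis
    from R'(2) show ?thesis
    proof eventually_elim
      case (elim A')
      then have "F A' R > 0" using F_pos[OF elim, of R] solvable_pos[OF d] R' by auto
      then show ?case using m1 by (simp add: powr_powr)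
    qed
  qed
  ultimately show ?thesis using tendsto_cong by fast
qed

text \<open>The continuation alternative. The truncated solution always exists on
  \<open>{0..R}\<close>; if it never met the ends of the clamp it would be genuine up to
  \<open>R\<close>.\<close>

lemma solvable_or_exit:
  assumes nd: "\<not> solvable A R" and R: "0 < R" and a: "0 < a" "a < A" "A < b"
  obtains R' where "0 < R'" "R' < R" "solvable A R'" "F A R' = a \<or> F A R' = b"
proof -
  define a' b' where "a' = a powr m" and "b' = b powr m"
  have ab: "0 < a'" "a' \<le> b'" and A': "a' < A powr m" "A powr m < b'"
    using a m1 by (auto simp: a'_def b'_def intro!: powr_mono2 powr_less_mono2)
  obtain u where u: "trunc_sol a' b' R A u"
    using trunc_exists[OF ab R] by blast
  have uc: "continuous_on {0..R} u" and u0: "u 0 = A powr m" using u R by (auto simp: trunc_sol_def)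
  define w where "w x = min (u x - a') (b' - u x)" for x
  have wc: "continuous_on {0..R} w" unfolding w_def using uc by (intro continuous_intros)
  have "\<exists>x\<in>{0..R}. w x \<le> 0"
  proof (rule ccontr)
    assume "\<not> ?thesis"
    then have "sol A R (\<lambda>s. trunc a' b' (u s))"
      using u ab a R by (intro trunc_sol_imp_sol) (force simp: w_def)+
    then show False using nd by (auto simp: solvable_def)
  qed
  then obtain x0 where x0: "x0 \<in> {0..R}" "w x0 \<le> 0" by blast
  then obtain z where z: "z \<in> {0<..x0}" "w z = 0" "\<forall>y\<in>{0..<z}. w y > 0"
    using first_zero[of 0 x0 w] continuous_on_subset[OF wc, of "{0..x0}"] u0 A' by (auto simp: w_def)
  have z0: "0 < z" "z \<le> R" using z(1) x0 by auto
  have wz: "w x \<ge> 0" if "x \<in> {0..z}" for x using z(2,3) that by (cases "x = z") (auto intro: less_imp_le)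
  have s: "sol A z (\<lambda>s. trunc a' b' (u s))"
  proof (rule trunc_sol_imp_sol)
    fix x assume "x \<in> {0..z}"
    then show "a' \<le> u x \<and> u x \<le> b'" using wz[of x] by (auto simp: w_def)
  qed (use trunc_sol_mono[OF u] a z0 ab in auto)
  have Fz: "F A z = trunc a' b' (u z)" using F_eq[OF s] z0 by auto
  have "u z = a' \<or> u z = b'" using z(2) by (auto simp: w_def min_def split: if_splits)
  moreover have "a' powr (1 / m) = a" "b' powr (1 / m) = b"
    using a m1 by (simp_all add: a'_def b'_def powr_powr)
  ultimately have "F A z = a \<or> F A z = b" unfolding Fz trunc_def using ab
    by (auto simp: max_def min_def)
  moreover have "solvable A z" using s by (auto simp: solvable_def)
  moreover from this have "z \<noteq> R" using nd by auto
  ultimately show thesis using that z0 by auto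
qed

lemma Fm_deriv:
  assumes d: "solvable A x" shows "((\<lambda>y. F A y powr m) has_real_derivative FG A x) (at x)"
proof -
  have x: "x > 0" using solvable_pos[OF d] by simp
  obtain R where R: "R > x" "solvable A R" using solvable_ext[OF d] by metis
  have s: "sol A R (F A)" using F_sol[OF R(2)] .
  have "(volterra A (F A) has_real_derivative FG A x) (at x within {0..R})"
    unfolding FG_def using s x R by (intro volterra_deriv) (auto simp: sol_def)
  then have "(volterra A (F A) has_real_derivative FG A x) (at x)"
    using at_within_Icc_at[OF x R(1)] by simp
  then show ?thesis
    by (rule has_field_derivative_transform_within_open[of _ _ _ "{0<..<R}"]) (use s x R in \<open>auto simp: sol_def\<close>)
qed

lemma F_deriv:
  assumes d: "solvable A x"
  shows "(F A has_real_derivative FG A x * F A x / (m * F A x powr m)) (at x)"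
proof -
  have p: "F A x > 0" using F_pos[OF d] solvable_pos[OF d] by auto
  obtain R where R: "R > x" "solvable A R" using solvable_ext[OF d] by metis
  have x: "x > 0" using solvable_pos[OF d] by simp
  have "((\<lambda>y. (F A y powr m) powr (1/m)) has_real_derivative
      (1/m) * (F A x powr m) powr (1/m - 1) * FG A x) (at x)"
    using DERIV_fun_powr[OF Fm_deriv[OF d], of "1/m"] p by simp
  moreover have "(1/m) * (F A x powr m) powr (1/m - 1) * FG A x = FG A x * F A x / (m * F A x powr m)"
  proof -
    have "(F A x powr m) powr (1/m - 1) = F A x powr (1 - m)"
      using m1 by (simp add: powr_powr right_diff_distrib)
    also have "\<dots> = F A x / F A x powr m" using p by (simp add: powr_diff)
    finally show ?thesis by simp
  qed
  ultimately have "((\<lambda>y. (F A y powr m) powr (1/m)) has_real_derivative FG A x * F A x / (m * F A x powr m)) (at x)"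
    by simp
  then show ?thesis
    by (rule has_field_derivative_transform_within_open[of _ _ _ "{0<..<R}"])
       (use x R F_pos[OF R(2)] m1 in \<open>auto simp: powr_powr less_imp_le\<close>)
qed

lemma srcint_deriv:
  assumes d: "solvable A x"
  shows "(srcint (F A) has_real_derivative source (F A) x) (at x)"
proof -
  have x: "x > 0" using solvable_pos[OF d] by simp
  obtain R where R: "R > x" "solvable A R" using solvable_ext[OF d] by metis
  have s: "sol A R (F A)" using F_sol[OF R(2)] .
  have "((\<lambda>u. integral {0..u} (source (F A))) has_real_derivative source (F A) x) (at x within {0..R})"
    using integral_has_real_derivative[OF source_cont[of R "F A"]] x R s by (auto simp: sol_def)
  then show ?thesis using at_within_Icc_at[OF x R(1)] unfolding srcint_def[abs_def] by simp
qed

lemma FG_deriv: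
  assumes d: "solvable A x"
  shows "(FG A has_real_derivative - al * F A x - be * x * (FG A x * F A x / (m * F A x powr m))
     + x powr \<sigma> * F A x powr p - (real N - 1) / x * FG A x) (at x)"
proof -
  have x: "x > 0" using solvable_pos[OF d] by simp
  note J = srcint_deriv[OF d]
  have *: "(FG A has_real_derivative
     (source (F A) x * x ^ (N - 1) - srcint (F A) x * (real (N - 1) * x ^ (N - 1 - 1))) / (x ^ (N - 1) * x ^ (N - 1))
       - (be * F A x + be * x * (FG A x * F A x / (m * F A x powr m)))) (at x)"
    unfolding FG_def flux_def[abs_def]
    by (rule derivative_eq_intros J F_deriv[OF d, unfolded FG_def flux_def] refl | use x in simp)+
  have **: "(source (F A) x * x ^ (N - 1) - srcint (F A) x * (real (N - 1) * x ^ (N - 1 - 1))) / (x ^ (N - 1) * x ^ (N - 1))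
      = (real N * be - al) * F A x + x powr \<sigma> * F A x powr p - (real N - 1) / x * (FG A x + be * x * F A x)"
  proof -
    have 1: "FG A x + be * x * F A x = srcint (F A) x / x ^ (N - 1)" by (simp add: FG_def flux_def)
    have 2: "real (N - 1) * x ^ (N - 1 - 1) * x = (real N - 1) * x ^ (N - 1)"
      using N1 by (cases "N = 1") (auto simp: of_nat_diff power_eq_if)
    have 3: "real (N - 1) * x ^ (N - 1 - 1) = (real N - 1) * x ^ (N - 1) / x"
      using 2 x by (simp add: field_simps)
    define P where "P = x ^ (N - 1)"
    have P: "P > 0" using x by (simp add: P_def)
    show ?thesis unfolding 1 3 source_def P_def[symmetric] using x P
      by (simp add: divide_simps) (simp add: algebra_simps)
  qed
  show ?thesis
    by (rule DERIV_cong[OF *[unfolded **]]) (use x in \<open>simp add: field_simps\<close>)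
qed

subsection \<open>Logarithmic variables\<close>

text \<open>The pairs \<open>rho = nu, X = ka\<close> and \<open>rho = ga, X = 0\<close> are two
  points of the slow manifold \<open>al - be * rho - X = 0\<close> (this is \<open>al_nu\<close> and
  \<open>al_ga\<close>): critical decay and tail decay. \<open>de = 2 + (m - 1) * ga\<close> is the
  logarithmic growth rate of \<open>Lam\<close> when \<open>rho = ga\<close>.\<close>

definition nu :: real where "nu = \<sigma> / (p - 1)"
definition ka :: real where "ka = 1 / (p - 1)"
definition ga :: real where "ga = (\<sigma> + 2) / (p - m)"
definition de :: real where "de = ga * (m - 1) + 2"

lemma nu_pos: "nu > 0" and ka_pos: "ka > 0" and ga_pos: "ga > 0" and de_pos: "de > 0"
  unfolding nu_def ka_def ga_def de_def using m1 mp sig by (auto intro!: add_nonneg_pos)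

lemma al_nu: "al = be * nu + ka"
proof -
  have "be * nu + ka = ((p - m) * \<sigma> + ssL m p \<sigma>) / (ssL m p \<sigma> * (p - 1))"
    unfolding ss_beta_def nu_def ka_def using ssL_pos m1 mp by (simp add: divide_simps) 
  also have "(p - m) * \<sigma> + ssL m p \<sigma> = (\<sigma> + 2) * (p - 1)" by (simp add: ssL_def algebra_simps)
  finally show ?thesis unfolding ss_alpha_def using m1 mp by simp
qed

lemma al_ga: "al = be * ga"
  unfolding ss_alpha_def ss_beta_def ga_def using mp by simp

lemma de_eq: "de = ssL m p \<sigma> / (p - m)"
  unfolding de_def ga_def ssL_def using mp by (simp add: divide_simps) (simp add: algebra_simps)

lemma be_de: "be * de = 1"
  unfolding de_eq ss_beta_def using ssL_pos mp by simp

lemma ga_p: "ga * (p - 1) = \<sigma> + de"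
  unfolding de_eq ga_def ssL_def using mp by (simp add: divide_simps) (simp add: algebra_simps)

text \<open>The logarithmic variable \<open>t = ln \<xi>\<close>: \<open>D A t\<close> says that the solution with value \<open>A\<close> at the origin
  is still positive at \<open>exp t\<close>, and \<open>rho\<close> is \<open>- \<xi> f'/f\<close>.
  The constants \<open>nu, ka, ga, de\<close> are \<open>\<nu>\<close>, \<open>1 / (p - 1)\<close>, \<open>\<gamma>\<close> and \<open>1 / \<beta>\<close>.\<close>

definition D :: "real \<Rightarrow> real \<Rightarrow> bool" where "D A t \<longleftrightarrow> solvable A (exp t)"
definition E :: "real \<Rightarrow> real \<Rightarrow> real" where "E A t = F A (exp t)"
definition rho :: "real \<Rightarrow> real \<Rightarrow> real" where
  "rho A t = - exp t * FG A (exp t) / (m * E A t powr m)"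
definition Lam :: "real \<Rightarrow> real \<Rightarrow> real" where "Lam A t = exp (2 * t) * E A t powr (1 - m)"
definition X :: "real \<Rightarrow> real \<Rightarrow> real" where "X A t = exp (\<sigma> * t) * E A t powr (p - 1)"
definition H :: "real \<Rightarrow> real \<Rightarrow> real" where "H A t = exp (ga * t) * E A t"

lemma D_mono: "D A t \<Longrightarrow> s \<le> t \<Longrightarrow> D A s"
  unfolding D_def by (rule solvable_mono) auto

lemma D_pos: "D A t \<Longrightarrow> A > 0" unfolding D_def using solvable_pos by blast

lemma D_ev: "D A t \<Longrightarrow> \<forall>\<^sub>F A' in nhds A. D A' t"
proof -
  assume d: "D A t"
  obtain R where R: "R > exp t" "\<forall>\<^sub>F A' in nhds A. solvable A' R" using solvable_open d unfolding D_def by metis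
  from R(2) show ?thesis unfolding D_def
    by (rule eventually_mono) (use R(1) in \<open>auto intro: solvable_mono\<close>)
qed

lemma E_pos: "D A t \<Longrightarrow> E A t > 0"
  unfolding D_def E_def by (rule F_pos) auto

lemma Lam_pos: "D A t \<Longrightarrow> Lam A t > 0" and X_pos: "D A t \<Longrightarrow> X A t > 0" and H_pos: "D A t \<Longrightarrow> H A t > 0"
  using E_pos[of A t] by (auto simp: Lam_def X_def H_def)

lemma E_tendsto: "D A t \<Longrightarrow> ((\<lambda>A'. E A' t) \<longlongrightarrow> E A t) (nhds A)"
  unfolding D_def E_def by (rule F_tendsto)

lemma rho_tendsto: assumes "D A t" shows "((\<lambda>A'. rho A' t) \<longlongrightarrow> rho A t) (nhds A)"
proof -
  have "E A t > 0" using E_pos[OF assms] .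
  then show ?thesis
    unfolding rho_def using E_tendsto[OF assms] FG_tendsto[of A "exp t"] assms m1
    by (intro tendsto_divide tendsto_mult tendsto_powr tendsto_const) (auto simp: D_def)
qed

lemma Lam_tendsto: assumes "D A t" shows "((\<lambda>A'. Lam A' t) \<longlongrightarrow> Lam A t) (nhds A)"
  unfolding Lam_def using E_tendsto[OF assms] E_pos[OF assms]
  by (intro tendsto_mult tendsto_powr tendsto_const) auto

lemma X_tendsto: assumes "D A t" shows "((\<lambda>A'. X A' t) \<longlongrightarrow> X A t) (nhds A)"
  unfolding X_def using E_tendsto[OF assms] E_pos[OF assms]
  by (intro tendsto_mult tendsto_powr tendsto_const) auto

lemma H_tendsto: assumes "D A t" shows "((\<lambda>A'. H A' t) \<longlongrightarrow> H A t) (nhds A)"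
  unfolding H_def using E_tendsto[OF assms]
  by (intro tendsto_mult tendsto_const) auto

lemma E_deriv: assumes "D A t" shows "(E A has_real_derivative - rho A t * E A t) (at t)"
proof -
  have "((\<lambda>t. F A (exp t)) has_real_derivative FG A (exp t) * F A (exp t) / (m * F A (exp t) powr m) * exp t) (at t)"
    using assms by (intro DERIV_chain2[OF F_deriv DERIV_exp]) (simp add: D_def)
  then show ?thesis unfolding E_def[abs_def] rho_def by (simp add: ac_simps)
qed

lemma Lam_deriv: assumes "D A t" shows "(Lam A has_real_derivative Lam A t * (2 + (m - 1) * rho A t)) (at t)"
proof -
  have p: "E A t > 0" using E_pos[OF assms] .
  have *: "(Lam A has_real_derivative exp (2 * t) * 2 * E A t powr (1 - m)
     + exp (2 * t) * ((1 - m) * E A t powr (1 - m - 1) * (- rho A t * E A t))) (at t)"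
    unfolding Lam_def[abs_def]
    by (rule derivative_eq_intros DERIV_fun_powr E_deriv[OF assms] p refl | simp)+
  have **: "E A t powr (1 - m - 1) = E A t powr (1 - m) / E A t"
    using p by (subst powr_diff) simp
  show ?thesis unfolding Lam_def
    by (rule DERIV_cong[OF *[unfolded ** Lam_def[abs_def]]]) (use p in \<open>simp add: field_simps\<close>)
qed

lemma X_deriv: assumes "D A t" shows "(X A has_real_derivative (p - 1) * X A t * (nu - rho A t)) (at t)"
proof -
  have p: "E A t > 0" using E_pos[OF assms] .
  have *: "(X A has_real_derivative exp (\<sigma> * t) * \<sigma> * E A t powr (p - 1)
     + exp (\<sigma> * t) * ((p - 1) * E A t powr (p - 1 - 1) * (- rho A t * E A t))) (at t)"
    unfolding X_def[abs_def]
    by (rule derivative_eq_intros DERIV_fun_powr E_deriv[OF assms] p refl | simp)+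
  have **: "E A t powr (p - 1 - 1) = E A t powr (p - 1) / E A t"
    using p by (subst powr_diff) simp
  have s: "\<sigma> = (p - 1) * nu" using m1 mp by (simp add: nu_def)
  define e q where "e = exp (\<sigma> * t)" and "q = E A t powr (p - 1)"
  have "e * \<sigma> * q + e * ((p - 1) * (q / E A t) * (- rho A t * E A t)) = (p - 1) * (e * q) * (nu - rho A t)"
    by (subst s) (use p in \<open>simp add: field_simps\<close>)
  with DERIV_cong[OF *[unfolded **]] show ?thesis unfolding X_def e_def q_def by blast
qed

lemma H_deriv: assumes "D A t" shows "(H A has_real_derivative H A t * (ga - rho A t)) (at t)"
  unfolding H_def[abs_def]
  by (rule derivative_eq_intros E_deriv[OF assms] refl | simp add: algebra_simps)+

lemma rho_deriv: assumes d: "D A t"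
  shows "(rho A has_real_derivative
    m * (rho A t)^2 - (real N - 2) * rho A t + Lam A t / m * (al - be * rho A t - X A t)) (at t)"
proof -
  have p: "E A t > 0" using E_pos[OF d] .
  define x f G V where "x = exp t" and "f = E A t" and "G = FG A (exp t)" and "V = E A t powr m"
  have V: "V > 0" and f: "f > 0" and x: "x > 0" using p by (auto simp: V_def f_def x_def)
  have m0: "m \<noteq> 0" using m1 by simp
  have 1: "((\<lambda>t. E A t powr m) has_real_derivative G * x) (at t)"
    unfolding E_def[abs_def] G_def x_def using d
    by (intro DERIV_chain2[OF Fm_deriv DERIV_exp]) (simp add: D_def)
  have 2: "((\<lambda>t. FG A (exp t)) has_real_derivative (- al * f - be * x * (G * f / (m * V))
     + x powr \<sigma> * f powr p - (real N - 1) / x * G) * x) (at t)"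
    using DERIV_chain2[OF FG_deriv DERIV_exp, of A t] d
    by (simp add: D_def x_def G_def f_def V_def E_def)
  have nz: "m * E A t powr m \<noteq> 0" using V m0 by (simp add: V_def)
  have 3: "(rho A has_real_derivative
      ((- x * G + ((- al * f - be * x * (G * f / (m * V)) + x powr \<sigma> * f powr p - (real N - 1) / x * G) * x) * (- x))
        * (m * V) - (- x * G) * (m * (G * x))) / ((m * V) * (m * V))) (at t)"
    using DERIV_divide[OF DERIV_mult[OF DERIV_minus[OF DERIV_exp] 2] DERIV_cmult[OF 1, of m] nz]
    unfolding rho_def[abs_def] V_def G_def x_def .
  have r: "rho A t = - x * G / (m * V)" by (simp add: rho_def x_def G_def V_def)
  have L: "Lam A t = x^2 * f / V" using p
    by (simp add: Lam_def x_def f_def V_def powr_diff exp_double)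
  have "f powr (p - 1) * f = f powr p" using f powr_mult_base[of f "p - 1"] by (simp add: mult.commute)
  moreover have "x powr \<sigma> = exp (\<sigma> * t)" by (simp add: x_def powr_def)
  ultimately have XX: "x powr \<sigma> * f powr p = X A t * f" by (simp add: X_def f_def mult.assoc)
  show ?thesis
    by (rule DERIV_cong[OF 3], unfold r L XX x_def[symmetric]) (use V x m0 in \<open>simp add: field_simps power2_eq_square\<close>)
qed

definition rhod :: "real \<Rightarrow> real \<Rightarrow> real" where
  "rhod A t = m * (rho A t)^2 - (real N - 2) * rho A t + Lam A t / m * (al - be * rho A t - X A t)"

lemmas rho_deriv' = rho_deriv[folded rhod_def]

text \<open>Since \<open>ga * (p - m) = \<sigma> + 2\<close>, the time factors cancel: the
  absorption term in the equation of \<open>rho\<close> depends on \<open>H\<close> alone. With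
  \<open>H\<close> kept fixed, \<open>Lam\<close> grows like \<open>exp (de * t)\<close> and
  \<open>X\<close> decays like \<open>exp (- de * t)\<close>, as the next two identities
  show.\<close>

lemma Lam_X: "D A t \<Longrightarrow> Lam A t * X A t = H A t powr (p - m)"
proof -
  assume d: "D A t"
  have p: "E A t > 0" using E_pos[OF d] .
  have "ga * (p - m) = \<sigma> + 2" using mp by (simp add: ga_def)
  then have "(p - m) * (ga * t) = 2 * t + \<sigma> * t"
    by (metis add.commute distrib_right mult.assoc mult.commute)
  then have "exp (ga * t) powr (p - m) = exp (2 * t) * exp (\<sigma> * t)"
    by (simp add: powr_def exp_add)
  moreover have "E A t powr (1 - m) * E A t powr (p - 1) = E A t powr (p - m)"
    by (simp flip: powr_add)
  ultimately show ?thesis using p unfolding Lam_def X_def H_def by (simp add: powr_mult algebra_simps)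
qed

lemma Lam_H: "D A t \<Longrightarrow> Lam A t = exp (de * t) * H A t powr (1 - m)"
proof -
  assume d: "D A t"
  have p: "E A t > 0" using E_pos[OF d] .
  have "exp (de * t) * exp (ga * t) powr (1 - m) = exp (2 * t)"
    unfolding de_def by (simp add: powr_def mult_exp_exp algebra_simps)
  then show ?thesis using p unfolding Lam_def H_def by (simp add: powr_mult)
qed

lemma X_H: "D A t \<Longrightarrow> X A t = exp (- de * t) * H A t powr (p - 1)"
proof -
  assume d: "D A t"
  have p: "E A t > 0" using E_pos[OF d] .
  have "(p - 1) * (ga * t) = (\<sigma> + de) * t" by (simp flip: ga_p)
  then have "exp (- de * t) * exp (ga * t) powr (p - 1) = exp (\<sigma> * t)"
    by (simp add: powr_def mult_exp_exp algebra_simps)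
  then show ?thesis using p unfolding X_def H_def by (simp add: powr_mult)
qed

subsection \<open>Solutions that turn up\<close>

lemma D_exists: assumes "A > 0" obtains t where "D A t"
proof (cases "solvable A 1")
  case True
  then show ?thesis using that[of 0] by (simp add: D_def)
next
  case False
  then obtain R where R: "0 < R" "solvable A R"
    using solvable_or_exit[of A 1 "A / 2" "2 * A"] assms by auto
  then show ?thesis using that[of "ln R"] by (simp add: D_def)
qed

lemma X_small_init:
  assumes "A > 0" "e > 0"
  obtains t0 where "D A t0" "\<And>t. t \<le> t0 \<Longrightarrow> X A t < e"
proof -
  obtain T where T: "D A T" using D_exists[OF assms(1)] .
  then have "continuous_on {0..exp T} (F A)" using F_cont by (simp add: D_def)
  then have "bounded (F A ` {0..exp T})" by (intro compact_imp_bounded compact_continuous_image) auto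
  then obtain M where M: "M > 0" "\<And>x. x \<in> {0..exp T} \<Longrightarrow> \<bar>F A x\<bar> \<le> M" unfolding bounded_pos by auto
  define t1 where "t1 = ln (e / (2 * M powr (p - 1))) / \<sigma>"
  have t1: "exp (\<sigma> * t) * M powr (p - 1) < e" if "t \<le> t1" for t
  proof -
    have "\<sigma> * t \<le> ln (e / (2 * M powr (p - 1)))" using that sig by (simp add: t1_def le_divide_eq mult.commute)
    then have "exp (\<sigma> * t) \<le> e / (2 * M powr (p - 1))"
      using assms(2) M(1) by (metis exp_le_cancel_iff exp_ln divide_pos_pos mult_pos_pos powr_gt_zero zero_less_numeral less_irrefl)
    then show ?thesis using assms(2) M(1) by (simp add: le_divide_eq) 
  qed
  show thesis
  proof (rule that[of "min T t1"])
    show "D A (min T t1)" using D_mono[OF T] by auto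
    fix t assume t: "t \<le> min T t1"
    have "E A t \<le> M" using M(2)[of "exp t"] t by (simp add: E_def)
    then have "E A t powr (p - 1) \<le> M powr (p - 1)"
      using E_pos[OF D_mono[OF T]] t m1 mp by (intro powr_mono2) (auto simp: less_imp_le)
    then have "X A t \<le> exp (\<sigma> * t) * M powr (p - 1)" unfolding X_def by simp
    then show "X A t < e" using t1[of t] t by simp
  qed
qed

text \<open>If \<open>rho\<close> were negative at \<open>t1\<close> it would be negative at all
  earlier times, since its derivative is positive at zeros with \<open>X < al\<close>. Hence
  \<open>FG\<close> would be positive down to the origin. But \<open>x ^ (N - 1) * FG A x\<close>
  starts at \<open>0\<close> and, as long as \<open>FG\<close> is positive and
  \<open>X < al\<close>, decreases. The second half is done in the original variable because the
  origin is at infinity in \<open>t\<close>.\<close>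

lemma rho_init:
  assumes d: "D A t1" and X: "\<And>t. t \<le> t1 \<Longrightarrow> X A t < al"
  shows "rho A t1 \<ge> 0"
proof (rule ccontr)
  assume n: "\<not> rho A t1 \<ge> 0"
  have neg: "rho A t < 0" if t: "t \<le> t1" for t
  proof (rule ccontr)
    assume "\<not> rho A t < 0"
    then have "rho A t \<ge> 0" "rho A t1 < 0" using n by auto
    then obtain s where s: "s \<in> {t..<t1}" "rho A s = 0" "rhod A s \<le> 0"
      using last_nonneg[OF t rho_deriv'[OF D_mono[OF d]]] by (metis atLeastAtMost_iff)
    have "Lam A s > 0" using Lam_pos[OF D_mono[OF d]] s by auto
    moreover have "X A s < al" using X s by auto
    ultimately show False using s m1 by (simp add: rhod_def mult_le_0_iff divide_le_0_iff)
  qed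
  define \<phi> where "\<phi> x = x ^ (N - 1) * FG A x" for x
  have dx: "solvable A (exp t1)" using d by (simp add: D_def)
  have FGp: "FG A x > 0" if "0 < x" "x \<le> exp t1" for x
  proof -
    have l: "ln x \<le> t1" using that by (metis exp_le_cancel_iff exp_ln)
    have "E A (ln x) > 0" using E_pos[OF D_mono[OF d l]] .
    then show ?thesis using neg[OF l] that m1
      by (auto simp: rho_def divide_less_0_iff mult_less_0_iff zero_less_mult_iff zero_less_divide_iff)
  qed
  have "\<phi> (exp t1) < \<phi> 0"
  proof (rule DERIV_neg_imp_decreasing_open[of 0 "exp t1" \<phi>])
    fix x assume x: "0 < x" "x < exp t1"
    have dm: "solvable A x" using solvable_mono[OF dx] x by auto
    define f V where "f = F A x" and "V = F A x powr m"
    have f: "f > 0" using F_pos[OF dm, of x] x by (simp add: f_def)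
    then have V: "V > 0" by (simp add: f_def V_def)
    have 1: "(\<phi> has_real_derivative real (N - 1) * x ^ (N - 1 - 1) * FG A x + x ^ (N - 1) *
       (- al * f - be * x * (FG A x * f / (m * V)) + x powr \<sigma> * f powr p - (real N - 1) / x * FG A x)) (at x)"
      unfolding \<phi>_def[abs_def] f_def V_def
      by (rule derivative_eq_intros FG_deriv[OF dm] refl | simp)+
    have 2: "real (N - 1) * x ^ (N - 1 - 1) = (real N - 1) * x ^ (N - 1) / x"
      using N1 x by (cases "N = 1") (auto simp: of_nat_diff power_eq_if)
    have l: "ln x \<le> t1" using x by (metis exp_le_cancel_iff exp_ln less_imp_le)
    have "f powr (p - 1) * f = f powr p" using f powr_mult_base[of f "p - 1"] by (simp add: mult.commute)
    moreover have "x powr \<sigma> = exp (\<sigma> * ln x)" using x by (simp add: powr_def)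
    ultimately have XX: "x powr \<sigma> * f powr p = X A (ln x) * f"
      using x by (simp add: X_def E_def f_def mult.assoc)
    have "X A (ln x) * f < al * f" using X[OF l] f by simp
    moreover have "be * x * (FG A x * f / (m * V)) > 0"
      using be_pos x FGp[of x] f V m1 by (auto intro!: mult_pos_pos divide_pos_pos)
    ultimately have "x ^ (N - 1) * (- al * f - be * x * (FG A x * f / (m * V)) + X A (ln x) * f) < 0"
      using x by (intro mult_pos_neg) auto
    moreover have "real (N - 1) * x ^ (N - 1 - 1) * FG A x + x ^ (N - 1) *
       (- al * f - be * x * (FG A x * f / (m * V)) + x powr \<sigma> * f powr p - (real N - 1) / x * FG A x)
       = x ^ (N - 1) * (- al * f - be * x * (FG A x * f / (m * V)) + X A (ln x) * f)"
      unfolding 2 XX by (simp add: algebra_simps)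
    ultimately show "\<exists>y. DERIV \<phi> x :> y \<and> y < 0" using 1 by auto
  next
    show "continuous_on {0..exp t1} \<phi>"
      unfolding \<phi>_def using FG_cont[OF dx] by (intro continuous_intros)
  qed simp
  then show False using FGp[of "exp t1"] by (simp add: \<phi>_def mult_less_0_iff)
qed

text \<open>At a zero of \<open>rho\<close> its derivative has the sign of \<open>al - X\<close>, so
  \<open>rho\<close> can become negative only where absorption dominates.\<close>

lemma rho_neg_source:
  assumes d: "D A t0" and n: "rho A t0 < 0"
  obtains s where "s < t0" "rho A s = 0" "al \<le> X A s" "\<forall>t\<in>{s<..t0}. rho A t < 0"
proof -
  obtain t1 where t1: "D A t1" "\<And>t. t \<le> t1 \<Longrightarrow> X A t < al"
    using X_small_init[OF D_pos[OF d] al_pos] by blast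
  define t2 where "t2 = min t0 t1"
  have "rho A t2 \<ge> 0" using rho_init[OF D_mono[OF t1(1)]] t1(2) by (auto simp: t2_def)
  moreover have "t2 \<le> t0" by (simp add: t2_def)
  ultimately obtain s where s: "s \<in> {t2..<t0}" "rho A s = 0" "rhod A s \<le> 0" "\<forall>t\<in>{s<..t0}. rho A t < 0"
    using last_nonneg[OF _ rho_deriv'[OF D_mono[OF d]] _ n] by (metis atLeastAtMost_iff)
  have "Lam A s > 0" using Lam_pos[OF D_mono[OF d]] s by auto
  then have "al \<le> X A s" using s(2,3) m1 by (simp add: rhod_def mult_le_0_iff divide_le_0_iff)
  then show thesis using that s by auto
qed

text \<open>From the last zero \<open>s\<close> on, \<open>rho \<le> 0\<close> makes
  \<open>X\<close> increase beyond its value at \<open>s\<close>, which is at least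
  \<open>al\<close>; so at a next zero the derivative of \<open>rho\<close> would be
  negative.\<close>

lemma rho_neg_forward:
  assumes d: "D A t1" and le: "t0 \<le> t1" and n: "rho A t0 < 0"
  shows "rho A t1 < 0"
proof -
  obtain s where s: "s < t0" "rho A s = 0" "al \<le> X A s" "\<forall>t\<in>{s<..t0}. rho A t < 0"
    using rho_neg_source[OF D_mono[OF d le] n] by blast
  have "- rho A t1 > 0"
  proof (rule barrier[OF le, of "\<lambda>t. - rho A t" "\<lambda>t. - rhod A t"])
    fix t assume "t \<in> {t0..t1}"
    then show "((\<lambda>t. - rho A t) has_real_derivative - rhod A t) (at t)"
      by (intro DERIV_minus rho_deriv' D_mono[OF d]) auto
  next
    fix r assume r: "r \<in> {t0..t1}" "- rho A r = 0" and b: "\<And>t. t \<in> {t0..r} \<Longrightarrow> - rho A t \<ge> 0"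
    have "X A s < X A r"
    proof (rule DERIV_pos_imp_increasing_open[of s r "X A"])
      fix x assume x: "s < x" "x < r"
      have dd: "D A x" using D_mono[OF d] x r by auto
      have "rho A x \<le> 0" using s(4) b[of x] x by (cases "x \<le> t0") (auto simp: less_imp_le)
      then have "(p - 1) * X A x * (nu - rho A x) > 0"
        using X_pos[OF dd] nu_pos m1 mp by (intro mult_pos_pos) auto
      then show "\<exists>y. DERIV (X A) x :> y \<and> 0 < y" using X_deriv[OF dd] by auto
    next
      show "continuous_on {s..r} (X A)"
        by (rule DERIV_imp_continuous_on[OF X_deriv[OF D_mono[OF d]]]) (use r in auto)
    qed (use s r in auto)
    moreover have "Lam A r > 0" using Lam_pos[OF D_mono[OF d]] r by auto
    ultimately show "- rhod A r > 0"
      using r(2) s(3) m1 by (simp add: rhod_def mult_less_0_iff divide_less_0_iff)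
  qed (use n in auto)
  then show ?thesis by simp
qed

lemma F_antimono:
  assumes d: "solvable A R" and r: "\<And>u. u \<le> ln R \<Longrightarrow> rho A u \<ge> 0" and xy: "0 \<le> x" "x \<le> y" "y \<le> R"
  shows "F A y \<le> F A x"
proof (cases "x = y")
  case False
  show ?thesis
  proof (rule DERIV_nonpos_imp_decreasing_open[of x y "F A"])
    fix z assume z: "x < z" "z < y"
    have dz: "solvable A z" using solvable_mono[OF d] z xy by auto
    have lz: "ln z \<le> ln R" using z xy by simp
    have "F A z > 0" using F_pos[OF dz, of z] z xy by auto
    then have "FG A z \<le> 0"
      using r[OF lz] z xy m1 by (auto simp: rho_def E_def zero_le_divide_iff zero_le_mult_iff divide_le_0_iff mult_le_0_iff)
    then have "FG A z * F A z / (m * F A z powr m) \<le> 0"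
      using \<open>F A z > 0\<close> m1 by (auto simp: divide_le_0_iff mult_le_0_iff)
    then show "\<exists>y. DERIV (F A) z :> y \<and> y \<le> 0" using F_deriv[OF dz] by auto
  next
    show "continuous_on {x..y} (F A)" using F_cont[OF d] xy by (auto intro: continuous_on_subset)
  qed (use xy False in auto)
qed simp

lemma E_antimono:
  assumes "D A t" "\<And>u. u \<le> t \<Longrightarrow> rho A u \<ge> 0" "s \<le> t"
  shows "E A t \<le> E A s"
  using F_antimono[of A "exp t" "exp s" "exp t"] assms by (simp add: D_def E_def)

lemma E_le: assumes "D A t" "\<And>u. u \<le> t \<Longrightarrow> rho A u \<ge> 0" shows "E A t \<le> A"
  using F_antimono[of A "exp t" 0 "exp t"] assms by (simp add: D_def E_def)

text \<open>Until \<open>rho\<close> vanishes for the last time before becoming negative the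
  solution is at most \<open>A\<close>, so \<open>X\<close> reaches \<open>al\<close> only through
  the factor \<open>exp (\<sigma> * t)\<close>: small data cannot turn up early.\<close>

lemma rho_neg_early:
  assumes d: "D A t0" and n: "rho A t0 < 0"
  shows "al \<le> exp (\<sigma> * t0) * A powr (p - 1)"
proof -
  obtain s where s: "s < t0" "rho A s = 0" "al \<le> X A s"
    using rho_neg_source[OF d n] by metis
  have ds: "D A s" using D_mono[OF d] s by auto
  have "rho A u \<ge> 0" if "u \<le> s" for u
    using rho_neg_forward[OF ds that] s(2) by force
  then have "E A s \<le> A" using E_le[OF ds] by auto
  then have "E A s powr (p - 1) \<le> A powr (p - 1)"
    using E_pos[OF ds] m1 mp by (intro powr_mono2) auto
  moreover have "exp (\<sigma> * s) \<le> exp (\<sigma> * t0)" using s sig by simp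
  ultimately have "X A s \<le> exp (\<sigma> * t0) * A powr (p - 1)"
    unfolding X_def by (intro mult_mono) auto
  then show ?thesis using s by simp
qed

definition turns_up :: "real \<Rightarrow> bool" where "turns_up A \<longleftrightarrow> (\<exists>t. D A t \<and> rho A t < 0)"

lemma turns_up_open: assumes "turns_up A" shows "\<forall>\<^sub>F A' in nhds A. turns_up A'"
proof -
  obtain t where t: "D A t" "rho A t < 0" using assms by (auto simp: turns_up_def)
  from D_ev[OF t(1)] order_tendstoD(2)[OF rho_tendsto[OF t(1)] t(2)]
  show ?thesis by eventually_elim (auto simp: turns_up_def)
qed

text \<open>A nonincreasing solution that fails to reach \<open>T\<close> cannot exit upwards, so it
  takes every value in \<open>(0, A)\<close> before \<open>T\<close>. Falling by arbitrarily large
  factors within bounded time forces \<open>rho\<close> to be arbitrarily large somewhere.\<close>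

lemma extinction:
  assumes A: "A > 0" and nd: "\<not> D A T" and r: "\<And>t. D A t \<Longrightarrow> rho A t \<ge> 0"
  obtains T0 where "\<And>e c. e > 0 \<Longrightarrow> \<exists>s. D A s \<and> T0 \<le> s \<and> s < T \<and> E A s < e \<and> rho A s > c"
proof -
  have ex: "\<exists>s. s < T \<and> D A s \<and> E A s = a" if a: "0 < a" "a < A" for a
  proof -
    obtain R where R: "0 < R" "R < exp T" "solvable A R" "F A R = a \<or> F A R = 2 * A"
      using solvable_or_exit[of A "exp T" a "2 * A"] nd a A by (auto simp: D_def)
    have dl: "D A (ln R)" using R by (simp add: D_def)
    have "rho A u \<ge> 0" if "u \<le> ln R" for u using r D_mono[OF dl that] by auto
    then have "E A (ln R) \<le> A" using E_le[OF dl] by auto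
    then have "E A (ln R) = a" using R A by (auto simp: E_def)
    moreover have "ln R < T" using R by (metis exp_less_cancel_iff exp_ln)
    ultimately show ?thesis using dl by blast
  qed
  \<comment> \<open>Fixed before \<open>e\<close> and \<open>c\<close>: this bounds from below the
    times that will be found, so exponentials of these times are controlled on both sides.\<close>
  obtain T0 where T0: "T0 < T" "D A T0" "E A T0 = A / 2" using ex[of "A / 2"] A by auto
  have later: "s \<le> t" if st: "D A s" "D A t" "E A t < E A s" for s t
  proof (rule ccontr)
    assume "\<not> s \<le> t"
    then have "E A s \<le> E A t" using r D_mono[OF st(1)] by (intro E_antimono[OF st(1)]) auto
    then show False using st by simp
  qed
  show thesis
  proof (rule that[of T0])
    fix e c :: real assume e: "e > 0"
    obtain T1 where T1: "T1 < T" "D A T1" "E A T1 = min (A / 4) (e / 2)" using ex[of "min (A / 4) (e / 2)"] A e by (auto simp: min_less_iff_disj)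
    define cc where "cc = max c 0"
    \<comment> \<open>Half of what remains of \<open>E A T1\<close> at time \<open>T\<close> under
      the constant rate \<open>cc\<close>; reaching this level earlier requires a larger
      rate.\<close>
    define a where "a = E A T1 * exp (- cc * (T - T1)) / 2"
    have a: "0 < a" "a < E A T1"
    proof -
      have "exp (- cc * (T - T1)) \<le> 1" using T1 by (simp add: cc_def)
      then have "E A T1 * exp (- cc * (T - T1)) \<le> E A T1 * 1"
        using E_pos[OF T1(2)] by (intro mult_left_mono) auto
      then show "a < E A T1" using E_pos[OF T1(2)] unfolding a_def by linarith
    qed (use E_pos[OF T1(2)] in \<open>simp add: a_def\<close>)
    obtain T2 where T2: "T2 < T" "D A T2" "E A T2 = a" using ex[of a] a T1(3) A by force
    have le: "T0 \<le> T1" "T1 \<le> T2" using later T0 T1 T2 a A by auto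
    have "\<exists>s\<in>{T1..T2}. rho A s > c"
    proof (rule ccontr)
      assume "\<not> (\<exists>s\<in>{T1..T2}. rho A s > c)"
      then have b: "\<And>s. s \<in> {T1..T2} \<Longrightarrow> rho A s \<le> cc" by (force simp: cc_def)
      have "E A T1 * exp (cc * T1) \<le> E A T2 * exp (cc * T2)"
      proof (rule DERIV_nonneg_imp_nondecreasing[OF le(2)])
        fix x assume x: "T1 \<le> x" "x \<le> T2"
        have dx: "D A x" using D_mono[OF T2(2)] x by auto
        have "((\<lambda>x. E A x * exp (cc * x)) has_real_derivative E A x * exp (cc * x) * (cc - rho A x)) (at x)"
          by (rule derivative_eq_intros E_deriv[OF dx] refl | simp add: algebra_simps)+
        moreover have "E A x * exp (cc * x) * (cc - rho A x) \<ge> 0"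
          using E_pos[OF dx] b[of x] x by (intro mult_nonneg_nonneg) auto
        ultimately show "\<exists>y. DERIV (\<lambda>x. E A x * exp (cc * x)) x :> y \<and> 0 \<le> y" by blast
      qed
      also have "\<dots> \<le> a * exp (cc * T)" using T2 a by (auto simp: cc_def intro!: mult_left_mono)
      also have "\<dots> = E A T1 * exp (cc * T1) / 2"
        by (simp add: a_def algebra_simps flip: exp_add)
      finally show False using E_pos[OF T1(2)] by (simp add: mult_less_0_iff not_less[symmetric])
    qed
    then obtain s where s: "s \<in> {T1..T2}" "rho A s > c" by blast
    have ds: "D A s" using D_mono[OF T2(2)] s by auto
    have "E A s \<le> E A T1" using s r D_mono[OF ds] by (intro E_antimono[OF ds]) auto
    then have "E A s < e" using T1(3) e by auto
    then show "\<exists>s. D A s \<and> T0 \<le> s \<and> s < T \<and> E A s < e \<and> rho A s > c"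
      using ds s le T2 by auto
  qed
qed

text \<open>Suppose a solution with large \<open>A\<close> never turns up. It is nonincreasing, and
  its flux is bounded below by a multiple of \<open>A * x\<close>, so its \<open>m\<close>-th power
  keeps half of its initial size on the unit interval. Integrated up to \<open>1\<close>, the
  absorption is then of order \<open>A powr p\<close>, while the sign of the flux at
  \<open>1\<close> allows only a quantity of order \<open>A\<close>.\<close>

lemma turns_up_large: obtains A0 where "\<And>A. A \<ge> A0 \<Longrightarrow> turns_up A"
proof -
  define c where "c = 1 / 2 powr (p / m)"
  \<comment> \<open>The second entry makes the loss of the \<open>m\<close>-th power on
    \<open>{0..1}\<close> at most one half; the third makes the absorption beat the linear terms.
    The factor \<open>c\<close> is what the half becomes under the power
    \<open>p / m\<close>.\<close>
  define A0 where "A0 = max 1 (max ((al + be) powr (1 / (m - 1))) ((((al + be) * (real N + \<sigma>) + 1) / c) powr (1 / (p - 1))))"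
  have c: "c > 0" by (simp add: c_def)
  show thesis
  proof (rule that[of A0], rule ccontr)
    fix A assume A: "A \<ge> A0" and nI: "\<not> turns_up A"
    have A1: "A \<ge> 1" using A by (simp add: A0_def)
    have Am: "al + be \<le> A powr (m - 1)"
    proof -
      have "((al + be) powr (1 / (m - 1))) powr (m - 1) \<le> A powr (m - 1)"
        using A m1 by (intro powr_mono2) (auto simp: A0_def)
      then show ?thesis using al_pos be_pos m1 by (simp add: powr_powr)
    qed
    have Ap: "(al + be) * (real N + \<sigma>) + 1 \<le> c * A powr (p - 1)"
    proof -
      have "((((al + be) * (real N + \<sigma>) + 1) / c) powr (1 / (p - 1))) powr (p - 1) \<le> A powr (p - 1)"
        using A m1 mp by (intro powr_mono2) (auto simp: A0_def)
      moreover have "((al + be) * (real N + \<sigma>) + 1) / c > 0"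
        using al_pos be_pos sig c by (intro divide_pos_pos add_nonneg_pos mult_nonneg_nonneg) auto
      moreover have "(y powr (1 / (p - 1))) powr (p - 1) = y" if "y > 0" for y
        using that m1 mp by (simp add: powr_powr)
      ultimately have "((al + be) * (real N + \<sigma>) + 1) / c \<le> A powr (p - 1)"
        by metis
      then show ?thesis using c by (simp add: divide_le_eq mult.commute)
    qed
    have r: "\<And>t. D A t \<Longrightarrow> rho A t \<ge> 0" using nI by (force simp: turns_up_def)
    have FA: "F A x \<le> A" if d: "solvable A R" and x: "0 \<le> x" "x \<le> R" for x R
    proof -
      have dl: "D A (ln R)" using d solvable_pos[OF d] by (simp add: D_def)
      show ?thesis using F_antimono[OF d _ order_refl x] r D_mono[OF dl] by simp
    qed
    have FGneg: "FG A x \<le> 0" if "solvable A x" for x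
    proof -
      have x: "x > 0" "F A x > 0" using solvable_pos[OF that] F_pos[OF that, of x] by auto
      have "rho A (ln x) \<ge> 0" using r that x by (simp add: D_def)
      then show ?thesis using x m1
        by (auto simp: rho_def E_def zero_le_divide_iff mult_le_0_iff divide_le_0_iff zero_le_mult_iff)
    qed
    have J: "srcint (F A) x / x ^ (N - 1) \<ge> - al * A * x" if d: "solvable A R" and x: "0 < x" "x \<le> R" for x R
    proof -
      have pc: "pos_cont R (F A)" using F_sol[OF d] by (simp add: sol_def)
      have "integral {0..x} (\<lambda>s. - (al * A * x ^ (N - 1))) \<le> integral {0..x} (source (F A))"
      proof (rule integral_le)
        show "source (F A) integrable_on {0..x}" using source_integrable[OF pc x(2)] .
        fix s assume s: "s \<in> {0..x}"
        have Fs: "F A s > 0" "F A s \<le> A" using F_pos[OF d, of s] FA[OF d, of s] s x by auto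
        have "s ^ (N - 1) * (al * F A s) \<le> x ^ (N - 1) * (al * A)"
          using s Fs al_pos by (intro mult_mono power_mono) auto
        moreover have "0 \<le> s ^ (N - 1) * (real N * be * F A s + s powr \<sigma> * F A s powr p)"
          using s Fs be_pos by (intro mult_nonneg_nonneg add_nonneg_nonneg) auto
        ultimately show "- (al * A * x ^ (N - 1)) \<le> source (F A) s"
          by (simp add: source_def algebra_simps)
      qed (rule integrable_const_ivl)
      then have "- (al * A * x ^ (N - 1)) * x \<le> srcint (F A) x" using x by (simp add: srcint_def mult_ac)
      then show ?thesis using x by (simp add: le_divide_eq mult_ac)
    qed
    have low: "F A x powr m \<ge> A powr m - (al + be) * A * x^2 / 2" if d: "solvable A R" and x: "0 \<le> x" "x \<le> R" for x R
    proof -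
      have "F A 0 powr m + (al + be) * A * 0^2 / 2 \<le> F A x powr m + (al + be) * A * x^2 / 2"
      proof (cases "x = 0")
        case False
        show ?thesis
        proof (rule DERIV_nonneg_imp_increasing_open[of 0 x "\<lambda>y. F A y powr m + (al + be) * A * y^2 / 2"])
          fix y assume y: "0 < y" "y < x"
          have dy: "solvable A y" using solvable_mono[OF d] y x by auto
          have "((\<lambda>y. F A y powr m + (al + be) * A * y^2 / 2) has_real_derivative FG A y + (al + be) * A * y) (at y)"
            by (rule derivative_eq_intros Fm_deriv[OF dy] refl | simp)+
          moreover have "FG A y + (al + be) * A * y \<ge> 0"
          proof -
            have "be * y * F A y \<le> be * y * A" using FA[OF d, of y] y x be_pos by (intro mult_left_mono) auto
            moreover have "(al + be) * A * y = al * A * y + be * y * A" by (simp add: algebra_simps)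
            moreover have "- al * A * y \<le> srcint (F A) y / y ^ (N - 1)" using J[OF d, of y] y x by simp
            ultimately show ?thesis unfolding FG_def flux_def by linarith
          qed
          ultimately show "\<exists>z. DERIV (\<lambda>y. F A y powr m + (al + be) * A * y^2 / 2) y :> z \<and> 0 \<le> z" by blast
        next
          have "pos_cont x (F A)" using F_sol[OF d] pos_cont_mono x by (auto simp: sol_def)
          then show "continuous_on {0..x} (\<lambda>y. F A y powr m + (al + be) * A * y^2 / 2)"
            unfolding pos_cont_def by (intro continuous_intros) auto
        qed (use x False in auto)
      qed simp
      then show ?thesis by simp
    qed
    have half: "F A x powr m \<ge> A powr m / 2" if d: "solvable A R" and x: "0 \<le> x" "x \<le> R" "x \<le> 1" for x R
    proof -
      have "(al + be) * A * x^2 \<le> A powr (m - 1) * A * 1"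
        using Am A1 x power_mono[of x 1 2] al_pos be_pos by (intro mult_mono) auto
      also have "\<dots> = A powr m" using A1 powr_mult_base[of A "m - 1"] by (simp add: mult.commute)
      finally show ?thesis using low[OF d x(1,2)] by simp
    qed
    have d1: "solvable A 1"
    proof (rule ccontr)
      assume nd: "\<not> solvable A 1"
      \<comment> \<open>A lower exit level strictly below the bound \<open>half\<close>, so the
        solution cannot leave through it before \<open>1\<close>; the upper level
        \<open>2 * A\<close> is excluded by monotonicity.\<close>
      define a where "a = (A powr m / 4) powr (1 / m)"
      have am: "a powr m = A powr m / 4" "0 < a" using m1 A1 by (auto simp: a_def powr_powr)
      have "a < A"
      proof (rule ccontr)
        assume "\<not> a < A"
        then have "A powr m \<le> a powr m" using A1 m1 by (intro powr_mono2) auto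
        then show False using am A1 by simp
      qed
      then obtain R where R: "0 < R" "R < 1" "solvable A R" "F A R = a \<or> F A R = 2 * A"
        using solvable_or_exit[OF nd _ am(2), of "2 * A"] A1 by auto
      then have "F A R = a" using FA[OF R(3), of R] A1 by auto
      then show False using half[OF R(3), of R] R am A1 by simp
    qed
    have pc: "pos_cont 1 (F A)" using F_sol[OF d1] by (simp add: sol_def)
    have Fp: "F A s powr p \<ge> c * A powr p" if s: "s \<in> {0..1}" for s
    proof -
      have "(A powr m / 2) powr (p / m) \<le> (F A s powr m) powr (p / m)"
        using half[OF d1, of s] s m1 mp by (intro powr_mono2) auto
      moreover have "(A powr m / 2) powr (p / m) = c * A powr p"
        using m1 by (simp add: c_def powr_divide powr_powr)
      ultimately show ?thesis using m1 by (simp add: powr_powr)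
    qed
    have "((\<lambda>s. c * A powr p * s powr (real N + \<sigma> - 1) - al * A) has_integral
       (c * A powr p * (1 powr (real N + \<sigma> - 1 + 1) / (real N + \<sigma> - 1 + 1) - 0) - al * A * 1)) {0..1}"
    proof -
      have "((\<lambda>s. s powr (real N + \<sigma> - 1)) has_integral (1 powr (real N + \<sigma> - 1 + 1) / (real N + \<sigma> - 1 + 1))) {0..1}"
        using N1 sig by (intro has_integral_powr_from_0) auto
      from has_integral_mult_right[OF this, of "c * A powr p"] have
        "((\<lambda>s. c * A powr p * s powr (real N + \<sigma> - 1)) has_integral (c * A powr p * (1 powr (real N + \<sigma> - 1 + 1) / (real N + \<sigma> - 1 + 1)))) {0..1}" .
      from has_integral_diff[OF this has_integral_const_real[of "al * A" 0 1]] show ?thesis by simp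
    qed
    then have "c * A powr p / (real N + \<sigma>) - al * A \<le> integral {0..1} (source (F A))"
    proof (rule has_integral_le[OF _ integrable_integral[OF source_integrable[OF pc order_refl]], THEN order_trans[rotated]])
      fix s :: real assume s: "s \<in> {0..1}"
      have Fs: "F A s > 0" "F A s \<le> A" using F_pos[OF d1, of s] FA[OF d1, of s] s by auto
      have "s ^ (N - 1) * s powr \<sigma> = s powr (real N + \<sigma> - 1)"
      proof (cases "s = 0")
        case False
        then show ?thesis using s N1 by (simp add: powr_realpow[symmetric] of_nat_diff powr_add[symmetric] algebra_simps)
      qed (use N1 sig in auto)
      then have "s powr (real N + \<sigma> - 1) * (c * A powr p) \<le> s ^ (N - 1) * (s powr \<sigma> * F A s powr p)"
        using mult_left_mono[OF Fp[OF s], of "s powr (real N + \<sigma> - 1)"] by (simp add: mult.assoc[symmetric])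
      moreover have "s ^ (N - 1) * (al * F A s) \<le> 1 * (al * A)"
        using s Fs al_pos by (intro mult_mono power_le_one) auto
      moreover have "0 \<le> s ^ (N - 1) * (real N * be * F A s)"
        using s Fs be_pos by (intro mult_nonneg_nonneg) auto
      ultimately show "c * A powr p * s powr (real N + \<sigma> - 1) - al * A \<le> source (F A) s"
        by (simp add: source_def algebra_simps)
    qed simp
    moreover have "srcint (F A) 1 \<le> be * A"
    proof -
      have "srcint (F A) 1 \<le> be * F A 1" using FGneg[OF d1] by (simp add: FG_def flux_def)
      also have "\<dots> \<le> be * A" using FA[OF d1, of 1] be_pos by simp
      finally show ?thesis .
    qed
    ultimately have "c * A powr p / (real N + \<sigma>) \<le> (al + be) * A" by (simp add: srcint_def algebra_simps)
    moreover have "A powr p = A powr (p - 1) * A" using A1 powr_mult_base[of A "p - 1"] by (simp add: mult.commute)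
    ultimately have "c * A powr (p - 1) * A \<le> (al + be) * (real N + \<sigma>) * A"
      using sig by (simp add: divide_le_eq mult_ac)
    then have "c * A powr (p - 1) \<le> (al + be) * (real N + \<sigma>)" using A1 by simp
    then show False using Ap by simp
  qed
qed

subsection \<open>The trichotomy\<close>

lemma rhod_nu: "rhod A t = m * (rho A t)^2 - (real N - 2) * rho A t
    + Lam A t / m * (be * (nu - rho A t) + (ka - X A t))"
  unfolding rhod_def by (subst al_nu) (simp add: algebra_simps)

lemma rhod_ga: "D A t \<Longrightarrow> rhod A t = m * (rho A t)^2 - (real N - 2) * rho A t - H A t powr (p - m) / m
    + be * Lam A t / m * (ga - rho A t)"
  unfolding rhod_def Lam_X[symmetric] by (subst al_ga) (simp add: algebra_simps add_divide_distrib diff_divide_distrib)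

text \<open>The last inequality makes \<open>rho\<close> increase on the side \<open>rho = nu\<close> of the region.\<close>

definition fast :: "real \<Rightarrow> real \<Rightarrow> bool" where
  "fast A t \<longleftrightarrow> D A t \<and> rho A t > nu \<and> X A t < ka \<and> Lam A t * (ka - X A t) > m * real N * nu"

lemma fast_open: assumes "fast A t" shows "\<forall>\<^sub>F A' in nhds A. fast A' t"
proof -
  have d: "D A t" and f: "rho A t > nu" "X A t < ka" "Lam A t * (ka - X A t) > m * real N * nu"
    using assms by (auto simp: fast_def)
  have "((\<lambda>A'. Lam A' t * (ka - X A' t)) \<longlongrightarrow> Lam A t * (ka - X A t)) (nhds A)"
    using Lam_tendsto[OF d] X_tendsto[OF d] by (intro tendsto_intros)
  from D_ev[OF d] order_tendstoD(1)[OF rho_tendsto[OF d] f(1)] order_tendstoD(2)[OF X_tendsto[OF d] f(2)]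
    order_tendstoD(1)[OF this f(3)]
  show ?thesis by eventually_elim (simp add: fast_def)
qed

text \<open>While \<open>rho \<ge> nu\<close>, \<open>X\<close> does not increase and
  \<open>Lam\<close> does not decrease, so the inequality for \<open>Lam A t * (ka - X A t)\<close>
  is inherited from \<open>t0\<close>. At a return to \<open>rho = nu\<close> it outweighs the term
  \<open>real N * nu\<close>, and \<open>rho\<close> would have to be increasing there.\<close>

lemma fast_forward:
  assumes f: "fast A t0" and d: "D A t1" and le: "t0 \<le> t1"
  shows "rho A t1 > nu" "X A t1 < ka"
proof -
  have mono: "X A r \<le> X A t0 \<and> Lam A t0 \<le> Lam A r"
    if r: "r \<in> {t0..t1}" and b: "\<And>t. t \<in> {t0..r} \<Longrightarrow> rho A t - nu \<ge> 0" for r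
  proof
    have dd: "D A x" if "x \<le> r" for x using D_mono[OF d] that r by auto
    have r0: "t0 \<le> r" using r by auto
    show "X A r \<le> X A t0"
    proof (rule DERIV_nonpos_imp_nonincreasing[OF r0])
      fix x assume x: "t0 \<le> x" "x \<le> r"
      have "(p - 1) * X A x * (nu - rho A x) \<le> 0"
        using X_pos[OF dd] x b[of x] m1 mp by (intro mult_nonneg_nonpos) (auto simp: less_imp_le)
      then show "\<exists>y. DERIV (X A) x :> y \<and> y \<le> 0" using X_deriv[OF dd] x by blast
    qed
    show "Lam A t0 \<le> Lam A r"
    proof (rule DERIV_nonneg_imp_nondecreasing[OF r0])
      fix x assume x: "t0 \<le> x" "x \<le> r"
      have "rho A x \<ge> 0" using b[of x] x nu_pos by auto
      then have "Lam A x * (2 + (m - 1) * rho A x) \<ge> 0"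
        using Lam_pos[OF dd] x m1 by (intro mult_nonneg_nonneg add_nonneg_nonneg) (auto simp: less_imp_le)
      then show "\<exists>y. DERIV (Lam A) x :> y \<and> 0 \<le> y" using Lam_deriv[OF dd] x by blast
    qed
  qed
  have pos: "rho A r - nu > 0" if r: "r \<in> {t0..t1}" for r
  proof (rule barrier[of t0 r "\<lambda>t. rho A t - nu" "rhod A"])
    show "t0 \<le> r" using r by auto
    fix t assume "t \<in> {t0..r}"
    then show "((\<lambda>t. rho A t - nu) has_real_derivative rhod A t) (at t)"
      using rho_deriv'[OF D_mono[OF d]] r by (auto intro!: derivative_eq_intros)
  next
    show "rho A t0 - nu > 0" using f by (simp add: fast_def)
    fix t assume t: "t \<in> {t0..r}" "rho A t - nu = 0" and b: "\<And>s. s \<in> {t0..t} \<Longrightarrow> rho A s - nu \<ge> 0"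
    have mo: "X A t \<le> X A t0" "Lam A t0 \<le> Lam A t" using mono[of t] b t r by auto
    have "Lam A t0 * (ka - X A t0) \<le> Lam A t * (ka - X A t)"
      using mo f Lam_pos[of A t0] by (intro mult_mono) (auto simp: fast_def)
    then have "m * real N * nu < Lam A t * (ka - X A t)" using f by (simp add: fast_def)
    then have "real N * nu < Lam A t / m * (ka - X A t)" using m1 by (simp add: less_divide_eq mult_ac)
    moreover have "rhod A t = m * nu^2 + 2 * nu - real N * nu + Lam A t / m * (ka - X A t)"
      using t(2) by (simp add: rhod_nu algebra_simps)
    moreover have "m * nu^2 > 0" using nu_pos m1 by simp
    ultimately show "rhod A t > 0" using nu_pos by linarith
  qed
  show "rho A t1 > nu" using pos[of t1] le by auto
  show "X A t1 < ka" using mono[of t1] pos f le by (force simp: fast_def less_imp_le)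
qed

definition critical :: "real \<Rightarrow> bool" where
  "critical A \<longleftrightarrow> A > 0 \<and> (\<forall>t. D A t \<and> rho A t \<ge> 0) \<and> (X A \<longlongrightarrow> ka) at_top"

lemma fast_not_turns_up: "fast A t \<Longrightarrow> \<not> turns_up A"
proof
  assume f: "fast A t" and "turns_up A"
  then obtain s where s: "D A s" "rho A s < 0" by (auto simp: turns_up_def)
  have dt: "D A t" using f by (simp add: fast_def)
  show False
  proof (cases "s \<le> t")
    case True
    then show False using rho_neg_forward[OF dt True s(2)] f nu_pos by (simp add: fast_def)
  next
    case False
    then show False using fast_forward(1)[OF f s(1)] s nu_pos by auto
  qed
qed

text \<open>Nonnegative \<open>rho\<close> gives \<open>E \<le> A\<close>, and the exponent
  \<open>1 - m\<close> is negative, so \<open>Lam\<close> grows at least like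
  \<open>exp (2 * t)\<close>. This is the separation of time scales.\<close>

lemma Lam_lower:
  assumes A: "A > 0" and g: "\<And>t. D A t" and r: "\<And>t. rho A t \<ge> 0"
  obtains t0 where "\<And>t. t \<ge> t0 \<Longrightarrow> Lam A t > c"
proof -
  have L: "exp (2 * t) * A powr (1 - m) \<le> Lam A t" for t
  proof -
    have "E A t \<le> A" using E_le[OF g] r by auto
    then have "A powr (1 - m) \<le> E A t powr (1 - m)"
      using E_pos[OF g] m1 A by (intro powr_mono2') auto
    then show ?thesis unfolding Lam_def by simp
  qed
  define K where "K = (\<bar>c\<bar> + 1) / A powr (1 - m)"
  have K: "K > 0" using A by (simp add: K_def)
  show thesis
  proof (rule that[of "ln K / 2"])
    fix t assume "t \<ge> ln K / 2"
    then have "exp (2 * t) \<ge> K" using K by (metis exp_le_cancel_iff exp_ln divide_le_eq_numeral1(1) mult.commute)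
    then have "exp (2 * t) * A powr (1 - m) \<ge> \<bar>c\<bar> + 1" using A by (simp add: K_def divide_le_eq)
    then show "Lam A t > c" using L[of t] by linarith
  qed
qed

text \<open>Near extinction \<open>E\<close> is small at times in a bounded interval, so
  \<open>X\<close> is small and \<open>Lam\<close> large. \<open>e1\<close> is tuned to give
  \<open>X A s \<le> ka / 2\<close>, and \<open>e2\<close> to give a \<open>Lam A s\<close> whose
  product with \<open>ka / 2\<close> exceeds the threshold in \<open>fast\<close>.\<close>

lemma extinction_fast:
  assumes A: "A > 0" and nd: "\<not> D A T" and r: "\<And>t. D A t \<Longrightarrow> rho A t \<ge> 0"
  shows "\<exists>t. fast A t"
proof -
  obtain T0 where T0: "\<And>e c. e > 0 \<Longrightarrow> \<exists>s. D A s \<and> T0 \<le> s \<and> s < T \<and> E A s < e \<and> rho A s > c"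
    using extinction[OF A nd r] by blast
  define e1 where "e1 = (ka / (2 * exp (\<sigma> * T))) powr (1 / (p - 1))"
  define e2 where "e2 = ((2 * m * real N * nu + 1) / ka * exp (- 2 * T0)) powr (1 / (1 - m))"
  have B: "(2 * m * real N * nu + 1) / ka * exp (- 2 * T0) > 0"
    using ka_pos nu_pos m1 by (intro mult_pos_pos divide_pos_pos add_nonneg_pos) auto
  have e: "e1 > 0" "e2 > 0" using ka_pos B by (auto simp: e1_def e2_def)
  obtain s where s: "D A s" "T0 \<le> s" "s < T" "E A s < min e1 e2" "rho A s > nu"
    using T0[of "min e1 e2" nu] e by auto
  have Ep: "E A s > 0" using E_pos[OF s(1)] .
  have "X A s \<le> ka / 2"
  proof -
    have "E A s powr (p - 1) \<le> e1 powr (p - 1)" using s Ep m1 mp by (intro powr_mono2) auto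
    also have "\<dots> = ka / (2 * exp (\<sigma> * T))" using ka_pos m1 mp by (simp add: e1_def powr_powr)
    finally have "X A s \<le> exp (\<sigma> * T) * (ka / (2 * exp (\<sigma> * T)))"
      unfolding X_def using s sig by (intro mult_mono) auto
    then show ?thesis by simp
  qed
  moreover have "Lam A s \<ge> (2 * m * real N * nu + 1) / ka"
  proof -
    have "(2 * m * real N * nu + 1) / ka * exp (- 2 * T0) = e2 powr (1 - m)"
    proof -
      have "(y powr (1 / (1 - m))) powr (1 - m) = y" if "y > 0" for y using that m1 by (simp add: powr_powr)
      then show ?thesis using B unfolding e2_def by metis
    qed
    also have "\<dots> \<le> E A s powr (1 - m)" using s Ep m1 by (intro powr_mono2') auto
    finally have "exp (2 * T0) * ((2 * m * real N * nu + 1) / ka * exp (- 2 * T0)) \<le> Lam A s"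
      unfolding Lam_def using s less_imp_le[OF B] by (intro mult_mono) simp_all
    moreover have "exp (2 * T0) * (y * exp (- 2 * T0)) = y" for y by (simp add: exp_minus)
    ultimately show ?thesis by metis
  qed
  ultimately have "(2 * m * real N * nu + 1) / ka * (ka / 2) \<le> Lam A s * (ka - X A s)"
    using Lam_pos[OF s(1)] ka_pos by (intro mult_mono) auto
  moreover have "(2 * m * real N * nu + 1) / ka * (ka / 2) > m * real N * nu" using ka_pos by simp
  ultimately have "fast A s" using s \<open>X A s \<le> ka / 2\<close> ka_pos unfolding fast_def by auto
  then show ?thesis by blast
qed

text \<open>Excluding the two alternatives ties the sign of \<open>nu - rho\<close> to that of
  \<open>X - ka\<close> at late times: \<open>X < ka - e\<close> with \<open>rho > nu\<close> would
  be \<open>fast\<close>, and \<open>X > ka + e\<close> with \<open>rho < nu\<close> would lead to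
  turning up. Hence \<open>X\<close> does not move away from \<open>ka\<close> once it is farther
  than \<open>e\<close> from it. It cannot stay there either, because the large factor
  \<open>Lam\<close> would push \<open>rho\<close> across \<open>nu\<close>.\<close>

lemma trichotomy:
  assumes A: "A > 0" and nF: "\<And>t. \<not> fast A t" and nI: "\<not> turns_up A"
  shows "critical A"
proof -
  have r0: "\<And>t. D A t \<Longrightarrow> rho A t \<ge> 0" using nI by (force simp: turns_up_def)
  have g: "D A t" for t using extinction_fast[OF A _ r0] nF by blast
  have r: "rho A t \<ge> 0" for t using r0 g by blast
  have Xd: "(X A has_real_derivative (p - 1) * X A t * (nu - rho A t)) (at t)" for t using X_deriv[OF g] .
  have Xp: "X A t > 0" for t using X_pos[OF g] .
  have Lp: "Lam A t > 0" for t using Lam_pos[OF g] .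
  have rd: "(rho A has_real_derivative rhod A t) (at t)" for t using rho_deriv'[OF g] .
  have low: "\<forall>\<^sub>F t in at_top. X A t \<ge> ka - e" if e: "e > 0" for e
  proof -
    obtain t0 where t0: "\<And>t. t \<ge> t0 \<Longrightarrow> Lam A t > m * (real N * nu + 1) / e" using Lam_lower[OF A g r] by blast
    have Le: "Lam A t * e > m * (real N * nu + 1)" if "t \<ge> t0" for t using t0[OF that] e by (simp add: divide_less_eq)
    have slow: "rho A t \<le> nu" if t: "t \<ge> t0" "X A t < ka - e" for t
    proof (rule ccontr)
      assume n: "\<not> rho A t \<le> nu"
      have "Lam A t * e \<le> Lam A t * (ka - X A t)" using t Lp[of t] by (intro mult_left_mono) auto
      moreover have "m * (real N * nu + 1) > m * real N * nu" using m1 by (simp add: algebra_simps)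
      ultimately have "fast A t" using g n t e Le[of t] unfolding fast_def by auto
      then show False using nF by blast
    qed
    have "\<exists>t1\<ge>t0. X A t1 \<ge> ka - e"
    proof (rule ccontr)
      assume n: "\<not> (\<exists>t1\<ge>t0. X A t1 \<ge> ka - e)"
      have "\<exists>t\<ge>t0. rho A t > nu"
      proof (rule unbounded_above_of_deriv_ge_1[OF rd])
        fix t assume t: "t \<ge> t0"
        have Xt: "X A t < ka - e" using n t by force
        have rt: "rho A t \<le> nu" "rho A t \<ge> 0" using slow[OF t Xt] r by auto
        have "Lam A t / m * e \<le> Lam A t / m * (be * (nu - rho A t) + (ka - X A t))"
          using rt Xt be_pos Lp[of t] m1 by (intro mult_left_mono) (auto intro: add_increasing)
        moreover have "Lam A t / m * e > real N * nu + 1" using Le[OF t] m1 by (simp add: less_divide_eq mult.commute)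
        moreover have "real N * rho A t \<le> real N * nu" using rt by (intro mult_left_mono) auto
        moreover have "m * (rho A t)^2 \<ge> 0" using m1 by simp
        moreover have "(real N - 2) * rho A t = real N * rho A t - 2 * rho A t" by (simp add: algebra_simps)
        ultimately show "rhod A t \<ge> 1" using rt unfolding rhod_nu by linarith
      qed
      then show False using slow n by force
    qed
    then obtain t1 where t1: "t1 \<ge> t0" "X A t1 \<ge> ka - e" by blast
    have "X A t \<ge> ka - e" if "t \<ge> t1" for t
    proof (rule eventually_ge_of_nondecreasing_below[OF Xd _ t1 that])
      fix t assume "t \<ge> t0" "X A t < ka - e"
      then show "(p - 1) * X A t * (nu - rho A t) \<ge> 0"
        using slow[of t] Xp[of t] m1 mp by (intro mult_nonneg_nonneg) auto
    qed
    then show ?thesis unfolding eventually_at_top_linorder by blast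
  qed
  have up: "\<forall>\<^sub>F t in at_top. X A t \<le> ka + e" if e: "e > 0" for e
  proof -
    \<comment> \<open>Dominates the part of \<open>rhod\<close> without \<open>Lam\<close> for
      \<open>0 \<le> rho \<le> nu + 1\<close>, with \<open>1\<close> to spare.\<close>
    define c where "c = m * (nu + 1)^2 + real N * (nu + 1) + 2 * (nu + 1) + 1"
    have c: "c > 0" unfolding c_def using nu_pos m1 by (intro add_nonneg_pos add_nonneg_nonneg mult_nonneg_nonneg) auto
    define e' where "e' = min (e / 2) 1"
    have e': "e' > 0" "e' \<le> e / 2" "e' \<le> 1" using e by (auto simp: e'_def)
    obtain t0 where t0: "\<And>t. t \<ge> t0 \<Longrightarrow> Lam A t > m * c / e'" using Lam_lower[OF A g r] by blast
    have Le: "Lam A t / m * e' > c" if "t \<ge> t0" for t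
      using t0[OF that] e' m1 by (simp add: divide_less_eq less_divide_eq mult_ac)
    have rdneg: "rhod A t \<le> -1"
      if t: "t \<ge> t0" "rho A t \<le> nu + 1" "be * (nu - rho A t) + (ka - X A t) \<le> - e'" for t
    proof -
      define Q where "Q = Lam A t / m * (be * (nu - rho A t) + (ka - X A t))"
      have "Q \<le> Lam A t / m * (- e')"
        unfolding Q_def using t Lp[of t] m1 by (intro mult_left_mono) auto
      then have "Q \<le> - (Lam A t / m * e')" by simp
      moreover have "m * (rho A t)^2 \<le> m * (nu + 1)^2" using t r[of t] m1 by (intro mult_left_mono power_mono) auto
      moreover have "real N * rho A t \<ge> 0" using r by simp
      moreover have "(real N - 2) * rho A t = real N * rho A t - 2 * rho A t" by (simp add: algebra_simps)
      moreover have "real N * (nu + 1) \<ge> 0" using nu_pos by simp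
      moreover have "m * (nu + 1)^2 + real N * (nu + 1) + 2 * (nu + 1) + 1 < Lam A t / m * e'"
        using Le[OF t(1)] by (simp add: c_def)
      moreover have "rhod A t = m * (rho A t)^2 - (real N - 2) * rho A t + Q" by (simp add: rhod_nu Q_def)
      moreover have "2 * rho A t \<le> 2 * (nu + 1)" using t(2) by simp
      moreover have "a \<le> -1" if "q \<le> - l" "m1 \<le> m2" "0 \<le> n1" "n2 = n1 - r" "0 \<le> n3" "m2 + n3 + r2 + 1 < l" "a = m1 - n2 + q" "r \<le> r2"
        for a q l m1 m2 n1 n2 n3 r r2 :: real using that by linarith
      ultimately show ?thesis by metis
    qed
    have Xinc: "X A s \<le> X A t" if "s \<le> t" "\<And>x. x \<in> {s..t} \<Longrightarrow> rho A x \<le> nu" for s t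
    proof (rule DERIV_nonneg_imp_nondecreasing[OF that(1)])
      fix x assume x: "s \<le> x" "x \<le> t"
      have "(p - 1) * X A x * (nu - rho A x) \<ge> 0"
        using Xp[of x] that(2)[of x] x m1 mp by (intro mult_nonneg_nonneg) auto
      then show "\<exists>y. DERIV (X A) x :> y \<and> 0 \<le> y" using Xd by blast
    qed
    have trap: "rho A t < b"
      if ts: "s \<le> t" "s \<ge> t0" "rho A s < b" "b \<le> nu + 1"
        and bd: "\<And>x. x \<ge> s \<Longrightarrow> rho A x = b \<Longrightarrow> (\<And>y. y \<in> {s..x} \<Longrightarrow> rho A y \<le> b) \<Longrightarrow> be * (nu - b) + (ka - X A x) \<le> - e'"
      for s t b
    proof -
      have "b - rho A t > 0"
      proof (rule barrier[OF ts(1), of "\<lambda>t. b - rho A t" "\<lambda>t. - rhod A t"])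
        show "((\<lambda>t. b - rho A t) has_real_derivative - rhod A x) (at x)" for x
          using rd[of x] by (auto intro!: derivative_eq_intros)
        show "b - rho A s > 0" using ts by simp
        fix x assume x: "x \<in> {s..t}" "b - rho A x = 0" "\<And>y. y \<in> {s..x} \<Longrightarrow> b - rho A y \<ge> 0"
        then have "be * (nu - b) + (ka - X A x) \<le> - e'" by (intro bd) auto
        then show "- rhod A x > 0" using rdneg[of x] x ts by force
      qed
      then show ?thesis by simp
    qed
    \<comment> \<open>Otherwise a runaway: \<open>rho\<close> stays below \<open>nu\<close>, then
      drops below \<open>nu - \<eta>\<close> for good, \<open>X\<close> grows at least linearly past
      \<open>al\<close>, and finally \<open>rho\<close> becomes negative.\<close>
    have slow: "rho A s \<ge> nu" if s: "s \<ge> t0" "X A s > ka + e" for s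
    proof (rule ccontr)
      assume n: "\<not> rho A s \<ge> nu"
      have below: "rho A t < nu" if "t \<ge> s" for t
      proof (rule trap[OF that s(1)])
        fix x assume "x \<ge> s" "\<And>y. y \<in> {s..x} \<Longrightarrow> rho A y \<le> nu"
        then have "X A s \<le> X A x" using Xinc by blast
        then show "be * (nu - nu) + (ka - X A x) \<le> - e'" using s e' e by simp
      qed (use n in auto)
      have Xbig: "X A t > ka + e" if "t \<ge> s" for t
        using Xinc[OF that] below s less_imp_le by fastforce
      \<comment> \<open>With \<open>be * \<eta> = e / 2\<close> the excess \<open>X > ka + e\<close>
        still leaves a downward push of \<open>e / 2\<close> while
        \<open>rho \<ge> nu - \<eta>\<close>.\<close>
      define \<eta> where "\<eta> = e / (2 * be)"
      have eta: "\<eta> > 0" "be * \<eta> = e / 2" using e be_pos by (auto simp: \<eta>_def)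
      have "\<exists>t\<ge>s. rho A t < nu - \<eta>"
      proof (rule ccontr)
        assume n2: "\<not> (\<exists>t\<ge>s. rho A t < nu - \<eta>)"
        have "\<exists>t\<ge>s. rho A t < 0"
        proof (rule unbounded_below_of_deriv_le_neg1[OF rd])
          fix t assume t: "t \<ge> s"
          have "be * (nu - rho A t) \<le> be * \<eta>" using n2 t be_pos by (intro mult_left_mono) force+
          then show "rhod A t \<le> -1" using Xbig[OF t] below[OF t] eta e' t s by (intro rdneg) auto
        qed
        then show False using r by (meson not_less)
      qed
      then obtain s2 where s2: "s2 \<ge> s" "rho A s2 < nu - \<eta>" by blast
      have below2: "rho A t < nu - \<eta>" if "t \<ge> s2" for t
      proof (rule trap[OF that _ s2(2)])
        fix x assume "x \<ge> s2"
        then show "be * (nu - (nu - \<eta>)) + (ka - X A x) \<le> - e'" using Xbig[of x] s2 eta e' by simp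
      qed (use s s2 eta in auto)
      define k where "k = (p - 1) * ka * \<eta>"
      have k: "k > 0" using m1 mp ka_pos eta by (simp add: k_def)
      have "\<exists>t\<ge>s2. X A t / k > (al + 1) / k"
      proof (rule unbounded_above_of_deriv_ge_1)
        show "((\<lambda>t. X A t / k) has_real_derivative (p - 1) * X A t * (nu - rho A t) / k) (at t)" for t
          using DERIV_cdivide[OF Xd] by blast
        fix t assume t: "t \<ge> s2"
        have "(p - 1) * ka * \<eta> \<le> (p - 1) * X A t * (nu - rho A t)"
          using below2[OF t] Xbig[of t] t s2 e m1 mp ka_pos eta Xp[of t] by (intro mult_mono) auto
        then show "(p - 1) * X A t * (nu - rho A t) / k \<ge> 1" using k unfolding k_def[symmetric] by simp
      qed
      then obtain s3 where s3: "s3 \<ge> s2" "X A s3 > al + 1" using k by (auto simp: divide_less_cancel)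
      have "\<exists>t\<ge>s3. rho A t < 0"
      proof (rule unbounded_below_of_deriv_le_neg1[OF rd])
        fix t assume t: "t \<ge> s3"
        have "X A s3 \<le> X A t" using Xinc[OF t] below s2 s3 by (force intro: less_imp_le)
        moreover have "be * (nu - rho A t) + (ka - X A t) = al - be * rho A t - X A t"
          by (subst al_nu) (simp add: algebra_simps)
        moreover have "be * rho A t \<ge> 0" using be_pos r[of t] by simp
        ultimately have "be * (nu - rho A t) + (ka - X A t) \<le> - e'" using s3 e' by linarith
        then show "rhod A t \<le> -1" using below[of t] t s s2 s3 by (intro rdneg) auto
      qed
      then show False using r by (meson not_less)
    qed
    have "\<exists>t1\<ge>t0. X A t1 \<le> ka + e"
    proof (rule ccontr)
      assume n: "\<not> (\<exists>t1\<ge>t0. X A t1 \<le> ka + e)"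
      then have Xbig: "X A t > ka + e" if "t \<ge> t0" for t using that by force
      \<comment> \<open>The drift estimate \<open>rdneg\<close> covers only
        \<open>rho \<le> nu + 1\<close>. Staying above that level would make \<open>X\<close>, which
        is kept above \<open>ka + e\<close>, fall at a fixed rate and become negative.\<close>
      have "\<exists>s\<ge>t0. rho A s < nu + 1"
      proof (rule ccontr)
        assume n2: "\<not> (\<exists>s\<ge>t0. rho A s < nu + 1)"
        define k where "k = (p - 1) * ka"
        have k: "k > 0" using m1 mp ka_pos by (simp add: k_def)
        have "\<exists>t\<ge>t0. X A t / k < 0"
        proof (rule unbounded_below_of_deriv_le_neg1)
          show "((\<lambda>t. X A t / k) has_real_derivative (p - 1) * X A t * (nu - rho A t) / k) (at t)" for t
            using DERIV_cdivide[OF Xd] by blast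
          fix t assume t: "t \<ge> t0"
          have "(p - 1) * ka * 1 \<le> (p - 1) * X A t * (rho A t - nu)"
            using n2 Xbig[of t] t e m1 mp ka_pos Xp[of t] by (intro mult_mono) force+
          then show "(p - 1) * X A t * (nu - rho A t) / k \<le> - 1"
            using k by (simp add: k_def divide_le_eq right_diff_distrib)
        qed
        then show False using Xp k by (simp add: divide_less_0_iff) (meson less_asym)
      qed
      then obtain s where s: "s \<ge> t0" "rho A s < nu + 1" by blast
      have below: "rho A t < nu + 1" if "t \<ge> s" for t
      proof (rule trap[OF that s])
        fix x assume "x \<ge> s"
        then show "be * (nu - (nu + 1)) + (ka - X A x) \<le> - e'" using Xbig[of x] s be_pos e' e by simp
      qed simp
      have "\<exists>t\<ge>s. rho A t < 0"
      proof (rule unbounded_below_of_deriv_le_neg1[OF rd])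
        fix t assume t: "t \<ge> s"
        have "be * (nu - rho A t) \<le> 0"
          using slow[of t] Xbig[of t] t s be_pos by (simp add: mult_le_0_iff)
        then show "rhod A t \<le> -1" using below[OF t] Xbig[of t] t s e' e by (intro rdneg) auto
      qed
      then show False using r by (meson not_less)
    qed
    then obtain t1 where t1: "t1 \<ge> t0" "X A t1 \<le> ka + e" by blast
    have "X A t \<le> ka + e" if "t \<ge> t1" for t
    proof (rule eventually_le_of_nonincreasing_above[OF Xd _ t1 that])
      fix t assume "t \<ge> t0" "X A t > ka + e"
      then show "(p - 1) * X A t * (nu - rho A t) \<le> 0"
        using slow[of t] Xp[of t] m1 mp by (intro mult_nonneg_nonpos) auto
    qed
    then show ?thesis unfolding eventually_at_top_linorder by blast
  qed
  have "(X A \<longlongrightarrow> ka) at_top"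
  proof (rule tendstoI)
    fix e :: real assume e: "e > 0"
    from low[of "e/2"] up[of "e/2"] e show "\<forall>\<^sub>F t in at_top. dist (X A t) ka < e"
      by (auto simp: dist_real_def elim: eventually_elim2)
  qed
  then show ?thesis using A g r by (simp add: critical_def)
qed

subsection \<open>The sliding argument\<close>

definition scale_exp :: real where "scale_exp = 2 / (m - 1)"
definition th :: real where "th = \<sigma> + scale_exp * (p - 1)"

lemma kk_pos: "scale_exp > 0" and th_pos: "th > 0"
  using m1 mp sig by (auto simp: scale_exp_def th_def intro!: add_pos_pos mult_pos_pos)

text \<open>The scaling that leaves the equation without absorption invariant; for \<open>l > 1\<close> it
  multiplies the absorption term by \<open>l powr th > 1\<close>.\<close>

definition rescaled :: "real \<Rightarrow> real \<Rightarrow> real \<Rightarrow> real" where "rescaled A l x = l powr (- scale_exp) * F A (l * x)"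
definition rescaled_flux :: "real \<Rightarrow> real \<Rightarrow> real \<Rightarrow> real" where "rescaled_flux A l x = l powr (- scale_exp - 1) * FG A (l * x)"

text \<open>The \<open>m\<close>-th power carries two more factors \<open>1 / l\<close> than the
  function itself, exactly what the two derivatives in the diffusion term give back.\<close>

lemma kk_m: "- scale_exp * m = - scale_exp - 2"
  using m1 by (simp add: scale_exp_def field_simps)

lemma rescaled_m:
  assumes "l > 0" "F A (l * x) > 0"
  shows "rescaled A l x powr m = l powr (- scale_exp - 2) * F A (l * x) powr m"
  using assms kk_m by (simp add: rescaled_def powr_mult powr_powr)

lemma rescaled_m_deriv:
  assumes g: "\<And>R. R > 0 \<Longrightarrow> solvable A R" and l: "l > 0" and x: "x > 0"
  shows "((\<lambda>x. rescaled A l x powr m) has_real_derivative rescaled_flux A l x) (at x)"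
proof -
  have d: "solvable A (l * x)" using g l x by simp
  have "((\<lambda>x. F A (l * x) powr m) has_real_derivative FG A (l * x) * l) (at x)"
    using DERIV_chain2[OF Fm_deriv[OF d] DERIV_cmult[OF DERIV_ident]] by simp
  from DERIV_cmult[OF this, of "l powr (- scale_exp - 2)"]
  have "((\<lambda>x. l powr (- scale_exp - 2) * F A (l * x) powr m) has_real_derivative l powr (- scale_exp - 2) * (FG A (l * x) * l)) (at x)" .
  moreover have "l powr (- scale_exp - 2) * l = l powr (- scale_exp - 1)"
    using l by (simp add: powr_diff power2_eq_square)
  ultimately have "((\<lambda>x. l powr (- scale_exp - 2) * F A (l * x) powr m) has_real_derivative rescaled_flux A l x) (at x)"
    unfolding rescaled_flux_def by (metis mult.assoc mult.commute)
  then show ?thesis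
  proof (rule has_field_derivative_transform_within_open[of _ _ _ "{0<..}"])
    fix y :: real assume "y \<in> {0<..}"
    then have "F A (l * y) > 0" using F_pos[OF g[of "l * y"], of "l * y"] l by simp
    then show "l powr (- scale_exp - 2) * F A (l * y) powr m = rescaled A l y powr m" using rescaled_m l by simp
  qed (use x in auto)
qed

lemma rescaled_flux_deriv:
  assumes g: "\<And>R. R > 0 \<Longrightarrow> solvable A R" and l: "l > 0" and x: "x > 0"
  shows "(rescaled_flux A l has_real_derivative - al * rescaled A l x - be * x * (rescaled_flux A l x * rescaled A l x / (m * rescaled A l x powr m))
     + l powr th * (x powr \<sigma> * rescaled A l x powr p) - (real N - 1) / x * rescaled_flux A l x) (at x)"
proof -
  have d: "solvable A (l * x)" using g l x by simp
  have Fp: "F A (l * x) > 0" using F_pos[OF d, of "l * x"] l x by simp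
  have "((\<lambda>x. l powr (- scale_exp - 1) * FG A (l * x)) has_real_derivative l powr (- scale_exp - 1) * ((
     - al * F A (l * x) - be * (l * x) * (FG A (l * x) * F A (l * x) / (m * F A (l * x) powr m))
     + (l * x) powr \<sigma> * F A (l * x) powr p - (real N - 1) / (l * x) * FG A (l * x)) * l)) (at x)"
    using DERIV_cmult[OF DERIV_chain2[OF FG_deriv[OF d] DERIV_cmult[OF DERIV_ident]]] by simp
  then have 1: "(rescaled_flux A l has_real_derivative l powr (- scale_exp - 1) * ((
     - al * F A (l * x) - be * (l * x) * (FG A (l * x) * F A (l * x) / (m * F A (l * x) powr m))
     + (l * x) powr \<sigma> * F A (l * x) powr p - (real N - 1) / (l * x) * FG A (l * x)) * l)) (at x)"
    by (simp add: rescaled_flux_def[abs_def])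
  define a f G V where "a = l powr (- scale_exp)" and "f = F A (l * x)" and "G = FG A (l * x)" and "V = F A (l * x) powr m"
  have a: "a > 0" using l by (simp add: a_def)
  have V: "V > 0" using Fp by (simp add: V_def)
  have e1: "l powr (- scale_exp - 1) = a / l" using l by (simp add: a_def powr_diff)
  have e2: "rescaled A l x powr m = a / l^2 * V"
    using rescaled_m[OF l Fp] l by (simp add: a_def V_def powr_diff powr_realpow)
  have e3: "l powr th * (x powr \<sigma> * rescaled A l x powr p) = a * ((l * x) powr \<sigma> * f powr p)"
  proof -
    have "rescaled A l x powr p = l powr (- scale_exp * p) * f powr p" using Fp l by (simp add: rescaled_def f_def powr_mult powr_powr)
    moreover have "l powr th * l powr (- scale_exp * p) = l powr \<sigma> * a"
      unfolding a_def by (simp add: th_def algebra_simps flip: powr_add)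
    moreover have "(l * x) powr \<sigma> = l powr \<sigma> * x powr \<sigma>" using l x by (simp add: powr_mult)
    ultimately show ?thesis by (simp add: mult_ac)
  qed
  have e4: "rescaled A l x = a * f" "rescaled_flux A l x = a / l * G" using e1 by (auto simp: rescaled_def rescaled_flux_def a_def f_def G_def)
  have e5: "(l * x) powr \<sigma> * F A (l * x) powr p = (l * x) powr \<sigma> * f powr p" by (simp add: f_def)
  show ?thesis
    by (rule DERIV_cong[OF 1], unfold e1 e2 e3, unfold V_def[symmetric], unfold e4 e5 f_def[symmetric] G_def[symmetric])
       (use a V l x m1 in \<open>simp add: field_simps power2_eq_square\<close>)
qed

text \<open>At the contact the values agree, and so do the fluxes because the difference
  \<open>d\<close> of the \<open>m\<close>-th powers is minimal. All terms of the two equations then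
  cancel except the absorption, and the second derivative of \<open>d\<close> is
  \<open>Q - l powr th * Q < 0\<close>, which is impossible at a minimum.\<close>

lemma interior_touch:
  assumes g1: "\<And>R. R > 0 \<Longrightarrow> solvable A1 R" and g2: "\<And>R. R > 0 \<Longrightarrow> solvable A2 R" and l: "l > 1" and x: "x > 0"
    and le: "\<And>y. y > 0 \<Longrightarrow> rescaled A2 l y \<le> F A1 y" and eq: "rescaled A2 l x = F A1 x"
  shows False
proof -
  define d where "d y = F A1 y powr m - rescaled A2 l y powr m" for y
  define d' where "d' y = FG A1 y - rescaled_flux A2 l y" for y
  have l0: "l > 0" using l by simp
  have dd: "(d has_real_derivative d' y) (at y)" if "y > 0" for y
    unfolding d_def[abs_def] d'_def using Fm_deriv[OF g1[OF that]] rescaled_m_deriv[OF g2 l0 that] by (intro DERIV_diff) auto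
  have dnn: "d y \<ge> 0" if "y > 0" for y
  proof -
    have "rescaled A2 l y \<ge> 0" using F_pos[OF g2[of "l * y"], of "l * y"] that l0 by (simp add: rescaled_def)
    then show ?thesis using le[OF that] m1 unfolding d_def by (simp add: powr_mono2)
  qed
  have dx: "d x = 0" using eq by (simp add: d_def)
  have "d' x = 0"
    by (rule DERIV_local_min[OF dd[OF x] x]) (use dx dnn in auto)
  then have G: "rescaled_flux A2 l x = FG A1 x" by (simp add: d'_def)
  define Q where "Q = x powr \<sigma> * F A1 x powr p"
  have Q: "Q > 0" using x F_pos[OF g1[OF x], of x] by (simp add: Q_def)
  have "(d' has_real_derivative (Q - l powr th * Q)) (at x)"
    unfolding d'_def[abs_def]
    by (rule DERIV_cong[OF DERIV_diff[OF FG_deriv[OF g1[OF x]] rescaled_flux_deriv[OF g2 l0 x]]])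
       (simp_all add: eq G Q_def)
  moreover have "l powr th > 1" using l th_pos by (simp add: gr_one_powr)
  then have "Q - l powr th * Q < 0" using Q by simp
  ultimately obtain e where e: "e > 0" "\<And>h. 0 < h \<Longrightarrow> h < e \<Longrightarrow> d' (x + h) < d' x"
    using DERIV_neg_dec_right[of d'] by blast
  have "d (x + e / 2) < d x"
  proof (rule DERIV_neg_imp_decreasing_open[of x "x + e / 2" d])
    fix y assume y: "x < y" "y < x + e / 2"
    then have "d' y < 0" using e(2)[of "y - x"] e(1) \<open>d' x = 0\<close> by simp
    then show "\<exists>z. DERIV d y :> z \<and> z < 0" using dd[of y] x y by auto
  next
    show "continuous_on {x..x + e / 2} d" by (rule DERIV_imp_continuous_on[OF dd]) (use x in auto)
  qed (use e in auto)
  then show False using dnn[of "x + e / 2"] dx x e by simp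
qed

lemma rescaled_srcint:
  assumes x: "x > 0" and l: "l > 0"
  shows "rescaled_flux A l x = (l powr (- scale_exp - 1) / l ^ (N - 1) * srcint (F A) (l * x)) / x ^ (N - 1) - be * x * rescaled A l x"
proof -
  have "l powr (- scale_exp - 1) * l = l powr (- scale_exp)" using l by (simp add: powr_diff)
  then have "l powr (- scale_exp - 1) * (be * (l * x) * F A (l * x)) = be * x * rescaled A l x"
    unfolding rescaled_def by (metis mult.assoc mult.left_commute)
  then show ?thesis using x l
    by (simp add: rescaled_flux_def FG_def flux_def power_mult_distrib right_diff_distrib)
qed

text \<open>Contact at the origin spreads: with \<open>d \<ge> 0\<close>, a one-sided Gronwall
  estimate in integral form shows that the maximum of \<open>d\<close> on a short interval is at
  most half of itself. The larger absorption of the rescaled solution and the term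
  \<open>- be * y * (F A1 y - rescaled A2 l y)\<close> have the favourable sign. An interior contact
  results, to which \<open>interior_touch\<close> applies.\<close>

lemma touch_at_0:
  assumes g1: "\<And>R. R > 0 \<Longrightarrow> solvable A1 R" and g2: "\<And>R. R > 0 \<Longrightarrow> solvable A2 R" and l: "l > 1"
    and le: "\<And>y. y \<ge> 0 \<Longrightarrow> rescaled A2 l y \<le> F A1 y" and eq: "rescaled A2 l 0 = F A1 0"
  shows "\<exists>x>0. rescaled A2 l x = F A1 x"
proof -
  have l0: "l > 0" using l by simp
  have scp: "rescaled A2 l y > 0" if "y \<ge> 0" for y
    using F_pos[OF g2[of "l * y + 1"], of "l * y"] that l0 by (simp add: rescaled_def add_nonneg_pos)
  have Fp: "F A1 y > 0" if "y \<ge> 0" for y using F_pos[OF g1[of "y + 1"], of y] that by simp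
  have c1: "continuous_on {0..1} (F A1)" using F_cont[OF g1] by simp
  have c2: "continuous_on {0..1} (rescaled A2 l)"
    unfolding rescaled_def[abs_def] using l0
    by (intro continuous_intros continuous_on_compose2[OF F_cont[OF g2[of l]]]) auto
  have "pos_cont 1 (F A1)" "pos_cont 1 (rescaled A2 l)" using c1 c2 Fp scp by (auto simp: pos_cont_def)
  then obtain a1 b1 a2 b2 where ab: "0 < a1" "\<And>x. x \<in> {0..1} \<Longrightarrow> a1 \<le> F A1 x powr m \<and> F A1 x powr m \<le> b1"
     "0 < a2" "\<And>x. x \<in> {0..1} \<Longrightarrow> a2 \<le> rescaled A2 l x powr m \<and> rescaled A2 l x powr m \<le> b2"
    using pos_cont_powr_bounds[of 1] zero_less_one by metis
  define a b where "a = min a1 a2" and "b = max b1 b2"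
  have a: "a > 0" using ab by (simp add: a_def)
  obtain k1 where k1: "k1 > 0" "\<And>x y. x \<in> {a..b} \<Longrightarrow> y \<in> {a..b} \<Longrightarrow> \<bar>x powr (1/m) - y powr (1/m)\<bar> \<le> k1 * \<bar>x - y\<bar>"
    using powr_lipschitz_on_interval[OF a] by blast
  obtain k2 where k2: "k2 > 0" "\<And>x y. x \<in> {a..b} \<Longrightarrow> y \<in> {a..b} \<Longrightarrow> \<bar>x powr (p/m) - y powr (p/m)\<bar> \<le> k2 * \<bar>x - y\<bar>"
    using powr_lipschitz_on_interval[OF a] by blast
  define d where "d y = F A1 y powr m - rescaled A2 l y powr m" for y
  have d0: "d y \<ge> 0" if "y \<ge> 0" for y
    using le[OF that] scp[OF that] m1 unfolding d_def by (simp add: powr_mono2)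
  have in_ab: "F A1 y powr m \<in> {a..b}" "rescaled A2 l y powr m \<in> {a..b}" if "y \<in> {0..1}" for y
    using ab that unfolding a_def b_def by (auto simp: min_le_iff_disj le_max_iff_disj)
  have L1: "F A1 y - rescaled A2 l y \<le> k1 * d y" if y: "y \<in> {0..1}" for y
    using k1(2)[OF in_ab[OF y]] d0[of y] Fp[of y] scp[of y] y m1 by (simp add: powr_powr d_def)
  have L2: "F A1 y powr p - rescaled A2 l y powr p \<le> k2 * d y" if y: "y \<in> {0..1}" for y
    using k2(2)[OF in_ab[OF y]] d0[of y] Fp[of y] scp[of y] y m1 by (simp add: powr_powr d_def)
  define C where "C = \<bar>real N * be - al\<bar> * k1 + k2"
  have C: "C > 0" using k1 k2 by (simp add: C_def add_nonneg_pos)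
  \<comment> \<open>Short enough that the factor \<open>C * x0 * x1\<close> in front of the maximum
    \<open>d x1\<close> is at most \<open>1 / 2\<close>.\<close>
  define x0 where "x0 = min 1 (1 / (2 * C))"
  have x0: "0 < x0" "x0 \<le> 1" "C * x0 \<le> 1 / 2" using C by (auto simp: x0_def min_def field_simps)
  define w where "w = l powr (- scale_exp - 1) / l ^ (N - 1)"
  define Y where "Y x = srcint (F A1) x - w * srcint (F A2) (l * x)" for x
  have cd: "continuous_on {0..x0} d" unfolding d_def[abs_def]
    using continuous_on_subset[OF c1] continuous_on_subset[OF c2] x0 Fp scp m1
    by (intro continuous_intros) (metis atLeastAtMost_iff order_less_irrefl | auto)+
  obtain x1 where x1: "x1 \<in> {0..x0}" "\<And>y. y \<in> {0..x0} \<Longrightarrow> d y \<le> d x1"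
    using continuous_attains_sup[OF _ _ cd] x0 by auto
  have Yd: "(Y has_real_derivative source (F A1) x - x ^ (N - 1) *
     ((real N * be - al) * rescaled A2 l x + l powr th * (x powr \<sigma> * rescaled A2 l x powr p))) (at x)" if x: "x > 0" for x
  proof -
    have d2: "solvable A2 (l * x)" using g2 l0 x by simp
    have f2: "F A2 (l * x) > 0" using F_pos[OF d2, of "l * x"] l0 x by simp
    have "(Y has_real_derivative source (F A1) x - w * (source (F A2) (l * x) * l)) (at x)"
      unfolding Y_def[abs_def]
      using DERIV_diff[OF srcint_deriv[OF g1[OF x]] DERIV_cmult[OF DERIV_chain2[OF srcint_deriv[OF d2] DERIV_cmult[OF DERIV_ident]]]]
      by simp
    moreover have "w * (source (F A2) (l * x) * l) = x ^ (N - 1) *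
     ((real N * be - al) * rescaled A2 l x + l powr th * (x powr \<sigma> * rescaled A2 l x powr p))"
    proof -
      define f where "f = F A2 (l * x)"
      have 1: "w * l * l ^ (N - 1) = l powr (- scale_exp)" using l0 by (simp add: w_def powr_diff)
      have 2: "l powr th * (x powr \<sigma> * rescaled A2 l x powr p) = l powr (- scale_exp) * ((l * x) powr \<sigma> * f powr p)"
      proof -
        have "rescaled A2 l x powr p = l powr (- scale_exp * p) * f powr p" using f2 l0 by (simp add: rescaled_def f_def powr_mult powr_powr)
        moreover have "l powr th * l powr (- scale_exp * p) = l powr \<sigma> * l powr (- scale_exp)"
          by (simp add: th_def algebra_simps flip: powr_add)
        moreover have "(l * x) powr \<sigma> = l powr \<sigma> * x powr \<sigma>" using l0 x by (simp add: powr_mult)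
        ultimately show ?thesis by (simp add: mult_ac)
      qed
      have "w * (source (F A2) (l * x) * l) = x ^ (N - 1) * ((w * l * l ^ (N - 1)) * ((real N * be - al) * f + (l * x) powr \<sigma> * f powr p))"
        by (simp add: source_def f_def power_mult_distrib mult_ac)
      then show ?thesis unfolding 1 2 by (simp add: rescaled_def f_def distrib_left mult_ac)
    qed
    ultimately show ?thesis by simp
  qed
  have th1: "l powr th \<ge> 1" using l th_pos by (simp add: ge_one_powr_ge_zero)
  have M0: "d x1 \<ge> 0" using d0 x1 by auto
  have Yle: "Y x \<le> C * d x1 * x ^ N" if x: "x \<in> {0<..x0}" for x
  proof -
    have "Y x - C * d x1 * x ^ N \<le> Y 0 - C * d x1 * 0 ^ N"
    proof (rule DERIV_nonpos_imp_decreasing_open[of 0 x "\<lambda>x. Y x - C * d x1 * x ^ N"])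
      fix y assume y: "0 < y" "y < x"
      then have y1: "y \<in> {0..1}" and yx: "y \<in> {0..x0}" using x x0 by auto
      let ?D = "source (F A1) y - y ^ (N - 1) *
     ((real N * be - al) * rescaled A2 l y + l powr th * (y powr \<sigma> * rescaled A2 l y powr p)) - C * d x1 * (real N * y ^ (N - 1))"
      have "((\<lambda>x. Y x - C * d x1 * x ^ N) has_real_derivative ?D) (at y)"
        by (rule derivative_eq_intros Yd y refl | simp)+
      moreover have "?D \<le> 0"
      proof -
        have "(real N * be - al) * (F A1 y - rescaled A2 l y) \<le> \<bar>real N * be - al\<bar> * (F A1 y - rescaled A2 l y)"
          using le[of y] y by (intro mult_right_mono) auto
        also have "\<dots> \<le> \<bar>real N * be - al\<bar> * (k1 * d y)" using L1[OF y1] by (intro mult_left_mono) auto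
        finally have i1: "(real N * be - al) * (F A1 y - rescaled A2 l y) \<le> \<bar>real N * be - al\<bar> * k1 * d y" by (simp add: mult.assoc)
        have ys: "y powr \<sigma> \<le> 1" "0 \<le> y powr \<sigma>" using y1 y sig by (auto intro: powr_le1)
        have "F A1 y powr p - l powr th * rescaled A2 l y powr p \<le> F A1 y powr p - 1 * rescaled A2 l y powr p"
          using th1 by (intro diff_left_mono mult_right_mono) auto
        also have "\<dots> \<le> k2 * d y" using L2[OF y1] by simp
        finally have "y powr \<sigma> * (F A1 y powr p - l powr th * rescaled A2 l y powr p) \<le> y powr \<sigma> * (k2 * d y)"
          using ys by (intro mult_left_mono) auto
        also have "\<dots> \<le> 1 * (k2 * d y)" using ys d0[of y] k2 y by (intro mult_right_mono) auto
        finally have i2: "y powr \<sigma> * (F A1 y powr p - l powr th * rescaled A2 l y powr p) \<le> k2 * d y" by simp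
        have "(real N * be - al) * (F A1 y - rescaled A2 l y) + y powr \<sigma> * (F A1 y powr p - l powr th * rescaled A2 l y powr p) \<le> C * d y"
          using i1 i2 by (simp add: C_def distrib_right)
        also have "\<dots> \<le> C * d x1" using x1(2)[OF yx] C by simp
        also have "\<dots> \<le> C * d x1 * real N" using N1 C M0 mult_left_mono[of 1 "real N" "C * d x1"] by simp
        finally have "y ^ (N - 1) * ((real N * be - al) * (F A1 y - rescaled A2 l y) + y powr \<sigma> * (F A1 y powr p - l powr th * rescaled A2 l y powr p))
          \<le> y ^ (N - 1) * (C * d x1 * real N)" using y by (intro mult_left_mono) auto
        then show ?thesis by (simp add: source_def algebra_simps)
      qed
      ultimately show "\<exists>z. DERIV (\<lambda>x. Y x - C * d x1 * x ^ N) y :> z \<and> z \<le> 0" by blast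
    next
      have s1: "continuous_on {0..x} (srcint (F A1))"
        unfolding srcint_def using F_sol[OF g1[of x]] x
        by (intro indefinite_integral_continuous_1 source_integrable[of x]) (auto simp: sol_def)
      have s2: "continuous_on {0..l * x} (srcint (F A2))"
        unfolding srcint_def using F_sol[OF g2[of "l * x"]] x l0
        by (intro indefinite_integral_continuous_1 source_integrable[of "l * x"]) (auto simp: sol_def)
      show "continuous_on {0..x} (\<lambda>x. Y x - C * d x1 * x ^ N)"
        unfolding Y_def[abs_def] using l0
        by (intro continuous_intros s1 continuous_on_compose2[OF s2]) auto
    qed (use x in auto)
    moreover have "Y 0 = 0" by (simp add: Y_def srcint_def)
    moreover have "(0::real) ^ N = 0" using N1 by simp
    ultimately show ?thesis by simp
  qed
  have "d x0 \<le> 0"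
  proof -
    have "d x1 - C * d x1 * x0 * x1 \<le> d 0 - C * d x1 * x0 * 0"
    proof (cases "x1 = 0")
      case False
      show ?thesis
      proof (rule DERIV_nonpos_imp_decreasing_open[of 0 x1 "\<lambda>x. d x - C * d x1 * x0 * x"])
        fix y assume y: "0 < y" "y < x1"
        have "((\<lambda>x. d x - C * d x1 * x0 * x) has_real_derivative FG A1 y - rescaled_flux A2 l y - C * d x1 * x0) (at y)"
          unfolding d_def[of "_::real"]
          by (rule derivative_eq_intros Fm_deriv[OF g1] rescaled_m_deriv[OF g2 l0] y refl | simp)+
        moreover have "FG A1 y - rescaled_flux A2 l y \<le> C * d x1 * x0"
        proof -
          have "FG A1 y - rescaled_flux A2 l y = Y y / y ^ (N - 1) - be * y * (F A1 y - rescaled A2 l y)"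
            unfolding rescaled_srcint[OF y(1) l0] by (simp add: FG_def flux_def Y_def w_def diff_divide_distrib algebra_simps)
          also have "\<dots> \<le> Y y / y ^ (N - 1)" using be_pos y le[of y] by simp
          also have "\<dots> \<le> C * d x1 * y ^ N / y ^ (N - 1)" using Yle[of y] y x1 by (intro divide_right_mono) auto
          also have "\<dots> = C * d x1 * y" using y pow_N[of y] by (simp add: field_simps)
          also have "\<dots> \<le> C * d x1 * x0" using y x1 C M0 by (intro mult_left_mono) auto
          finally show ?thesis .
        qed
        ultimately show "\<exists>z. DERIV (\<lambda>x. d x - C * d x1 * x0 * x) y :> z \<and> z \<le> 0" by force
      next
        show "continuous_on {0..x1} (\<lambda>x. d x - C * d x1 * x0 * x)"
          using x1 by (intro continuous_intros continuous_on_subset[OF cd]) auto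
      qed (use x1 False in auto)
    qed simp
    moreover have "d 0 = 0" using eq by (simp add: d_def)
    moreover have "C * d x1 * x0 * x1 \<le> d x1 / 2"
    proof -
      have "C * x0 * x1 \<le> 1 / 2 * 1" using x0 x1 C by (intro mult_mono) auto
      then have "d x1 * (C * x0 * x1) \<le> d x1 * (1 / 2)" using M0 by (intro mult_left_mono) auto
      then show ?thesis by (simp add: mult_ac)
    qed
    ultimately have "d x1 \<le> 0" by simp
    then show ?thesis using x1(2)[of x0] x0 by simp
  qed
  then have "F A1 x0 powr m = rescaled A2 l x0 powr m" using d0[of x0] x0 by (simp add: d_def)
  then have "F A1 x0 = rescaled A2 l x0" using powr_m_inj[OF Fp[of x0] scp[of x0]] x0 by simp
  then show ?thesis using x0 by (intro exI[of _ x0]) simp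
qed

lemma F_cont_global:
  assumes g: "\<And>R. R > 0 \<Longrightarrow> solvable A R" shows "continuous_on {0..} (F A)"
proof -
  have "continuous (at x within {0..}) (F A)" if x: "x \<in> {0..}" for x
  proof -
    have "continuous_on {0..x+1} (F A)" using F_cont[OF g[of "x + 1"]] x by simp
    then have "continuous (at x within {0..x+1}) (F A)" using x by (simp add: continuous_on_eq_continuous_within)
    moreover have "at x within {0..x+1} = at x within {0..}"
      by (rule at_within_nhd[of x "{..<x+1}"]) auto
    ultimately show ?thesis by simp
  qed
  then show ?thesis by (simp add: continuous_on_eq_continuous_within)
qed

text \<open>The least \<open>l\<close> for which the rescaled larger solution lies below
  \<open>F A1\<close> exceeds \<open>1\<close>, since at \<open>l = 1\<close> the values at the
  origin are in the wrong order. Without contact at this \<open>l\<close> a smaller one would do: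
  near the origin by compactness, far out because the ratio tends to \<open>1\<close>, and
  monotonicity makes that tail estimate uniform in \<open>l\<close>.\<close>

lemma sliding:
  assumes g1: "\<And>R. R > 0 \<Longrightarrow> solvable A1 R" and g2: "\<And>R. R > 0 \<Longrightarrow> solvable A2 R" and A: "A1 < A2"
    and mono: "\<And>x y. 0 \<le> x \<Longrightarrow> x \<le> y \<Longrightarrow> F A2 y \<le> F A2 x"
    and lim: "((\<lambda>x. F A2 x / F A1 x) \<longlongrightarrow> 1) at_top"
  shows False
proof -
  have F1: "F A1 y > 0" if "y \<ge> 0" for y using F_pos[OF g1[of "y + 1"], of y] that by simp
  have F2: "F A2 y > 0" if "y \<ge> 0" for y using F_pos[OF g2[of "y + 1"], of y] that by simp
  have tail: "\<exists>X0>0. \<forall>x\<ge>X0. F A2 x \<le> c * F A1 x" if c: "c > 1" for c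
  proof -
    have "\<forall>\<^sub>F x in at_top. F A2 x / F A1 x < c" using order_tendstoD(2)[OF lim c] .
    then obtain X0 where X0: "\<And>x. x \<ge> X0 \<Longrightarrow> F A2 x / F A1 x < c" unfolding eventually_at_top_linorder by blast
    have "F A2 x \<le> c * F A1 x" if "x \<ge> max 1 X0" for x
      using X0[of x] F1[of x] that by (simp add: divide_less_eq)
    then show ?thesis by (intro exI[of _ "max 1 X0"]) auto
  qed
  have scmono: "rescaled A2 l' x \<le> rescaled A2 l x" if "0 < l" "l \<le> l'" "0 \<le> x" for l l' x
    unfolding rescaled_def using that kk_pos F2[of "l' * x"]
    by (intro mult_mono mono powr_mono2' mult_right_mono) auto
  note F_cont' = F_cont_global[OF g2]
  define S where "S = {1..} \<inter> (\<Inter>x\<in>{0..}. {l\<in>{1..}. rescaled A2 l x \<le> F A1 x})"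
  have S_iff: "l \<in> S \<longleftrightarrow> l \<ge> 1 \<and> (\<forall>x\<ge>0. rescaled A2 l x \<le> F A1 x)" for l by (auto simp: S_def)
  have "closed S" unfolding S_def
  proof (intro closed_Int closed_INT ballI)
    fix x :: real assume x: "x \<in> {0..}"
    have "continuous_on {1..} (\<lambda>l. rescaled A2 l x)"
      unfolding rescaled_def using x by (intro continuous_intros continuous_on_compose2[OF F_cont']) auto
    then show "closed {l \<in> {1..}. rescaled A2 l x \<le> F A1 x}"
      by (intro continuous_on_closed_Collect_le) auto
  qed auto
  moreover have "S \<noteq> {}"
  proof -
    obtain X0 where X0: "X0 > 0" "\<And>x. x \<ge> X0 \<Longrightarrow> F A2 x \<le> 2 * F A1 x" using tail[of 2] by auto
    have "continuous_on {0..X0} (\<lambda>x. F A2 x / F A1 x)"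
      using F_cont[OF g1[OF X0(1)]] F_cont[OF g2[OF X0(1)]] F1 by (intro continuous_intros) (metis atLeastAtMost_iff order_less_irrefl | auto)+
    then have "bounded ((\<lambda>x. F A2 x / F A1 x) ` {0..X0})"
      by (intro compact_imp_bounded compact_continuous_image) auto
    then obtain M0 where M0: "\<And>y. y \<in> (\<lambda>x. F A2 x / F A1 x) ` {0..X0} \<Longrightarrow> norm y \<le> M0"
      unfolding bounded_iff by blast
    have M0: "F A2 x / F A1 x \<le> M0" if "x \<in> {0..X0}" for x
      using M0[OF imageI[OF that]] unfolding real_norm_def by (rule abs_le_D1)
    define M where "M = max 2 M0"
    have M: "F A2 x \<le> M * F A1 x" if "x \<ge> 0" for x
    proof (cases "x \<le> X0")
      case True
      then have "F A2 x / F A1 x \<le> M" using M0[of x] that by (auto simp: M_def)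
      then show ?thesis using F1[OF that] by (simp add: divide_le_eq)
    next
      case False
      then have "F A2 x \<le> 2 * F A1 x" using X0 by simp
      also have "\<dots> \<le> M * F A1 x" using F1[OF that] by (intro mult_right_mono) (auto simp: M_def)
      finally show ?thesis .
    qed
    \<comment> \<open>Chosen so that \<open>l powr (- scale_exp) = 1 / M\<close>, which cancels the
      bound \<open>M\<close> of the ratio; \<open>F A2 (l * x) \<le> F A2 x\<close> by
      monotonicity.\<close>
    define l where "l = M powr (1 / scale_exp)"
    have l1: "l \<ge> 1" unfolding l_def M_def using kk_pos by (intro ge_one_powr_ge_zero) auto
    have "rescaled A2 l x \<le> F A1 x" if x: "x \<ge> 0" for x
    proof -
      have "rescaled A2 l x \<le> l powr (- scale_exp) * F A2 x"
        unfolding rescaled_def using x l1 mult_right_mono[OF l1 x] by (intro mult_left_mono mono) auto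
      also have "\<dots> \<le> l powr (- scale_exp) * (M * F A1 x)" using M[OF x] by (intro mult_left_mono) auto
      also have "l powr (- scale_exp) = 1 / M" using kk_pos by (simp add: l_def powr_powr powr_minus_divide M_def)
      also have "1 / M * (M * F A1 x) = F A1 x" by (simp add: M_def)
      finally show ?thesis .
    qed
    then show ?thesis using l1 S_iff by blast
  qed
  moreover have bb: "bdd_below S" by (rule bdd_belowI[of _ 1]) (simp add: S_def)
  ultimately have inS: "Inf S \<in> S" by (rule closed_contains_Inf[rotated 2])
  define l0 where "l0 = Inf S"
  have l0S: "l0 \<ge> 1" "\<And>x. x \<ge> 0 \<Longrightarrow> rescaled A2 l0 x \<le> F A1 x" using inS S_iff by (auto simp: l0_def)
  have "l0 \<noteq> 1" using l0S(2)[of 0] A by (auto simp: rescaled_def)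
  then have l0: "l0 > 1" using l0S by simp
  have "\<exists>x\<ge>0. rescaled A2 l0 x = F A1 x"
  proof (rule ccontr)
    assume "\<not> ?thesis"
    then have strict: "rescaled A2 l0 x < F A1 x" if "x \<ge> 0" for x using l0S(2)[OF that] that by force
    \<comment> \<open>Any number strictly between \<open>1\<close> and \<open>l0\<close> serves:
      \<open>\<mu> powr scale_exp > 1\<close> is the slack that settles the tail for all
      \<open>l \<ge> \<mu>\<close>.\<close>
    define \<mu> where "\<mu> = (1 + l0) / 2"
    have mu: "1 < \<mu>" "\<mu> < l0" using l0 by (auto simp: \<mu>_def)
    have "\<mu> powr scale_exp > 1" using mu kk_pos by (simp add: gr_one_powr)
    then obtain X0 where X0: "X0 > 0" "\<And>x. x \<ge> X0 \<Longrightarrow> F A2 x \<le> \<mu> powr scale_exp * F A1 x" using tail by blast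
    have cs: "continuous_on {0..X0} (\<lambda>x. F A1 x - rescaled A2 l0 x)"
      unfolding rescaled_def using F_cont[OF g1[OF X0(1)]] l0
      by (intro continuous_intros continuous_on_compose2[OF F_cont']) auto
    obtain x1 where x1: "x1 \<in> {0..X0}" "\<And>x. x \<in> {0..X0} \<Longrightarrow> F A1 x1 - rescaled A2 l0 x1 \<le> F A1 x - rescaled A2 l0 x"
      using continuous_attains_inf[OF _ _ cs] X0 by auto
    define \<eta> where "\<eta> = F A1 x1 - rescaled A2 l0 x1"
    have eta: "\<eta> > 0" using strict x1 by (auto simp: \<eta>_def)
    have "continuous_on ({\<mu>..l0} \<times> {0..X0}) (\<lambda>z. rescaled A2 (fst z) (snd z))"
      unfolding rescaled_def using mu by (intro continuous_intros continuous_on_compose2[OF F_cont']) auto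
    then have "uniformly_continuous_on ({\<mu>..l0} \<times> {0..X0}) (\<lambda>z. rescaled A2 (fst z) (snd z))"
      by (intro compact_uniformly_continuous compact_Times) auto
    then obtain e where e: "e > 0" "\<And>z z'. z \<in> {\<mu>..l0} \<times> {0..X0} \<Longrightarrow> z' \<in> {\<mu>..l0} \<times> {0..X0} \<Longrightarrow> dist z' z < e \<Longrightarrow>
       dist (rescaled A2 (fst z') (snd z')) (rescaled A2 (fst z) (snd z)) < \<eta>"
      using eta unfolding uniformly_continuous_on_def by meson
    define l where "l = max \<mu> (l0 - e / 2)"
    have l: "\<mu> \<le> l" "l < l0" "l0 - l < e" using mu e by (auto simp: l_def)
    have "rescaled A2 l x \<le> F A1 x" if x: "x \<ge> 0" for x
    proof (cases "x \<le> X0")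
      case True
      have "dist (rescaled A2 l x) (rescaled A2 l0 x) < \<eta>"
        using e(2)[of "(l0, x)" "(l, x)"] l mu True x by (simp add: dist_Pair_Pair dist_real_def)
      then have "rescaled A2 l x < rescaled A2 l0 x + \<eta>" unfolding dist_real_def by linarith
      then show ?thesis using x1(2)[of x] x True unfolding \<eta>_def by auto
    next
      case False
      have "rescaled A2 l x \<le> rescaled A2 \<mu> x" using scmono l mu x by auto
      also have "\<dots> \<le> \<mu> powr (- scale_exp) * F A2 x"
        unfolding rescaled_def using x mu mult_right_mono[of 1 \<mu> x] by (intro mult_left_mono mono) auto
      also have "\<dots> \<le> \<mu> powr (- scale_exp) * (\<mu> powr scale_exp * F A1 x)" using X0(2)[of x] False by (intro mult_left_mono) auto
      also have "\<dots> = F A1 x" using mu by (simp add: powr_minus)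
      finally show ?thesis .
    qed
    then have "l \<in> S" using S_iff l mu by auto
    then have "l0 \<le> l" unfolding l0_def using bb by (rule cInf_lower)
    then show False using l by simp
  qed
  then obtain x where x: "x \<ge> 0" "rescaled A2 l0 x = F A1 x" by blast
  then have "\<exists>x>0. rescaled A2 l0 x = F A1 x"
    using touch_at_0[OF g1 g2 l0 l0S(2)] by (metis less_eq_real_def)
  then show False using interior_touch[OF g1 g2 l0] l0S(2) by (meson less_imp_le)
qed

subsection \<open>Tails of order \<open>\<xi>\<^sup>-\<^sup>\<gamma>\<close>\<close>

text \<open>Barriers around the level \<open>K\<close>: in \<open>below\<close> the product of \<open>H\<close> and the exponential factor decreases
  along the flow, in \<open>above\<close> it increases. The width \<open>B exp (- de t)\<close> matches the size of
  \<open>ga - rho\<close> on the slow manifold.\<close>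

definition below :: "real \<Rightarrow> real \<Rightarrow> real \<Rightarrow> real \<Rightarrow> bool" where
  "below B K A t \<longleftrightarrow> D A t \<and> H A t * exp (B * exp (- de * t)) < K \<and> ga - rho A t < B * de * exp (- de * t)"

definition above :: "real \<Rightarrow> real \<Rightarrow> real \<Rightarrow> real \<Rightarrow> real \<Rightarrow> bool" where
  "above B T K A t \<longleftrightarrow> D A t \<and> t > T \<and> H A t * exp (- B * exp (- de * t)) > K \<and> ga - rho A t > - (B * de * exp (- de * t))"

text \<open>An upper bound for \<open>m * rho\<^sup>2 - (N - 2) * rho\<close> on
  \<open>0 \<le> rho \<le> ga + 1\<close>.\<close>

definition quad_sup :: real where "quad_sup = m * (ga + 1)^2 + 2 * (ga + 1)"

text \<open>The first two bounds on \<open>B / m * K powr (1 - m)\<close> close the lateral side of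
  \<open>below\<close>. The condition for all \<open>h > 0\<close> closes that of
  \<open>above\<close>, where \<open>H\<close> has no upper bound. \<open>B * de > ga\<close> lets
  small data enter \<open>below\<close> at time \<open>0\<close>, and the last inequality forces
  \<open>X < al\<close> inside \<open>below\<close> at zeros of \<open>rho\<close>, so that nothing
  turns up there.\<close>

definition barrier_width :: "real \<Rightarrow> real \<Rightarrow> bool" where
  "barrier_width K B \<longleftrightarrow> B > 0 \<and> B / m * K powr (1 - m) \<ge> (real N)^2 + K powr (p - m) + 1
    \<and> B / m * K powr (1 - m) * (m - 1) \<ge> de^2
    \<and> (\<forall>h>0. h powr (p - m) / m + B / m * h powr (1 - m) \<ge> quad_sup + 2)
    \<and> B * de > ga \<and> K powr (p - 1) < al * (p - 1) * B"

text \<open>Every condition holds for large \<open>B\<close>; only the one for all \<open>h\<close>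
  needs a split. Beyond \<open>h0\<close> the first power suffices by itself, below
  \<open>h0\<close> the negative power is bounded away from \<open>0\<close> and \<open>B\<close>
  does the work.\<close>

lemma barrier_width_exists: assumes K: "K > 0" obtains B where "barrier_width K B"
proof -
  have quad_sup: "quad_sup > 0" unfolding quad_sup_def using ga_pos m1 by (intro add_nonneg_pos) auto
  define h0 where "h0 = (m * (quad_sup + 2)) powr (1 / (p - m))"
  have h0: "h0 > 0" "h0 powr (p - m) = m * (quad_sup + 2)" using m1 mp quad_sup by (auto simp: h0_def powr_powr)
  define k where "k = K powr (1 - m) / m"
  have k: "k > 0" using K m1 by (simp add: k_def)
  define k' where "k' = h0 powr (1 - m) / m"
  have k': "k' > 0" using h0 m1 by (simp add: k'_def)
  define B1 B2 B3 B4 B5 where "B1 = ((real N)^2 + K powr (p - m) + 1) / k" and "B2 = de^2 / (k * (m - 1))"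
    and "B3 = (quad_sup + 2) / k'" and "B4 = ga / de + 1" and "B5 = K powr (p - 1) / (al * (p - 1)) + 1"
  define B where "B = \<bar>B1\<bar> + \<bar>B2\<bar> + \<bar>B3\<bar> + \<bar>B4\<bar> + \<bar>B5\<bar> + 1"
  have B: "B > 0" "B \<ge> B1" "B \<ge> B2" "B \<ge> B3" "B \<ge> B4" "B \<ge> B5" by (auto simp: B_def)
  have "barrier_width K B" unfolding barrier_width_def
  proof (intro conjI allI impI)
    show "B > 0" using B by simp
    have "B1 * k \<le> B * k" using B k by (intro mult_right_mono) auto
    moreover have "B1 * k = (real N)^2 + K powr (p - m) + 1" using k by (simp add: B1_def)
    moreover have "B * k = B / m * K powr (1 - m)" by (simp add: k_def)
    ultimately show "B / m * K powr (1 - m) \<ge> (real N)^2 + K powr (p - m) + 1" by simp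
    have "B2 * (k * (m - 1)) \<le> B * (k * (m - 1))" using B k m1 by (intro mult_right_mono) auto
    moreover have "B2 * (k * (m - 1)) = de^2" using k m1 by (simp add: B2_def)
    moreover have "B * (k * (m - 1)) = B / m * K powr (1 - m) * (m - 1)" by (simp add: k_def)
    ultimately show "B / m * K powr (1 - m) * (m - 1) \<ge> de^2" by simp
    show "B * de > ga" using B(5) de_pos mult_right_mono[OF B(5), of de] by (simp add: B4_def distrib_right)
    have a: "al * (p - 1) > 0" using al_pos m1 mp by simp
    have "B5 * (al * (p - 1)) \<le> B * (al * (p - 1))" using B a by (intro mult_right_mono) auto
    moreover have "B5 * (al * (p - 1)) = K powr (p - 1) + al * (p - 1)" using al_pos m1 mp by (simp add: B5_def distrib_right)
    moreover have "B * (al * (p - 1)) = al * (p - 1) * B" by simp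
    ultimately show "K powr (p - 1) < al * (p - 1) * B" using a by linarith
    fix h :: real assume h: "h > 0"
    show "h powr (p - m) / m + B / m * h powr (1 - m) \<ge> quad_sup + 2"
    proof (cases "h \<ge> h0")
      case True
      then have "h0 powr (p - m) \<le> h powr (p - m)" using h0 mp by (intro powr_mono2) auto
      then have "quad_sup + 2 \<le> h powr (p - m) / m" using h0 m1 by (simp add: le_divide_eq mult.commute)
      moreover have "B / m * h powr (1 - m) \<ge> 0" using B m1 by simp
      ultimately show ?thesis by simp
    next
      case False
      then have "h0 powr (1 - m) \<le> h powr (1 - m)" using h m1 by (intro powr_mono2') auto
      then have "k' \<le> h powr (1 - m) / m" using m1 by (simp add: k'_def divide_right_mono)
      moreover have "B3 * k' = quad_sup + 2" using k' by (simp add: B3_def)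
      moreover have "B3 * k' \<le> B * (h powr (1 - m) / m)"
        using B calculation k' by (intro mult_mono) auto
      moreover have "h powr (p - m) / m \<ge> 0" using m1 by simp
      ultimately show ?thesis by simp
    qed
  qed
  then show thesis by (rule that)
qed

text \<open>Completing the square makes this bound valid for every value of \<open>rho\<close>, in
  contrast to the upper bound below it.\<close>

lemma rhod_lower: assumes d: "D A t"
  shows "rhod A t \<ge> - ((real N)^2) - H A t powr (p - m) + be * Lam A t / m * (ga - rho A t)"
proof -
  define r where "r = rho A t"
  have "(r - (real N - 2) / 2)^2 \<ge> 0" by simp
  then have "r^2 - (real N - 2) * r \<ge> - ((real N - 2)^2 / 4)" by (simp add: power2_eq_square algebra_simps)
  moreover have "(real N - 2)^2 \<le> (2 * real N)^2" using N1 by (intro abs_le_square_iff[THEN iffD1]) auto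
  then have "(real N - 2)^2 / 4 \<le> (real N)^2" by (simp add: power_mult_distrib)
  moreover have "m * r^2 \<ge> 1 * r^2" using m1 by (intro mult_right_mono) auto
  moreover have "H A t powr (p - m) / m \<le> H A t powr (p - m)" using m1 by (simp add: divide_le_eq mult_le_cancel_left1)
  ultimately show ?thesis unfolding rhod_ga[OF d] r_def by linarith
qed

lemma rhod_upper: assumes d: "D A t" and r: "0 \<le> rho A t" "rho A t \<le> ga + 1"
  shows "rhod A t \<le> quad_sup - H A t powr (p - m) / m + be * Lam A t / m * (ga - rho A t)"
proof -
  have "m * (rho A t)^2 \<le> m * (ga + 1)^2" using r m1 by (intro mult_left_mono power_mono) auto
  moreover have "(real N - 2) * rho A t = real N * rho A t - 2 * rho A t" by (simp add: algebra_simps)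
  moreover have "real N * rho A t \<ge> 0" using r by simp
  moreover have "2 * rho A t \<le> 2 * (ga + 1)" using r by simp
  moreover have "a1 - b1 - h + z \<le> a2 + b2 - h + z" if "a1 \<le> a2" "b1 = n - b" "n \<ge> 0" "b \<le> b2" for a1 b1 a2 b2 h z n b :: real
    using that by linarith
  ultimately show ?thesis unfolding rhod_ga[OF d] quad_sup_def by metis
qed

text \<open>The reason for the decay rate of the barrier: \<open>Lam\<close> grows exactly as fast
  as the width shrinks, so on the lateral side the relaxation term is a function of \<open>H\<close>
  alone, of adjustable size \<open>B\<close>.\<close>

lemma be_Lam: assumes "D A t"
  shows "be * Lam A t / m * (B * de * exp (- de * t)) = B / m * H A t powr (1 - m)"
proof -
  have "be * Lam A t / m * (B * de * exp (- de * t)) = (be * de) * (B / m) * (exp (de * t) * exp (- de * t)) * H A t powr (1 - m)"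
    unfolding Lam_H[OF assms] by simp
  then show ?thesis unfolding be_de by (simp flip: exp_add)
qed

lemma xd: "((\<lambda>t. exp (- de * t)) has_real_derivative - de * exp (- de * t)) (at t)"
  by (auto intro!: derivative_eq_intros)

text \<open>While \<open>u \<ge> 0\<close>, the product of \<open>H\<close> and the exponential does
  not increase. On the side \<open>u = 0\<close> the inequality
  \<open>h \<le> K * exp (- (B * x))\<close> gives \<open>h powr (1 - m)\<close> a surplus
  proportional to \<open>B * x\<close>, which pays for the shrinking of the width. Hence the region
  is invariant from any time on, including the early times at which small data enter it.\<close>

lemma below_forward:
  assumes g: "barrier_width K B" and K: "K > 0" and r: "below B K A t0" and d: "D A t1" and le: "t0 \<le> t1"
  shows "below B K A t1"
proof -
  have B: "B > 0" using g by (simp add: barrier_width_def)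
  have dd: "D A t" if "t \<le> t1" for t using D_mono[OF d that] .
  define u where "u t = B * de * exp (- de * t) - (ga - rho A t)" for t
  have ud: "(u has_real_derivative rhod A t - B * de^2 * exp (- de * t)) (at t)" if "t \<le> t1" for t
    unfolding u_def[abs_def]
    by (rule derivative_eq_intros rho_deriv'[OF dd[OF that]] xd refl | simp add: power2_eq_square)+
  have hm: "H A t * exp (B * exp (- de * t)) < K" if t: "t \<in> {t0..t1}" and un: "\<And>s. s \<in> {t0..t} \<Longrightarrow> u s \<ge> 0" for t
  proof -
    have t0t: "t0 \<le> t" using t by simp
    have "H A t * exp (B * exp (- de * t)) \<le> H A t0 * exp (B * exp (- de * t0))"
    proof (rule DERIV_nonpos_imp_nonincreasing[OF t0t])
      fix s assume s: "t0 \<le> s" "s \<le> t"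
      have ds: "D A s" using dd s t by auto
      have "((\<lambda>t. H A t * exp (B * exp (- de * t))) has_real_derivative
         H A s * exp (B * exp (- de * s)) * (- u s)) (at s)"
        unfolding u_def
        by (rule derivative_eq_intros H_deriv[OF ds] xd refl | simp add: algebra_simps)+
      moreover have "H A s * exp (B * exp (- de * s)) * (- u s) \<le> 0"
        using H_pos[OF ds] un[of s] s by (intro mult_nonneg_nonpos) auto
      ultimately show "\<exists>y. DERIV (\<lambda>t. H A t * exp (B * exp (- de * t))) s :> y \<and> y \<le> 0" by blast
    qed
    then show ?thesis using r by (simp add: below_def)
  qed
  have upos: "u t > 0" if t: "t \<in> {t0..t1}" for t
  proof (rule barrier[of t0 t u])
    show "u t0 > 0" using r by (simp add: below_def u_def)
    fix s assume s: "s \<in> {t0..t}" "u s = 0" and un: "\<And>y. y \<in> {t0..s} \<Longrightarrow> u y \<ge> 0"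
    have ds: "D A s" using dd s t by auto
    define x h where "x = exp (- de * s)" and "h = H A s"
    have x: "x > 0" by (simp add: x_def)
    have h: "h > 0" using H_pos[OF ds] by (simp add: h_def)
    have hK: "h * exp (B * x) < K" using hm[of s] un s t by (auto simp: h_def x_def)
    have "h \<le> K * exp (- (B * x))" using hK by (simp add: exp_minus field_simps)
    then have "(K * exp (- (B * x))) powr (1 - m) \<le> h powr (1 - m)" using h m1 by (intro powr_mono2') auto
    also have "(K * exp (- (B * x))) powr (1 - m) = K powr (1 - m) * exp ((m - 1) * (B * x))"
      using K mult_exp_powr[of K "- (B * x)" "1 - m"] by (simp add: algebra_simps)
    finally have h1: "K powr (1 - m) * exp ((m - 1) * (B * x)) \<le> h powr (1 - m)" .
    have "K powr (1 - m) * (1 + (m - 1) * (B * x)) \<le> h powr (1 - m)"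
      by (rule order_trans[OF mult_left_mono[OF exp_ge_add_one_self] h1]) auto
    then have "B / m * (K powr (1 - m) * (1 + (m - 1) * (B * x))) \<le> B / m * h powr (1 - m)"
      using B m1 by (intro mult_left_mono) auto
    moreover have "c * (k * (1 + q * z)) = c * k + (c * k * q) * z" for c k q z :: real by (simp add: algebra_simps)
    ultimately have i1: "B / m * K powr (1 - m) + (B / m * K powr (1 - m) * (m - 1)) * (B * x) \<le> B / m * h powr (1 - m)"
      by metis
    have i2: "de^2 * (B * x) \<le> (B / m * K powr (1 - m) * (m - 1)) * (B * x)"
      using g B x by (intro mult_right_mono) (auto simp: barrier_width_def)
    have "h \<le> K" using hK h B x by (smt (verit) mult_left_mono mult_pos_pos one_le_exp_iff mult_cancel_left2)
    then have i3: "h powr (p - m) \<le> K powr (p - m)" using h mp by (intro powr_mono2) auto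
    have "ga - rho A s = B * de * x" using s(2) by (simp add: u_def x_def)
    then have "rhod A s \<ge> - ((real N)^2) - h powr (p - m) + B / m * h powr (1 - m)"
      using rhod_lower[OF ds] be_Lam[OF ds, of B] unfolding h_def x_def by metis
    moreover have "B / m * K powr (1 - m) \<ge> (real N)^2 + K powr (p - m) + 1" using g by (simp add: barrier_width_def)
    ultimately have "rhod A s \<ge> 1 + de^2 * (B * x)" using i1 i2 i3 by linarith
    then show "rhod A s - B * de^2 * exp (- de * s) > 0" by (simp add: x_def mult_ac)
  qed (use t ud in auto)
  then show ?thesis using hm[of t1] upos[of t1] le d unfolding below_def by (force simp: u_def less_imp_le)
qed

text \<open>From \<open>T\<close> on the side of \<open>above\<close> lies in
  \<open>rho \<le> ga + 1\<close>, the range of \<open>quad_sup\<close>, and the width shrinks at a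
  speed less than \<open>1\<close>, against the speed \<open>2\<close> given by
  \<open>rhod_neg\<close>.\<close>

definition barrier_start :: "real \<Rightarrow> real \<Rightarrow> bool" where
  "barrier_start B T \<longleftrightarrow> (\<forall>t\<ge>T. B * de * exp (- de * t) \<le> 1 \<and> B * de^2 * exp (- de * t) < 1)"

lemma barrier_start_exists: assumes "B > 0" obtains T where "barrier_start B T"
proof -
  define k where "k = B * de + B * de^2 + 1"
  have k: "k > 0" using assms de_pos by (simp add: k_def add_pos_pos)
  have "barrier_start B (ln k / de)" unfolding barrier_start_def
  proof (intro allI impI)
    fix t assume "t \<ge> ln k / de"
    then have "ln k \<le> de * t" using de_pos by (simp add: divide_le_eq mult.commute)
    then have "k \<le> exp (de * t)" using k by (metis exp_le_cancel_iff exp_ln)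
    then have "k * exp (- de * t) \<le> 1" by (simp add: exp_minus divide_le_eq flip: divide_inverse)
    then have s: "B * de * exp (- de * t) + B * de^2 * exp (- de * t) + exp (- de * t) \<le> 1" by (simp add: k_def distrib_right)
    have "B * de * exp (- de * t) > 0" "B * de^2 * exp (- de * t) > 0" "exp (- de * t) > 0" using assms de_pos by auto
    then show "B * de * exp (- de * t) \<le> 1 \<and> B * de^2 * exp (- de * t) < 1" using s by linarith
  qed
  then show thesis by (rule that)
qed

lemma rhod_neg:
  assumes g: "barrier_width K B" and d: "D A t" and r: "0 \<le> rho A t" "ga - rho A t \<ge> -1" "ga - rho A t \<le> - (B * de * exp (- de * t))"
  shows "rhod A t \<le> -2"
proof -
  have "be * Lam A t / m * (ga - rho A t) \<le> be * Lam A t / m * (- (B * de * exp (- de * t)))"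
    using r be_pos Lam_pos[OF d] m1 by (intro mult_left_mono) auto
  also have "\<dots> = - (B / m * H A t powr (1 - m))" using be_Lam[OF d, of B] by simp
  finally have "be * Lam A t / m * (ga - rho A t) \<le> - (B / m * H A t powr (1 - m))" .
  moreover have "H A t powr (p - m) / m + B / m * H A t powr (1 - m) \<ge> quad_sup + 2"
    using g H_pos[OF d] by (simp add: barrier_width_def)
  moreover have "rhod A t \<le> quad_sup - H A t powr (p - m) / m + be * Lam A t / m * (ga - rho A t)"
    using rhod_upper[OF d] r by simp
  ultimately show ?thesis by linarith
qed

lemma above_forward:
  assumes g: "barrier_width K B" and T: "barrier_start B T" and r: "above B T K A t0" and d: "D A t1" and le: "t0 \<le> t1"
  shows "above B T K A t1"
proof -
  have B: "B > 0" using g by (simp add: barrier_width_def)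
  have dd: "D A t" if "t \<le> t1" for t using D_mono[OF d that] .
  have tT: "t0 > T" using r by (simp add: above_def)
  define u where "u t = (ga - rho A t) + B * de * exp (- de * t)" for t
  have ud: "(u has_real_derivative - rhod A t - B * de^2 * exp (- de * t)) (at t)" if "t \<le> t1" for t
    unfolding u_def[abs_def]
    by (rule derivative_eq_intros rho_deriv'[OF dd[OF that]] xd refl | simp add: power2_eq_square)+
  have upos: "u t > 0" if t: "t \<in> {t0..t1}" for t
  proof (rule barrier[of t0 t u])
    show "u t0 > 0" using r by (simp add: above_def u_def)
    fix s assume s: "s \<in> {t0..t}" "u s = 0"
    have ds: "D A s" using dd s t by auto
    have L: "B * de * exp (- de * s) \<le> 1" "B * de^2 * exp (- de * s) < 1" using T s tT by (auto simp: barrier_start_def)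
    have xp: "B * de * exp (- de * s) > 0" using B de_pos by simp
    have e: "ga - rho A s = - (B * de * exp (- de * s))" using s(2) by (simp add: u_def)
    have "rhod A s \<le> -2"
      using e L xp ga_pos by (intro rhod_neg[OF g ds]) linarith+
    then show "- rhod A s - B * de^2 * exp (- de * s) > 0" using L by linarith
  qed (use t ud in auto)
  have "H A t0 * exp (- B * exp (- de * t0)) \<le> H A t1 * exp (- B * exp (- de * t1))"
  proof (rule DERIV_nonneg_imp_nondecreasing[OF le])
    fix s assume s: "t0 \<le> s" "s \<le> t1"
    have ds: "D A s" using dd s by auto
    have "((\<lambda>t. H A t * exp (- B * exp (- de * t))) has_real_derivative
       H A s * exp (- B * exp (- de * s)) * u s) (at s)"
      unfolding u_def
      by (rule derivative_eq_intros H_deriv[OF ds] xd refl | simp add: algebra_simps)+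
    moreover have "H A s * exp (- B * exp (- de * s)) * u s \<ge> 0"
      using H_pos[OF ds] upos[of s] s by (intro mult_nonneg_nonneg) auto
    ultimately show "\<exists>y. DERIV (\<lambda>t. H A t * exp (- B * exp (- de * t))) s :> y \<and> 0 \<le> y" by blast
  qed
  then show ?thesis using r upos[of t1] le d tT unfolding above_def u_def by auto
qed

text \<open>Both regions are forward invariant, so at the later of the two times the solution lies
  in both, on opposite sides of \<open>K\<close>.\<close>

lemma below_above_disjoint:
  assumes g: "barrier_width K B" and K: "K > 0" and T: "barrier_start B T" and r: "below B K A s" "above B T K A t"
  shows False
proof -
  have B: "B > 0" using g by (simp add: barrier_width_def)
  have D: "D A s" "D A t" using r by (auto simp: below_def above_def)
  obtain u where u: "below B K A u" "above B T K A u"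
    using below_forward[OF g K r(1) D(2)] above_forward[OF g T r(2) D(1)] r by (meson linear)
  have "H A u > 0" using u H_pos by (simp add: below_def)
  then have "H A u * exp (- B * exp (- de * u)) \<le> H A u * exp (B * exp (- de * u))"
    using B by (intro mult_left_mono) (auto simp: order_trans[of _ 0])
  then show False using u by (simp add: below_def above_def)
qed

lemma below_open: assumes "below B K A t" shows "\<forall>\<^sub>F A' in nhds A. below B K A' t"
proof -
  have d: "D A t" and f: "H A t * exp (B * exp (- de * t)) < K" "ga - rho A t < B * de * exp (- de * t)"
    using assms by (auto simp: below_def)
  have "((\<lambda>A'. H A' t * exp (B * exp (- de * t))) \<longlongrightarrow> H A t * exp (B * exp (- de * t))) (nhds A)"
    using H_tendsto[OF d] by (intro tendsto_intros)
  moreover have "((\<lambda>A'. ga - rho A' t) \<longlongrightarrow> ga - rho A t) (nhds A)"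
    using rho_tendsto[OF d] by (intro tendsto_intros)
  note l = order_tendstoD(2)[OF calculation f(1)] order_tendstoD(2)[OF this f(2)]
  from l D_ev[OF d] show ?thesis by eventually_elim (simp add: below_def)
qed

lemma above_open: assumes "above B T K A t" shows "\<forall>\<^sub>F A' in nhds A. above B T K A' t"
proof -
  have d: "D A t" and f: "t > T" "H A t * exp (- B * exp (- de * t)) > K" "ga - rho A t > - (B * de * exp (- de * t))"
    using assms by (auto simp: above_def)
  have "((\<lambda>A'. H A' t * exp (- B * exp (- de * t))) \<longlongrightarrow> H A t * exp (- B * exp (- de * t))) (nhds A)"
    using H_tendsto[OF d] by (intro tendsto_intros)
  moreover have "((\<lambda>A'. ga - rho A' t) \<longlongrightarrow> ga - rho A t) (nhds A)"
    using rho_tendsto[OF d] by (intro tendsto_intros)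
  note l = order_tendstoD(1)[OF calculation f(2)] order_tendstoD(1)[OF this f(3)]
  from l D_ev[OF d] show ?thesis by eventually_elim (use f(1) in \<open>simp add: above_def\<close>)
qed

section \<open>Which solutions enter the two regions, and the limit outside them\<close>

lemma x_tendsto: "((\<lambda>t. exp (- de * t)) \<longlongrightarrow> 0) at_top"
proof -
  have "filterlim (\<lambda>t. de * t) at_top at_top"
    using de_pos filterlim_tendsto_pos_mult_at_top[OF tendsto_const de_pos filterlim_ident] by simp
  then have "filterlim (\<lambda>t. - (de * t)) at_bot at_top" by (simp add: filterlim_uminus_at_bot)
  from filterlim_compose[OF exp_at_bot this] show ?thesis by simp
qed

lemma extinction_below:
  assumes K: "K > 0" and B: "B > 0" and A: "A > 0" and nd: "\<not> D A T" and r: "\<And>t. D A t \<Longrightarrow> rho A t \<ge> 0"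
  shows "\<exists>t<T. below B K A t"
proof -
  obtain T0 where T0: "\<And>e c. e > 0 \<Longrightarrow> \<exists>s. D A s \<and> T0 \<le> s \<and> s < T \<and> E A s < e \<and> rho A s > c"
    using extinction[OF A nd r] by blast
  define q where "q = exp (ga * T) * exp (B * exp (- de * T0))"
  have q: "q > 0" by (simp add: q_def)
  obtain s where s: "D A s" "T0 \<le> s" "s < T" "E A s < K / q" "rho A s > ga"
    using T0[of "K / q" ga] K q by auto
  have "exp (- de * s) \<le> exp (- de * T0)" using s de_pos by simp
  then have "exp (B * exp (- de * s)) \<le> exp (B * exp (- de * T0))" using B by simp
  moreover have "exp (ga * s) \<le> exp (ga * T)" using s ga_pos by simp
  ultimately have "exp (ga * s) * exp (B * exp (- de * s)) \<le> q" unfolding q_def by (intro mult_mono) auto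
  then have "E A s * (exp (ga * s) * exp (B * exp (- de * s))) \<le> E A s * q"
    using E_pos[OF s(1)] by (intro mult_left_mono) auto
  also have "\<dots> < K" using s(4) q by (simp add: less_divide_eq)
  finally have "H A s * exp (B * exp (- de * s)) < K" by (simp add: H_def mult_ac)
  moreover have "B * de * exp (- de * s) > 0" using B de_pos by simp
  ultimately have "below B K A s" using s unfolding below_def by auto
  then show ?thesis using s by blast
qed

text \<open>Small data are in \<open>below\<close> at some time \<open>t \<le> 0\<close>, by
  extinction or because \<open>E \<le> A\<close> at time \<open>0\<close>. Turning up needs a zero
  of \<open>rho\<close> with \<open>X \<ge> al\<close>: before that time this is excluded by
  \<open>rho_neg_early\<close>, afterwards by the last condition of
  \<open>barrier_width\<close>.\<close>

lemma small_below:
  assumes g: "barrier_width K B" and K: "K > 0"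
  obtains \<epsilon> where "\<epsilon> > 0" "\<And>A. 0 < A \<Longrightarrow> A < \<epsilon> \<Longrightarrow> (\<exists>t. below B K A t) \<and> \<not> turns_up A"
proof -
  have B: "B > 0" using g by (simp add: barrier_width_def)
  \<comment> \<open>The first entry puts \<open>H\<close> at time \<open>0\<close>, where the
    exponential factor is \<open>exp B\<close>, below \<open>K\<close>; the second excludes negative
    \<open>rho\<close> at times \<open>t \<le> 0\<close>.\<close>
  define \<epsilon> where "\<epsilon> = min (K / exp B) (al powr (1 / (p - 1)))"
  show thesis
  proof (rule that[of \<epsilon>])
    show "\<epsilon> > 0" using K al_pos by (simp add: \<epsilon>_def)
    fix A assume A: "0 < A" "A < \<epsilon>"
    have A1: "A * exp B < K" using A by (simp add: \<epsilon>_def less_divide_eq)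
    have "A powr (p - 1) < (al powr (1 / (p - 1))) powr (p - 1)"
      using A m1 mp by (intro powr_less_mono2) (auto simp: \<epsilon>_def)
    then have A2: "A powr (p - 1) < al" using al_pos m1 mp by (simp add: powr_powr)
    have early: "rho A t \<ge> 0" if "D A t" "t \<le> 0" for t
    proof (rule ccontr)
      assume "\<not> rho A t \<ge> 0"
      then have "al \<le> exp (\<sigma> * t) * A powr (p - 1)" using rho_neg_early that by auto
      also have "\<dots> \<le> 1 * A powr (p - 1)" using that sig by (intro mult_right_mono) (auto simp: mult_le_0_iff)
      finally show False using A2 by simp
    qed
    have "\<exists>t\<le>0. below B K A t"
    proof (cases "D A 0")
      case True
      have "E A 0 \<le> A" using E_le[OF True] early D_mono[OF True] by auto
      then have "E A 0 * exp B \<le> A * exp B" by simp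
      then have "E A 0 * exp B < K" using A1 by linarith
      then have "H A 0 * exp (B * exp (- de * 0)) < K" by (simp add: H_def)
      moreover have "ga - rho A 0 < B * de * exp (- de * 0)" using early[OF True] g by (simp add: barrier_width_def)
      ultimately show ?thesis using True unfolding below_def by (intro exI[of _ 0]) auto
    next
      case False
      then have "t \<le> 0" if "D A t" for t using D_mono[OF that, of 0] by force
      then have "rho A t \<ge> 0" if "D A t" for t using early that by auto
      then show ?thesis using extinction_below[OF K B A(1) False] by (auto intro: less_imp_le)
    qed
    then obtain t where t: "t \<le> 0" "below B K A t" by blast
    have Dt: "D A t" using t by (simp add: below_def)
    have "\<not> turns_up A"
    proof
      assume "turns_up A"
      then obtain t0 where t0: "D A t0" "rho A t0 < 0" by (auto simp: turns_up_def)
      obtain s where s: "s < t0" "rho A s = 0" "al \<le> X A s" "\<forall>t\<in>{s<..t0}. rho A t < 0"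
        using rho_neg_source[OF t0] by blast
      have Ds: "D A s" using D_mono[OF t0(1)] s by simp
      show False
      proof (cases "t \<le> s")
        case True
        then have Rs: "below B K A s" using below_forward[OF g K t(2) Ds] by simp
        define x h where "x = exp (- de * s)" and "h = H A s"
        have x: "x > 0" by (simp add: x_def)
        have h: "h > 0" using H_pos[OF Ds] by (simp add: h_def)
        have hK: "h * exp (B * x) < K" using Rs by (auto simp: below_def h_def x_def)
        then have "(h * exp (B * x)) powr (p - 1) \<le> K powr (p - 1)"
          using h m1 mp by (intro powr_mono2) auto
        then have h2: "h powr (p - 1) * exp ((p - 1) * (B * x)) \<le> K powr (p - 1)"
          using h mult_exp_powr[of h "B * x" "p - 1"] by simp
        have "(p - 1) * (B * x) \<le> exp ((p - 1) * (B * x))"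
          using exp_ge_add_one_self[of "(p - 1) * (B * x)"] by linarith
        then have "h powr (p - 1) * ((p - 1) * (B * x)) \<le> K powr (p - 1)"
          using h2 mult_left_mono[of "(p - 1) * (B * x)" "exp ((p - 1) * (B * x))" "h powr (p - 1)"] by simp
        moreover have "K powr (p - 1) < al * ((p - 1) * B)" using g by (simp add: barrier_width_def mult.assoc)
        moreover have "(x * h powr (p - 1)) * ((p - 1) * B) = h powr (p - 1) * ((p - 1) * (B * x))" by (simp add: mult_ac)
        ultimately have "(x * h powr (p - 1)) * ((p - 1) * B) < al * ((p - 1) * B)" by linarith
        then have "x * h powr (p - 1) < al" using B m1 mp by (simp add: mult_less_cancel_right)
        then show False using s(3) X_H[OF Ds] by (simp add: x_def h_def)
      next
        case False
        have "rho A t < 0"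
          using s False rho_neg_forward[OF Dt _ t0(2)] by (cases "t \<le> t0") auto
        then show False using early[OF Dt] t by simp
      qed
    qed
    then show "(\<exists>t. below B K A t) \<and> \<not> turns_up A" using t by blast
  qed
qed

text \<open>As \<open>X\<close> tends to \<open>ka > 0\<close> and equals
  \<open>exp (- de * t) * H powr (p - 1)\<close>, \<open>H\<close> tends to infinity. If
  \<open>above\<close> were never entered, \<open>rho \<ge> ga\<close> would hold from some time on
  and \<open>H\<close> could not increase any more.\<close>

lemma critical_above:
  assumes g: "barrier_width K B" and K: "K > 0" and T: "barrier_start B T" and c: "critical A"
  shows "\<exists>t. above B T K A t"
proof (rule ccontr)
  assume n: "\<not> ?thesis"
  have D: "\<And>t. D A t" and X: "(X A \<longlongrightarrow> ka) at_top" using c by (auto simp: critical_def)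
  have B: "B > 0" using g by (simp add: barrier_width_def)
  have Hbig: "\<forall>\<^sub>F t in at_top. H A t > c" for c
  proof -
    define c' where "c' = \<bar>c\<bar> + 1"
    have c': "c' > 0" "c' > c" by (auto simp: c'_def)
    have "((\<lambda>t. exp (- de * t) * c' powr (p - 1)) \<longlongrightarrow> 0 * c' powr (p - 1)) at_top"
      by (intro tendsto_intros x_tendsto)
    then have "\<forall>\<^sub>F t in at_top. exp (- de * t) * c' powr (p - 1) < ka / 2"
      using ka_pos by (intro order_tendstoD) auto
    moreover have "\<forall>\<^sub>F t in at_top. X A t > ka / 2" using X ka_pos by (intro order_tendstoD) auto
    ultimately show ?thesis
    proof eventually_elim
      case (elim t)
      then have "exp (- de * t) * c' powr (p - 1) < exp (- de * t) * H A t powr (p - 1)"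
        using X_H[OF D, of t] by linarith
      then have "c' powr (p - 1) < H A t powr (p - 1)" by simp
      then have "c' < H A t"
        using powr_mono2[of "p - 1" "H A t" c'] H_pos[OF D, of t] m1 mp by (cases "c' < H A t") auto
      then show ?case using c' by simp
    qed
  qed
  have "((\<lambda>t. exp (- B * exp (- de * t))) \<longlongrightarrow> exp (- B * 0)) at_top"
    by (intro tendsto_intros x_tendsto)
  then have "\<forall>\<^sub>F t in at_top. exp (- B * exp (- de * t)) > 1 / 2" by (intro order_tendstoD) auto
  then have "\<forall>\<^sub>F t in at_top. t > T \<and> H A t * exp (- B * exp (- de * t)) > K"
    using Hbig[of "2 * K"] eventually_gt_at_top[of T]
  proof eventually_elim
    case (elim t)
    have "2 * K * (1 / 2) < H A t * exp (- B * exp (- de * t))"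
      using elim K by (intro mult_strict_mono) auto
    then show ?case using elim by simp
  qed
  then obtain t2 where t2: "\<And>t. t \<ge> t2 \<Longrightarrow> t > T \<and> H A t * exp (- B * exp (- de * t)) > K"
    unfolding eventually_at_top_linorder by blast
  have dneg: "ga - rho A t \<le> 0" if "t \<ge> t2" for t
  proof -
    have "\<not> above B T K A t" using n by blast
    then have "ga - rho A t \<le> - (B * de * exp (- de * t))" using t2[OF that] D unfolding above_def by auto
    moreover have "B * de * exp (- de * t) > 0" using B de_pos by simp
    ultimately show ?thesis by linarith
  qed
  obtain t3 where t3: "\<And>t. t \<ge> t3 \<Longrightarrow> H A t > H A t2" using Hbig[of "H A t2"] unfolding eventually_at_top_linorder by blast
  have "H A (max t2 t3) \<le> H A t2"
  proof (rule DERIV_nonpos_imp_nonincreasing[of t2 "max t2 t3" "H A"])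
    fix x assume "t2 \<le> x"
    then have "H A x * (ga - rho A x) \<le> 0" using dneg H_pos[OF D, of x] by (intro mult_nonneg_nonpos) auto
    then show "\<exists>y. DERIV (H A) x :> y \<and> y \<le> 0" using H_deriv[OF D] by blast
  qed simp
  then show False using t3[of "max t2 t3"] by simp
qed

text \<open>The scheme of \<open>trichotomy\<close> with \<open>H\<close> and \<open>ga\<close> for
  \<open>X\<close> and \<open>nu\<close>. Outside the regions, \<open>H\<close> being away from
  \<open>K\<close> fixes the sign of \<open>ga - rho\<close> with at least the barrier width, so
  \<open>H\<close> does not move farther away. It cannot remain away, since the drift of
  \<open>rho\<close> would end in the wrong sign.\<close>

lemma K_limit:
  assumes g: "barrier_width K B" and K: "K > 0" and T: "barrier_start B T" and D: "\<And>t. D A t" and r: "\<And>t. rho A t \<ge> 0"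
    and nm: "\<And>t. \<not> below B K A t" and np: "\<And>t. \<not> above B T K A t"
  shows "(H A \<longlongrightarrow> K) at_top"
proof -
  have B: "B > 0" using g by (simp add: barrier_width_def)
  have Hp: "H A t > 0" for t using H_pos[OF D] .
  have Hd: "(H A has_real_derivative H A t * (ga - rho A t)) (at t)" for t using H_deriv[OF D] .
  have rd: "(rho A has_real_derivative rhod A t) (at t)" for t using rho_deriv'[OF D] .
  have bx: "B * de * exp (- de * t) > 0" for t using B de_pos by simp
  have low: "\<forall>\<^sub>F t in at_top. H A t \<ge> K - e" if e: "e > 0" for e
  proof (cases "K - e \<le> 0")
    case True
    have "K - e \<le> H A t" for t using True Hp[of t] by linarith
    then show ?thesis by simp
  next
    case False
    have "((\<lambda>t. (K - e) * exp (B * exp (- de * t))) \<longlongrightarrow> (K - e) * exp (B * 0)) at_top"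
      by (intro tendsto_intros x_tendsto)
    then have "\<forall>\<^sub>F t in at_top. (K - e) * exp (B * exp (- de * t)) < K" using e by (intro order_tendstoD) auto
    then obtain t0 where t0: "\<And>t. t \<ge> t0 \<Longrightarrow> (K - e) * exp (B * exp (- de * t)) < K"
      unfolding eventually_at_top_linorder by blast
    have dpos: "ga - rho A t \<ge> B * de * exp (- de * t)" if t: "t \<ge> t0" "H A t < K - e" for t
    proof -
      have "H A t * exp (B * exp (- de * t)) \<le> (K - e) * exp (B * exp (- de * t))" using t by simp
      then have "H A t * exp (B * exp (- de * t)) < K" using t0[OF t(1)] by linarith
      then show ?thesis using nm[of t] D[of t] unfolding below_def by (meson not_less)
    qed
    have "\<exists>t1\<ge>t0. H A t1 \<ge> K - e"
    proof (rule ccontr)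
      assume n: "\<not> ?thesis"
      then have Hs: "H A t < K - e" if "t \<ge> t0" for t using that by force
      have "\<exists>t\<ge>t0. rho A t > ga"
      proof (rule unbounded_above_of_deriv_ge_1[OF rd])
        fix t assume t: "t \<ge> t0"
        have HK: "H A t < K" using Hs[OF t] e by simp
        have "K powr (1 - m) \<le> H A t powr (1 - m)" using HK Hp[of t] m1 by (intro powr_mono2') auto
        then have "B / m * K powr (1 - m) \<le> B / m * H A t powr (1 - m)" using B m1 by (intro mult_left_mono) auto
        also have "\<dots> \<le> be * Lam A t / m * (ga - rho A t)"
          unfolding be_Lam[OF D, symmetric] using dpos[OF t Hs[OF t]] be_pos Lam_pos[OF D, of t] m1
          by (intro mult_left_mono) auto
        finally have "B / m * K powr (1 - m) \<le> be * Lam A t / m * (ga - rho A t)" .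
        moreover have "H A t powr (p - m) \<le> K powr (p - m)" using HK Hp[of t] mp by (intro powr_mono2) auto
        moreover have "B / m * K powr (1 - m) \<ge> (real N)^2 + K powr (p - m) + 1" using g by (simp add: barrier_width_def)
        ultimately show "rhod A t \<ge> 1" using rhod_lower[OF D, of t] by linarith
      qed
      then obtain t where "t \<ge> t0" "rho A t > ga" by blast
      then show False using dpos[of t] Hs[of t] bx[of t] by linarith
    qed
    then obtain t1 where t1: "t1 \<ge> t0" "H A t1 \<ge> K - e" by blast
    have "H A t \<ge> K - e" if "t \<ge> t1" for t
    proof (rule eventually_ge_of_nondecreasing_below[OF Hd _ t1 that])
      fix t assume "t \<ge> t0" "H A t < K - e"
      then have "ga - rho A t \<ge> 0" using dpos[of t] bx[of t] by linarith
      then show "H A t * (ga - rho A t) \<ge> 0" using Hp[of t] by simp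
    qed
    then show ?thesis unfolding eventually_at_top_linorder by blast
  qed
  have up: "\<forall>\<^sub>F t in at_top. H A t \<le> K + e" if e: "e > 0" for e
  proof -
    have "((\<lambda>t. (K + e) * exp (- B * exp (- de * t))) \<longlongrightarrow> (K + e) * exp (- B * 0)) at_top"
      by (intro tendsto_intros x_tendsto)
    then have "\<forall>\<^sub>F t in at_top. (K + e) * exp (- B * exp (- de * t)) > K" using e by (intro order_tendstoD) auto
    then have "\<forall>\<^sub>F t in at_top. t > T \<and> (K + e) * exp (- B * exp (- de * t)) > K"
      using eventually_gt_at_top[of T] by eventually_elim auto
    then obtain t0 where t0: "\<And>t. t \<ge> t0 \<Longrightarrow> t > T \<and> (K + e) * exp (- B * exp (- de * t)) > K"
      unfolding eventually_at_top_linorder by blast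
    have dneg: "ga - rho A t \<le> - (B * de * exp (- de * t))" if t: "t \<ge> t0" "H A t > K + e" for t
    proof -
      have "(K + e) * exp (- B * exp (- de * t)) \<le> H A t * exp (- B * exp (- de * t))" using t by simp
      then have "H A t * exp (- B * exp (- de * t)) > K" using t0[OF t(1)] by linarith
      then show ?thesis using np[of t] t0[OF t(1)] D[of t] unfolding above_def by (meson not_less)
    qed
    have "\<exists>t1\<ge>t0. H A t1 \<le> K + e"
    proof (rule ccontr)
      assume n: "\<not> ?thesis"
      then have Hs: "H A t > K + e" if "t \<ge> t0" for t using that by force
      \<comment> \<open>\<open>rhod_neg\<close> requires \<open>rho \<le> ga + 1\<close>; if
        \<open>rho\<close> stayed above that, \<open>H\<close> would decrease at the rate
        \<open>K\<close> at least and become negative.\<close>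
      have "\<exists>t\<ge>t0. ga - rho A t > -1"
      proof (rule ccontr)
        assume n2: "\<not> (\<exists>t\<ge>t0. ga - rho A t > -1)"
        have "\<exists>t\<ge>t0. H A t / K < 0"
        proof (rule unbounded_below_of_deriv_le_neg1)
          show "((\<lambda>t. H A t / K) has_real_derivative H A t * (ga - rho A t) / K) (at t)" for t
            using DERIV_cdivide[OF Hd] by blast
          fix t assume t: "t \<ge> t0"
          have "K * 1 \<le> H A t * (rho A t - ga)" using Hs[OF t] e K n2 t by (intro mult_mono) force+
          then show "H A t * (ga - rho A t) / K \<le> -1" using K by (simp add: divide_le_eq right_diff_distrib)
        qed
        then show False using Hp K by (simp add: divide_less_0_iff) (meson less_asym)
      qed
      then obtain s where s: "s \<ge> t0" "ga - rho A s > -1" by blast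
      have rn: "rhod A t \<le> -2" if "t \<ge> t0" "ga - rho A t \<ge> -1" for t
        using rhod_neg[OF g D r that(2) dneg[OF that(1) Hs[OF that(1)]]] .
      have near: "ga - rho A t + 1 > 0" if t: "t \<ge> s" for t
      proof (rule barrier[OF t, of "\<lambda>t. ga - rho A t + 1" "\<lambda>t. - rhod A t"])
        show "((\<lambda>t. ga - rho A t + 1) has_real_derivative - rhod A x) (at x)" for x
          using rd[of x] by (auto intro!: derivative_eq_intros)
        show "ga - rho A s + 1 > 0" using s by simp
        fix x assume "x \<in> {s..t}" "ga - rho A x + 1 = 0"
        then show "- rhod A x > 0" using rn[of x] s by force
      qed
      have "\<exists>t\<ge>s. rho A t < 0"
      proof (rule unbounded_below_of_deriv_le_neg1[OF rd])
        fix t assume t: "t \<ge> s"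
        have "rhod A t \<le> -2" using near[OF t] s t by (intro rn) auto
        then show "rhod A t \<le> -1" by simp
      qed
      then show False using r by (meson not_less)
    qed
    then obtain t1 where t1: "t1 \<ge> t0" "H A t1 \<le> K + e" by blast
    have "H A t \<le> K + e" if "t \<ge> t1" for t
    proof (rule eventually_le_of_nonincreasing_above[OF Hd _ t1 that])
      fix t assume "t \<ge> t0" "H A t > K + e"
      then have "ga - rho A t \<le> 0" using dneg[of t] bx[of t] by linarith
      then show "H A t * (ga - rho A t) \<le> 0" using Hp[of t] by (simp add: mult_le_0_iff)
    qed
    then show ?thesis unfolding eventually_at_top_linorder by blast
  qed
  show ?thesis
  proof (rule tendstoI)
    fix e :: real assume e: "e > 0"
    from low[of "e/2"] up[of "e/2"] e show "\<forall>\<^sub>F t in at_top. dist (H A t) K < e"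
      by (auto simp: dist_real_def elim: eventually_elim2)
  qed
qed

subsection \<open>Profiles\<close>

text \<open>A profile supplies \<open>G\<close> for each point separately; replacing it by
  \<open>deriv\<close> gives one function for all points, which can then be differentiated along an
  interval.\<close>

lemma profile_deriv:
  assumes f: "ss_profile N m p \<sigma> A f" and x: "x > 0" "f x > 0"
  obtains f1 where "(f has_real_derivative f1) (at x)"
    "((\<lambda>x. f x powr m) has_real_derivative deriv (\<lambda>x. f x powr m) x) (at x)"
    "(deriv (\<lambda>x. f x powr m) has_real_derivative
       - (real N - 1) / x * deriv (\<lambda>x. f x powr m) x - al * f x - be * x * f1 + x powr \<sigma> * f x powr p) (at x)"
proof -
  obtain f1 G G2 where g: "(f has_real_derivative f1) (at x)"
     "\<forall>y>0. f y > 0 \<longrightarrow> ((\<lambda>x. f x powr m) has_real_derivative G y) (at y)"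
     "(G has_real_derivative G2) (at x)"
     "G2 + (real N - 1) / x * G x + al * f x + be * x * f1 - x powr \<sigma> * f x powr p = 0"
    using f x unfolding ss_profile_def by blast
  have eq: "deriv (\<lambda>x. f x powr m) y = G y" if "y > 0" "f y > 0" for y
    using g(2) that by (intro DERIV_imp_deriv) auto
  have "isCont f x" using g(1) by (rule DERIV_isCont)
  then have "\<forall>\<^sub>F y in nhds x. f y > 0"
    using x(2) order_tendstoD(1)[of f "f x" "nhds x" 0] by (simp add: isCont_def tendsto_at_iff_tendsto_nhds)
  moreover have "\<forall>\<^sub>F y in nhds x. y \<in> {0<..}" using x by (intro eventually_nhds_in_open) auto
  ultimately have "\<forall>\<^sub>F y in nhds x. deriv (\<lambda>x. f x powr m) y = G y"
    by eventually_elim (simp add: eq)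
  then have "(deriv (\<lambda>x. f x powr m) has_real_derivative G2) (at x)"
    using DERIV_cong_ev[OF refl _ refl] g(3) by blast
  moreover have "G2 = - (real N - 1) / x * deriv (\<lambda>x. f x powr m) x - al * f x - be * x * f1 + x powr \<sigma> * f x powr p"
  proof -
    have "- (real N - 1) / x * G x = - ((real N - 1) / x * G x)" using x by (simp add: field_simps)
    then show ?thesis using g(4) unfolding eq[OF x] by linarith
  qed
  ultimately show thesis using that g(1,2) eq[OF x] x by simp
qed

text \<open>Integrating the equation in divergence form leaves a constant \<open>c\<close>, and
  \<open>c = 0\<close> is what the condition \<open>f'(0) = 0\<close> means. By the mean value
  theorem \<open>W x / x = c / z ^ (N - 1)\<close> with \<open>0 < z < x\<close>, of size at least
  \<open>\<bar>c\<bar>\<close> for \<open>x \<le> 1\<close>, whereas \<open>W\<close> has derivative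
  \<open>0\<close> at the origin.\<close>

lemma profile_imp_sol:
  assumes f: "ss_profile N m p \<sigma> A f" and A: "A > 0" and R: "R > 0" and pos: "\<And>x. x \<in> {0..R} \<Longrightarrow> f x > 0"
  shows "sol A R f"
proof -
  have cf: "continuous_on {0..R} f" and f0: "f 0 = A" and fd0: "(f has_real_derivative 0) (at 0 within {0..})"
    using f continuous_on_subset[of "{0..}" f "{0..R}"] by (auto simp: ss_profile_def)
  have pc: "pos_cont R f" using cf pos by (simp add: pos_cont_def)
  define G where "G = deriv (\<lambda>x. f x powr m)"
  have vd: "((\<lambda>x. f x powr m) has_real_derivative G x) (at x)" if "x \<in> {0<..R}" for x
    using profile_deriv[OF f, of x] pos[of x] that unfolding G_def by auto
  define Y where "Y x = x ^ (N - 1) * G x + be * x ^ N * f x - srcint f x" for x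
  have Yd: "(Y has_real_derivative 0) (at x)" if x: "x \<in> {0<..<R}" for x
  proof -
    obtain f1 where f1: "(f has_real_derivative f1) (at x)"
      "(G has_real_derivative - (real N - 1) / x * G x - al * f x - be * x * f1 + x powr \<sigma> * f x powr p) (at x)"
      using profile_deriv[OF f, of x] pos[of x] x unfolding G_def by auto
    have "((\<lambda>u. integral {0..u} (source f)) has_real_derivative source f x) (at x within {0..R})"
      using integral_has_real_derivative[OF source_cont[OF pc]] x by auto
    then have J: "(srcint f has_real_derivative source f x) (at x)"
      using x at_within_Icc_at[of 0 x R] unfolding srcint_def[abs_def] by simp
    have 1: "(Y has_real_derivative real (N - 1) * x ^ (N - 1 - 1) * G x + x ^ (N - 1) * (- (real N - 1) / x * G x - al * f x - be * x * f1 + x powr \<sigma> * f x powr p)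
       + (be * (real N * x ^ (N - 1)) * f x + be * x ^ N * f1) - source f x) (at x)"
      unfolding Y_def[abs_def]
      by (rule derivative_eq_intros f1 J refl | simp)+
    have 2: "real (N - 1) * x ^ (N - 1 - 1) = (real N - 1) * x ^ (N - 1) / x"
      using N1 x by (cases "N = 1") (auto simp: of_nat_diff power_eq_if)
    have 3: "x ^ N = x * x ^ (N - 1)" using pow_N[of x] by simp
    show ?thesis
      by (rule DERIV_cong[OF 1], unfold 2 3) (use x in \<open>simp add: source_def field_simps\<close>)
  qed
  obtain c where c: "\<And>x. x \<in> {0<..<R} \<Longrightarrow> Y x = c"
  proof -
    have "Y x = Y (R / 2)" if "x \<in> {0<..<R}" for x
      using that R Yd by (intro DERIV_isconst3[of 0 R x "R / 2" Y]) auto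
    then show thesis using that by blast
  qed
  have Geq: "G x = flux f x + c / x ^ (N - 1)" if x: "x \<in> {0<..<R}" for x
  proof -
    have "x ^ (N - 1) * G x = c + srcint f x - be * (x * x ^ (N - 1)) * f x"
      using c[OF x] pow_N[of x] by (simp add: Y_def)
    then show ?thesis using x by (simp add: flux_def field_simps)
  qed
  define W where "W x = f x powr m - volterra A f x" for x
  have Wd: "(W has_real_derivative c / x ^ (N - 1)) (at x)" if x: "x \<in> {0<..<R}" for x
  proof -
    have "(volterra A f has_real_derivative flux f x) (at x within {0..R})"
      using volterra_deriv[OF pc _ R] x by auto
    then have "(volterra A f has_real_derivative flux f x) (at x)"
      using x at_within_Icc_at[of 0 x R] by simp
    from DERIV_diff[OF vd this] x Geq[OF x] show ?thesis unfolding W_def[abs_def] by simp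
  qed
  have Wc: "continuous_on {0..R} W"
    unfolding W_def using volterra_cont[OF pc R] cf pos
    by (intro continuous_intros) (metis order_less_irrefl | auto)+
  have W0: "W 0 = 0" by (simp add: W_def f0)
  have W0d: "(W has_real_derivative 0) (at 0 within {0..R})"
  proof -
    have "(f has_real_derivative 0) (at 0 within {0..R})" using fd0 by (rule DERIV_subset) auto
    then have "((\<lambda>x. f x powr m) has_real_derivative m * f 0 powr (m - 1) * 0) (at 0 within {0..R})"
      using pos[of 0] R by (auto intro!: derivative_eq_intros)
    moreover have "(volterra A f has_real_derivative flux f 0) (at 0 within {0..R})"
      using volterra_deriv[OF pc _ R] R by auto
    ultimately show ?thesis using DERIV_diff unfolding W_def[abs_def] by (force simp: flux_def srcint_def)
  qed
  have mvt: "\<exists>z. z \<in> {0<..<x} \<and> W x = x * (c / z ^ (N - 1))" if x: "x \<in> {0<..R}" for x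
  proof -
    have "\<exists>l z. 0 < z \<and> z < x \<and> DERIV W z :> l \<and> W x - W 0 = (x - 0) * l"
    proof (rule MVT)
      show "continuous_on {0..x} W" using x by (intro continuous_on_subset[OF Wc]) auto
      show "W differentiable (at z)" if "0 < z" "z < x" for z
        using Wd[of z] x that by (auto simp: real_differentiable_def)
    qed (use x in auto)
    then obtain l z where z: "0 < z" "z < x" "DERIV W z :> l" "W x = x * l" using W0 by auto
    moreover have "l = c / z ^ (N - 1)" using DERIV_unique[OF z(3) Wd[of z]] z x by auto
    ultimately show ?thesis by auto
  qed
  have "c = 0"
  proof (rule ccontr)
    assume c0: "c \<noteq> 0"
    have "((\<lambda>x. (W x - W 0) / (x - 0)) \<longlongrightarrow> 0) (at 0 within {0..R})"
      using W0d by (simp add: has_field_derivative_iff)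
    then have "\<forall>\<^sub>F x in at 0 within {0..R}. dist ((W x - W 0) / (x - 0)) 0 < \<bar>c\<bar>"
      using c0 by (intro tendstoD) auto
    then obtain e where e: "e > 0" "\<And>x. x \<in> {0..R} \<Longrightarrow> x \<noteq> 0 \<Longrightarrow> dist x 0 < e \<Longrightarrow> \<bar>W x / x\<bar> < \<bar>c\<bar>"
      unfolding eventually_at W0 by (auto simp: dist_real_def)
    define x where "x = min (min (e / 2) 1) R"
    have x: "x \<in> {0<..R}" "x < e" "x \<le> 1" using e R by (auto simp: x_def)
    obtain z where z: "z \<in> {0<..<x}" "W x = x * (c / z ^ (N - 1))" using mvt[OF x(1)] by blast
    have "z ^ (N - 1) \<le> 1" "z ^ (N - 1) > 0" using z x by (auto intro: power_le_one)
    then have "\<bar>c\<bar> \<le> \<bar>c\<bar> / z ^ (N - 1)" by (simp add: le_divide_eq mult_left_le)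
    also have "\<dots> = \<bar>W x / x\<bar>" using z x \<open>z ^ (N - 1) > 0\<close> by (simp add: abs_mult)
    also have "\<dots> < \<bar>c\<bar>" using e(2)[of x] x by auto
    finally show False by simp
  qed
  then have "W x = 0" if "x \<in> {0..R}" for x using mvt[of x] W0 that by (cases "x = 0") auto
  then show ?thesis using A R pc by (simp add: sol_def W_def)
qed

lemma global_F_deriv_0:
  assumes d: "solvable A 1" shows "(F A has_real_derivative 0) (at 0 within {0..})"
proof -
  have s: "sol A 1 (F A)" using F_sol[OF d] .
  have pc: "pos_cont 1 (F A)" using s by (simp add: sol_def)
  have "(volterra A (F A) has_real_derivative flux (F A) 0) (at 0 within {0..1})"
    using volterra_deriv[OF pc] by auto
  then have "(volterra A (F A) has_real_derivative 0) (at 0 within {0..1})"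
    by (simp add: flux_def srcint_def)
  then have v: "((\<lambda>x. F A x powr m) has_real_derivative 0) (at 0 within {0..1})"
    by (rule has_field_derivative_transform_within[OF _ zero_less_one]) (use s in \<open>auto simp: sol_def\<close>)
  define v where "v x = F A x powr m" for x
  have "v 0 > 0" using F_pos[OF d, of 0] by (simp add: v_def)
  then have vm: "((\<lambda>x. v x powr (1/m)) has_real_derivative 0) (at 0 within {0..1})"
    using v[folded v_def] by (auto intro!: derivative_eq_intros)
  have vF: "v x powr (1/m) = F A x" if "x \<in> {0..1}" for x
    using F_pos[OF d that] m1 by (simp add: v_def powr_powr)
  have "(F A has_real_derivative 0) (at 0 within {0..1})"
    by (rule has_field_derivative_transform_within[OF vm zero_less_one _ vF]) simp_all
  moreover have "at (0::real) within {0..1} = at 0 within {0..}"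
    by (rule at_within_nhd[of _ "{..<1}"]) auto
  ultimately show ?thesis by simp
qed

lemma F_profile:
  assumes g: "\<And>R. R > 0 \<Longrightarrow> solvable A R"
  shows "ss_profile N m p \<sigma> A (F A)"
proof -
  have Fp: "F A y > 0" if "y \<ge> 0" for y using F_pos[OF g[of "y + 1"], of y] that by simp
  show ?thesis unfolding ss_profile_def
  proof (intro conjI allI impI)
    show "(F A has_real_derivative 0) (at 0 within {0..})" using global_F_deriv_0 g by simp
    show "continuous_on {0..} (F A)" using F_cont_global[OF g] .
    fix x :: real assume x: "x > 0"
    show "\<exists>f1 G G2. (F A has_real_derivative f1) (at x) \<and>
      (\<forall>\<eta>>0. 0 < F A \<eta> \<longrightarrow> ((\<lambda>x. F A x powr m) has_real_derivative G \<eta>) (at \<eta>)) \<and>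
      (G has_real_derivative G2) (at x) \<and>
      G2 + (real N - 1) / x * G x + al * F A x + be * x * f1 - x powr \<sigma> * F A x powr p = 0"
      by (rule exI[of _ "FG A x * F A x / (m * F A x powr m)"], rule exI[of _ "FG A"],
          rule exI[of _ "- al * F A x - be * x * (FG A x * F A x / (m * F A x powr m)) + x powr \<sigma> * F A x powr p - (real N - 1) / x * FG A x"])
         (use F_deriv[OF g[OF x]] Fm_deriv[OF g] FG_deriv[OF g[OF x]] in auto)
  qed (use Fp in \<open>auto intro: less_imp_le simp: less_le\<close>)
qed

lemma profile_pos_eq:
  assumes f: "ss_profile N m p \<sigma> A f" and A: "A > 0" and pos: "\<And>x. x \<ge> 0 \<Longrightarrow> f x > 0"
  shows "R > 0 \<Longrightarrow> solvable A R" "x \<ge> 0 \<Longrightarrow> f x = F A x"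
proof -
  have s: "sol A R f" if "R > 0" for R using profile_imp_sol[OF f A that] pos by auto
  show "R > 0 \<Longrightarrow> solvable A R" using s by (auto simp: solvable_def)
  show "x \<ge> 0 \<Longrightarrow> f x = F A x" using F_eq[OF s[of "x + 1"], of x] by auto
qed

text \<open>A profile is only known to be nonnegative, so it might vanish. Up to a first zero it
  agrees with \<open>F A\<close>, and by continuity it would take the positive value of
  \<open>F A\<close> there.\<close>

lemma global_profile_unique:
  assumes g: "\<And>R. R > 0 \<Longrightarrow> solvable A R" and f: "ss_profile N m p \<sigma> A f" and x: "x \<ge> 0"
  shows "f x = F A x"
proof -
  have A: "A > 0" using solvable_pos(1)[OF g[of 1]] by simp
  have cf: "continuous_on {0..} f" and f0: "f 0 = A" and nn: "\<And>x. x \<ge> 0 \<Longrightarrow> f x \<ge> 0"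
    using f by (auto simp: ss_profile_def)
  have "f y > 0" if y: "y \<ge> 0" for y
  proof (rule ccontr)
    assume n: "\<not> f y > 0"
    then obtain z where z: "z \<in> {0<..y}" "f z = 0" "\<forall>w\<in>{0..<z}. f w > 0"
      using first_zero[of 0 y f] y continuous_on_subset[OF cf, of "{0..y}"] f0 A by auto
    then have z0: "z > 0" "f z = 0" by auto
    have eq: "f w = F A w" if w: "w \<in> {0<..<z}" for w
    proof -
      have "sol A w f" using w z(3) by (intro profile_imp_sol[OF f A]) auto
      then show ?thesis using F_eq[of A w f w] w by auto
    qed
    have "F A z > 0" using F_pos[OF g[OF z0(1)], of z] z0 by auto
    have c: "continuous_on {0..z} (\<lambda>w. f w - F A w)"
      using continuous_on_subset[OF cf, of "{0..z}"] F_cont[OF g[OF z0(1)]] by (intro continuous_intros) auto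
    have "f z - F A z = 0"
    proof (rule continuous_constant_on_closure[of "{0<..<z}" "\<lambda>w. f w - F A w" 0 z])
      show "continuous_on (closure {0<..<z}) (\<lambda>w. f w - F A w)" using c z0 by simp
    qed (use eq z0 in auto)
    then show False using z0 \<open>F A z > 0\<close> by simp
  qed
  then show ?thesis using profile_pos_eq(2)[OF f A] x by blast
qed

section \<open>Limits at infinity as properties of the initial value\<close>

lemma lim_F_iff_E:
  fixes q L :: real
  shows "((\<lambda>x. x powr q * F A x) \<longlongrightarrow> L) at_top \<longleftrightarrow> ((\<lambda>t. exp (q * t) * E A t) \<longlongrightarrow> L) at_top"
proof
  assume "((\<lambda>x. x powr q * F A x) \<longlongrightarrow> L) at_top"
  from filterlim_compose[OF this exp_at_top] show "((\<lambda>t. exp (q * t) * E A t) \<longlongrightarrow> L) at_top"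
    by (simp add: E_def powr_def)
next
  assume "((\<lambda>t. exp (q * t) * E A t) \<longlongrightarrow> L) at_top"
  from filterlim_compose[OF this ln_at_top] have "((\<lambda>x. exp (q * ln x) * E A (ln x)) \<longlongrightarrow> L) at_top" .
  moreover have "\<forall>\<^sub>F x in at_top. exp (q * ln x) * E A (ln x) = x powr q * F A x"
    using eventually_gt_at_top[of "0::real"] by eventually_elim (simp add: E_def powr_def)
  ultimately show "((\<lambda>x. x powr q * F A x) \<longlongrightarrow> L) at_top" using tendsto_cong by fast
qed

definition has_lim :: "real \<Rightarrow> real \<Rightarrow> real \<Rightarrow> bool" where
  "has_lim q L A \<longleftrightarrow> (\<exists>f. ss_profile N m p \<sigma> A f) \<and>
     (\<forall>f. ss_profile N m p \<sigma> A f \<longrightarrow> ((\<lambda>x. x powr q * f x) \<longlongrightarrow> L) at_top)"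

text \<open>A positive limit excludes extinction, since a profile that vanishes once stays zero. A
  finite limit excludes turning up: once \<open>rho\<close> is negative it remains so, and a
  nondecreasing \<open>f\<close> times \<open>x powr q\<close> is unbounded.\<close>

lemma has_lim_iff:
  assumes A: "A > 0" and q: "q > 0" and L: "L > 0"
  shows "has_lim q L A \<longleftrightarrow> (\<forall>t. D A t \<and> rho A t \<ge> 0) \<and> ((\<lambda>x. x powr q * F A x) \<longlongrightarrow> L) at_top"
proof
  assume "has_lim q L A"
  then obtain f where f: "ss_profile N m p \<sigma> A f" "((\<lambda>x. x powr q * f x) \<longlongrightarrow> L) at_top"
    by (auto simp: has_lim_def)
  have nn: "\<And>x. x \<ge> 0 \<Longrightarrow> f x \<ge> 0" and f0: "f 0 = A"
    and z: "\<And>x y. x > 0 \<Longrightarrow> f x = 0 \<Longrightarrow> y \<ge> x \<Longrightarrow> f y = 0"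
    using f(1) by (auto simp: ss_profile_def)
  have ev: "\<forall>\<^sub>F x in at_top. x powr q * f x > 0" using f(2) L by (rule order_tendstoD)
  have pos: "f x > 0" if x: "x \<ge> 0" for x
  proof (rule ccontr)
    assume n: "\<not> f x > 0"
    then have fx: "f x = 0" "x > 0" using nn[OF x] f0 A x by (auto simp: order.order_iff_strict)
    obtain y where "y powr q * f y > 0" "y \<ge> x"
      using eventually_happens[OF eventually_conj[OF ev eventually_ge_at_top[of x]]] by auto
    then show False using z[OF fx(2,1)] by simp
  qed
  have solvable: "\<And>R. R > 0 \<Longrightarrow> solvable A R" and eq: "\<And>x. x \<ge> 0 \<Longrightarrow> f x = F A x"
    using profile_pos_eq[OF f(1) A pos] by auto
  have D: "D A t" for t using solvable by (simp add: D_def)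
  have "\<forall>\<^sub>F x in at_top. x powr q * f x = x powr q * F A x"
    using eventually_ge_at_top[of "0::real"] by eventually_elim (simp add: eq)
  then have lim: "((\<lambda>x. x powr q * F A x) \<longlongrightarrow> L) at_top" using f(2) tendsto_cong by fast
  have "rho A t \<ge> 0" for t
  proof (rule ccontr)
    assume n: "\<not> rho A t \<ge> 0"
    have inc: "E A t \<le> E A s" if s: "s \<ge> t" for s
    proof (rule DERIV_nonneg_imp_nondecreasing[OF s])
      fix x assume x: "t \<le> x" "x \<le> s"
      have "rho A x < 0" using rho_neg_forward[OF D x(1)] n by simp
      then have "- rho A x * E A x \<ge> 0" using E_pos[OF D, of x] by (intro mult_nonneg_nonneg) auto
      then show "\<exists>y. DERIV (E A) x :> y \<and> 0 \<le> y" using E_deriv[OF D] by blast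
    qed
    have lE: "((\<lambda>t. exp (q * t) * E A t) \<longlongrightarrow> L) at_top" using lim lim_F_iff_E by blast
    define k where "k = (L + 1) / E A t"
    have k: "k > 0" using E_pos[OF D, of t] L by (simp add: k_def)
    have "\<forall>\<^sub>F s in at_top. exp (q * s) * E A s < L + 1" using lE by (rule order_tendstoD) simp
    then have "\<forall>\<^sub>F s in at_top. exp (q * s) * E A s < L + 1 \<and> s \<ge> t \<and> s \<ge> ln k / q"
      by (intro eventually_conj eventually_ge_at_top)
    then obtain s where s: "exp (q * s) * E A s < L + 1" "s \<ge> t" "s \<ge> ln k / q"
      using eventually_happens by force
    have "ln k \<le> q * s" using s q by (simp add: divide_le_eq mult.commute)
    then have "k \<le> exp (q * s)" using k by (metis exp_le_cancel_iff exp_ln)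
    then have "k * E A t \<le> exp (q * s) * E A s"
      using inc[OF s(2)] E_pos[OF D, of t] by (intro mult_mono) auto
    then have "L + 1 \<le> exp (q * s) * E A s" using E_pos[OF D, of t] by (simp add: k_def)
    then show False using s by simp
  qed
  then show "(\<forall>t. D A t \<and> rho A t \<ge> 0) \<and> ((\<lambda>x. x powr q * F A x) \<longlongrightarrow> L) at_top"
    using D lim by blast
next
  assume a: "(\<forall>t. D A t \<and> rho A t \<ge> 0) \<and> ((\<lambda>x. x powr q * F A x) \<longlongrightarrow> L) at_top"
  have solvable: "solvable A R" if R: "R > 0" for R
  proof -
    have "D A (ln R)" using a by blast
    then show ?thesis using R by (simp add: D_def)
  qed
  have "((\<lambda>x. x powr q * f x) \<longlongrightarrow> L) at_top" if f: "ss_profile N m p \<sigma> A f" for f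
  proof -
    have "\<forall>\<^sub>F x in at_top. x powr q * f x = x powr q * F A x"
      using eventually_ge_at_top[of "0::real"] by eventually_elim (simp add: global_profile_unique[OF solvable f])
    then show ?thesis using a tendsto_cong by fast
  qed
  then show "has_lim q L A" using F_profile[OF solvable] by (auto simp: has_lim_def)
qed

lemma has_lim_unique:
  assumes A: "A1 > 0" "A2 > 0" and q: "q > 0" and L: "L > 0" and h: "has_lim q L A1" "has_lim q L A2"
  shows "A1 = A2"
proof -
  have no: "\<not> a < b" if ab: "a > 0" "b > 0" "has_lim q L a" "has_lim q L b" for a b
  proof
    assume lt: "a < b"
    have ha: "\<And>t. D a t" "((\<lambda>x. x powr q * F a x) \<longlongrightarrow> L) at_top"
      and hb: "\<And>t. D b t" "\<And>t. rho b t \<ge> 0" "((\<lambda>x. x powr q * F b x) \<longlongrightarrow> L) at_top"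
      using ab has_lim_iff[OF _ q L] by auto
    have solvable: "solvable a R" "solvable b R" if R: "R > 0" for R
      using ha(1)[of "ln R"] hb(1)[of "ln R"] R by (simp_all add: D_def)
    show False
    proof (rule sliding[OF solvable(1) solvable(2) lt])
      fix x y :: real assume xy: "0 \<le> x" "x \<le> y"
      show "F b y \<le> F b x" using F_antimono[OF solvable(2)[of "y + 1"] hb(2), of x y] xy by simp
    next
      have "((\<lambda>x. (x powr q * F b x) / (x powr q * F a x)) \<longlongrightarrow> L / L) at_top"
        using ha(2) hb(3) L by (intro tendsto_divide) auto
      moreover have "\<forall>\<^sub>F x in at_top. (x powr q * F b x) / (x powr q * F a x) = F b x / F a x"
        using eventually_gt_at_top[of "0::real"] by eventually_elim simp
      ultimately have "((\<lambda>x. F b x / F a x) \<longlongrightarrow> L / L) at_top" using tendsto_cong by fast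
      then show "((\<lambda>x. F b x / F a x) \<longlongrightarrow> 1) at_top" using L by simp
    qed
  qed
  show ?thesis using no[OF A h] no[OF A(2,1) h(2,1)] by simp
qed

definition critical_const :: real where "critical_const = (1 / (p - 1)) powr (1 / (p - 1))"

lemma Cst_pos: "critical_const > 0" using m1 mp by (simp add: critical_const_def)

lemma critical_iff_has_lim: assumes A: "A > 0" shows "critical A \<longleftrightarrow> has_lim nu critical_const A"
proof -
  have eq: "(X A \<longlongrightarrow> ka) at_top \<longleftrightarrow> ((\<lambda>t. exp (nu * t) * E A t) \<longlongrightarrow> critical_const) at_top" if D: "\<And>t. D A t"
  proof -
    have "(p - 1) * nu = \<sigma>" using m1 mp by (simp add: nu_def)
    then have XE: "X A t = (exp (nu * t) * E A t) powr (p - 1)" for t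
      using E_pos[OF D, of t] mult_exp_powr[of "E A t" "nu * t" "p - 1"]
      by (simp add: X_def mult.commute mult.left_commute)
    have EX: "exp (nu * t) * E A t = X A t powr (1 / (p - 1))" for t
      unfolding XE using E_pos[OF D, of t] m1 mp by (simp add: powr_powr)
    have Ck: "critical_const powr (p - 1) = ka" "ka powr (1 / (p - 1)) = critical_const" using m1 mp by (simp_all add: critical_const_def ka_def powr_powr)
    show ?thesis
    proof
      assume "(X A \<longlongrightarrow> ka) at_top"
      then have "((\<lambda>t. X A t powr (1 / (p - 1))) \<longlongrightarrow> ka powr (1 / (p - 1))) at_top"
        using ka_pos by (intro tendsto_powr tendsto_const) auto
      then show "((\<lambda>t. exp (nu * t) * E A t) \<longlongrightarrow> critical_const) at_top" using Ck by (simp add: EX)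
    next
      assume "((\<lambda>t. exp (nu * t) * E A t) \<longlongrightarrow> critical_const) at_top"
      then have "((\<lambda>t. (exp (nu * t) * E A t) powr (p - 1)) \<longlongrightarrow> critical_const powr (p - 1)) at_top"
        using Cst_pos by (intro tendsto_powr tendsto_const) auto
      then show "(X A \<longlongrightarrow> ka) at_top" using Ck by (simp add: XE[abs_def])
    qed
  qed
  show ?thesis unfolding has_lim_iff[OF A nu_pos Cst_pos] critical_def lim_F_iff_E using A eq by auto
qed

lemma critical_unique: "critical A \<Longrightarrow> critical B \<Longrightarrow> A = B"
  using has_lim_unique[OF _ _ nu_pos Cst_pos] critical_iff_has_lim unfolding critical_def by blast

section \<open>Selection of the initial value by connectedness\<close>

lemma connected_split:
  fixes S :: "real set"
  assumes S: "connected S" and P: "\<And>x. P x \<Longrightarrow> \<forall>\<^sub>F y in nhds x. P y" and Q: "\<And>x. Q x \<Longrightarrow> \<forall>\<^sub>F y in nhds x. Q y"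
    and a: "a \<in> S" "P a" and b: "b \<in> S" "Q b" and dis: "\<And>x. x \<in> S \<Longrightarrow> P x \<Longrightarrow> Q x \<Longrightarrow> False"
  shows "\<exists>x\<in>S. \<not> P x \<and> \<not> Q x"
proof (rule ccontr)
  assume "\<not> ?thesis"
  then have "S \<subseteq> {x. P x} \<union> {x. Q x}" by blast
  moreover have "{x. P x} \<inter> {x. Q x} \<inter> S = {}" using dis by blast
  ultimately show False
    using connectedD[OF S open_Collect_nhds[OF P] open_Collect_nhds[OF Q]] a b by blast
qed

lemma fast_ex_open: "\<exists>t. fast A t \<Longrightarrow> \<forall>\<^sub>F A' in nhds A. \<exists>t. fast A' t"
  by (elim exE) (drule fast_open, auto elim: eventually_mono)

lemma below_ex_open: "\<exists>t. below B K A t \<Longrightarrow> \<forall>\<^sub>F A' in nhds A. \<exists>t. below B K A' t"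
  by (elim exE) (drule below_open, auto elim: eventually_mono)

lemma above_ex_open: "\<exists>t. above B T K A t \<Longrightarrow> \<forall>\<^sub>F A' in nhds A. \<exists>t. above B T K A' t"
  by (elim exE) (drule above_open, auto elim: eventually_mono)

lemma not_turns_up_small: obtains \<epsilon> where "\<epsilon> > 0" "\<And>A. 0 < A \<Longrightarrow> A < \<epsilon> \<Longrightarrow> \<not> turns_up A"
proof -
  obtain B where "barrier_width 1 B" using barrier_width_exists[of 1] by auto
  then obtain \<epsilon> where "\<epsilon> > 0" "\<And>A. 0 < A \<Longrightarrow> A < \<epsilon> \<Longrightarrow> (\<exists>t. below B 1 A t) \<and> \<not> turns_up A"
    using small_below[of 1 B] by auto
  then show thesis using that by blast
qed

lemma critical_exists: obtains A where "critical A"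
proof (rule ccontr)
  assume n: "\<not> thesis"
  then have nC: "\<not> critical A" for A using that by blast
  obtain \<epsilon> where e: "\<epsilon> > 0" "\<And>A. 0 < A \<Longrightarrow> A < \<epsilon> \<Longrightarrow> \<not> turns_up A" using not_turns_up_small by blast
  obtain A0 where A0: "\<And>A. A \<ge> A0 \<Longrightarrow> turns_up A" using turns_up_large by blast
  \<comment> \<open>Small data do not turn up, and nothing is critical by assumption, so the
    trichotomy leaves only \<open>fast\<close>.\<close>
  have "\<exists>t. fast (\<epsilon> / 2) t" using trichotomy[of "\<epsilon> / 2"] e nC by fastforce
  then have "\<exists>A\<in>{0<..}. \<not> (\<exists>t. fast A t) \<and> \<not> turns_up A"
    using e(1) A0[of "max A0 1"]
    by (intro connected_split[of _ _ _ "\<epsilon> / 2" "max A0 1"] fast_ex_open turns_up_open) (auto dest: fast_not_turns_up)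
  then show False using trichotomy nC by auto
qed

text \<open>If some \<open>A\<close> in \<open>(0, C)\<close> turned up, connectedness between it
  and a small, \<open>fast\<close> value would produce a second critical value, against the
  uniqueness obtained by sliding.\<close>

lemma not_turns_up_below_critical:
  assumes c: "critical C" and A: "0 < A" "A < C"
  shows "\<not> turns_up A"
proof
  assume I: "turns_up A"
  obtain \<epsilon> where e: "\<epsilon> > 0" "\<And>A. 0 < A \<Longrightarrow> A < \<epsilon> \<Longrightarrow> \<not> turns_up A" using not_turns_up_small by blast
  define a where "a = min (\<epsilon> / 2) (C / 2)"
  have a: "0 < a" "a < \<epsilon>" "a < C" using e c by (auto simp: a_def critical_def)
  have "\<exists>t. fast a t" using trichotomy[of a] e a critical_unique[OF c, of a] by fastforce
  then have "\<exists>A\<in>{0<..<C}. \<not> (\<exists>t. fast A t) \<and> \<not> turns_up A"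
    using a A I by (intro connected_split[of _ _ _ a A] fast_ex_open turns_up_open) (auto dest: fast_not_turns_up)
  then obtain b where "b \<in> {0<..<C}" "\<not> (\<exists>t. fast b t)" "\<not> turns_up b" by blast
  then show False using trichotomy[of b] critical_unique[OF c, of b] by auto
qed

lemma K_exists:
  assumes c: "critical C" and K: "K > 0"
  shows "\<exists>A. 0 < A \<and> A < C \<and> has_lim ga K A"
proof -
  obtain B where g: "barrier_width K B" using barrier_width_exists[OF K] .
  have B: "B > 0" using g by (simp add: barrier_width_def)
  obtain T where T: "barrier_start B T" using barrier_start_exists[OF B] .
  obtain \<epsilon> where e: "\<epsilon> > 0" "\<And>A. 0 < A \<Longrightarrow> A < \<epsilon> \<Longrightarrow> (\<exists>t. below B K A t) \<and> \<not> turns_up A"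
    using small_below[OF g K] by blast
  have C: "C > 0" using c by (simp add: critical_def)
  define a where "a = min (\<epsilon> / 2) (C / 2)"
  have a: "0 < a" "a < \<epsilon>" "a < C" using e C by (auto simp: a_def)
  have "\<exists>t. below B K a t" using e a by blast
  moreover have "\<exists>t. above B T K C t" using critical_above[OF g K T c] .
  \<comment> \<open>The interval includes \<open>C\<close> because the critical solution is the
    witness for \<open>above\<close>; for the same reason the value found differs from
    \<open>C\<close>.\<close>
  ultimately have "\<exists>A\<in>{0<..C}. \<not> (\<exists>t. below B K A t) \<and> \<not> (\<exists>t. above B T K A t)"
    using a C by (intro connected_split[of _ _ _ a C] below_ex_open above_ex_open) (auto dest: below_above_disjoint[OF g K T])
  then obtain A where A: "0 < A" "A \<le> C" "\<And>t. \<not> below B K A t" "\<And>t. \<not> above B T K A t" by auto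
  have AC: "A < C" using A critical_above[OF g K T c] by (cases "A = C") auto
  have "\<not> turns_up A" using not_turns_up_below_critical[OF c A(1) AC] .
  then have r0: "\<And>t. D A t \<Longrightarrow> rho A t \<ge> 0" by (force simp: turns_up_def)
  have D: "D A t" for t using extinction_below[OF K B A(1) _ r0] A(3) by blast
  have r: "rho A t \<ge> 0" for t using r0 D by blast
  have "(H A \<longlongrightarrow> K) at_top" using K_limit[OF g K T D r A(3,4)] .
  then have "has_lim ga K A"
    unfolding has_lim_iff[OF A(1) ga_pos K] lim_F_iff_E using D r by (simp add: H_def[abs_def])
  then show ?thesis using A AC by blast
qed

lemma critical_and_tail_amplitudes:
  "\<exists>C. (0 < C \<and> has_lim nu critical_const C) \<and> (\<forall>A. 0 < A \<and> has_lim nu critical_const A \<longrightarrow> A = C) \<and>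
    (\<forall>K>0. \<exists>!A. 0 < A \<and> A < C \<and> has_lim ga K A)"
proof -
  obtain C where c: "critical C" using critical_exists .
  have C: "C > 0" using c by (simp add: critical_def)
  have hC: "has_lim nu critical_const C" using c critical_iff_has_lim[OF C] by simp
  show ?thesis
  proof (intro exI[of _ C] conjI allI impI)
    fix A assume "0 < A \<and> has_lim nu critical_const A"
    then show "A = C" using has_lim_unique[OF _ C nu_pos Cst_pos _ hC] by blast
  next
    fix K :: real assume K: "K > 0"
    then obtain A where A: "0 < A" "A < C" "has_lim ga K A" using K_exists[OF c] by blast
    show "\<exists>!A. 0 < A \<and> A < C \<and> has_lim ga K A"
      using A has_lim_unique[OF _ _ ga_pos K] by (intro ex1I[of _ A]) blast+
  qed (use C hC in auto)
qed

end

theorem theorem2p1: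
  fixes N :: nat and m p \<sigma> :: real
  assumes "N \<ge> 1" and "1 < m" and "m < p" and "\<sigma> > 0"
  shows "\<exists>Astar.
     (0 < Astar \<and> (\<exists>f. ss_profile N m p \<sigma> Astar f) \<and>
      (\<forall>f. ss_profile N m p \<sigma> Astar f \<longrightarrow>
         ((\<lambda>\<xi>. \<xi> powr (\<sigma> / (p - 1)) * f \<xi>) \<longlongrightarrow> (1 / (p - 1)) powr (1 / (p - 1))) at_top)) \<and>
     (\<forall>A. (0 < A \<and> (\<exists>f. ss_profile N m p \<sigma> A f) \<and>
        (\<forall>f. ss_profile N m p \<sigma> A f \<longrightarrow>
           ((\<lambda>\<xi>. \<xi> powr (\<sigma> / (p - 1)) * f \<xi>) \<longlongrightarrow> (1 / (p - 1)) powr (1 / (p - 1))) at_top))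
        \<longrightarrow> A = Astar) \<and>
     (\<forall>K>0. \<exists>!AK. 0 < AK \<and> AK < Astar \<and> (\<exists>f. ss_profile N m p \<sigma> AK f) \<and>
        (\<forall>f. ss_profile N m p \<sigma> AK f \<longrightarrow>
           ((\<lambda>\<xi>. \<xi> powr ((\<sigma> + 2) / (p - m)) * f \<xi>) \<longlongrightarrow> K) at_top))"
proof -
  interpret ss_ode N m p \<sigma> using assms by unfold_locales
  show ?thesis using critical_and_tail_amplitudes unfolding has_lim_def nu_def critical_const_def ga_def by blast
qed

end
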